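(* Let $V$ be a simple Euclidean Jordan algebra with symmetric cone $\Omega$, let $\sigma$ be an involutive Jordan automorphism of $V$, and let $\Omega_\sigma^\pm$, $d^\pm$, $f_\sigma$ and $d_\sigma$ be as defined in the context. Then the metric space $(\Omega,d_\sigma)$ is Hadamard, and the map $$f_\sigma:\Bigl(\Omega_\sigma^+\times\Omega_\sigma^-,\ \bigl((a_1,b_1),(a_2,b_2)\bigr)\mapsto\bigl(d^+(a_1,a_2)^2+d^-(b_1,b_2)^2\bigr)^{1/2}\Bigr)\to(\Omega,d_\sigma)$$ is an isometry. Moreover, if $x=f_\sigma(a_1,b_1)$ and $y=f_\sigma(a_2,b_2)$, then the unique $d_\sigma$-geodesic joining $x$ and $y$ is $$m_\sigma(t;x,y):=f_\sigma(a_1\mathbin{\#_t}a_2,\ b_1\mathbin{\#_t}b_2),\qquad 0\le t\le1.$$ In particular, the midpoint is $m_\sigma(x,y):=m_\sigma(\tfrac12;x,y)=f_\sigma(a_1\mathbin{\#}a_2,\ b_1\mathbin{\#}b_2)$; that is, $$m_\sigma(x,y)=P(a_*^{1/2})\,b_*,$$ where $$a_*=\bigl(x\mathbin{\#}\sigma(x)\bigr)\mathbin{\#}\bigl(y\mathbin{\#}\sigma(y)\bigr),\qquad b_*=\bigl(x\mathbin{\natural}\sigma(x^{-1})\bigr)\mathbin{\#}\bigl(y\mathbin{\natural}\sigma(y^{-1})\bigr).$$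
   Context: A Euclidean Jordan algebra is a finite-dimensional real inner product space $V$ with a bilinear product $(x,y)\mapsto xy$ satisfying $xy=yx$, $x(x^2y)=x^2(xy)$, $\langle xy,z\rangle=\langle y,xz\rangle$, and having a unit element $e$; it is simple if it has no nontrivial ideals. Its symmetric cone is $\Omega=\operatorname{int}\{x^2:x\in V\}$. For $x\in V$, $L(x)y=xy$ and $P(x)=2L(x)^2-L(x^2)$ (quadratic representation). Every $x\in V$ has a spectral decomposition $x=\sum_{j=1}^r\lambda_jc_j$, with $(c_1,\dots,c_r)$ a Jordan frame (pairwise orthogonal primitive idempotents with sum $e$) and $\lambda_j\in\mathbb R$ the spectral values; for $x\in\Omega$ all $\lambda_j>0$ and $x^\alpha=\sum_j\lambda_j^\alpha c_j$ for $\alpha\in\mathbb R$ (so $x^{-1}$ is the Jordan inverse). The cone carries the distance $d(a,b)=\bigl(\sum_{i=1}^r\log^2\lambda_i\bigr)^{1/2}$, where $\lambda_1,\dots,\lambda_r$ are the spectral values of $P(a^{-1/2})b$. It is the distance of the Riemannian metric $\mathsf g_x(u,v)=\langle P(x^{-1})u,v\rangle$, with $\langle u,v\rangle=\operatorname{tr}(uv)$ and $\operatorname{tr}$ the sum of the spectral values. For $a,b\in\Omega$ and $t\in\mathbb R$, $a\mathbin{\#_t}b=P(a^{1/2})\bigl(P(a^{-1/2})b\bigr)^{t}$, $a\mathbin{\#}b=a\mathbin{\#_{1/2}}b$ (metric geometric mean), and $a\mathbin{\natural}b=P\bigl((a^{-1}\mathbin{\#}b)^{1/2}\bigr)a$ (spectral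 geometric mean). An involutive Jordan automorphism is a linear bijection $\sigma:V\to V$ with $\sigma(xy)=\sigma(x)\sigma(y)$ and $\sigma^2=\operatorname{id}$. Set $\Omega_\sigma^+=\{a\in\Omega:\sigma(a)=a\}$, $\Omega_\sigma^-=\{b\in\Omega:\sigma(b)=b^{-1}\}$, and let $d^\pm$ be the restriction of $d$ to $\Omega_\sigma^\pm$ (this is also the intrinsic distance, as $\Omega_\sigma^\pm$ are totally geodesic). The map $f_\sigma:\Omega_\sigma^+\times\Omega_\sigma^-\to\Omega$, $f_\sigma(a,b)=P(a^{1/2})b$, is a bijection with inverse $x\mapsto(x\mathbin{\#}\sigma(x),\,x\mathbin{\natural}\sigma(x^{-1}))$. For $x=f_\sigma(a_1,b_1)$, $y=f_\sigma(a_2,b_2)$ define $$d_\sigma(x,y)=\bigl(d^+(a_1,a_2)^2+d^-(b_1,b_2)^2\bigr)^{1/2}.$$ A Hadamard metric space is a complete metric space $(M,\delta)$ satisfying the semiparallelogram law: for all $x,y\in M$ there is $m\in M$ with $\delta(m,z)^2\le\frac12\delta(x,z)^2+\frac12\delta(y,z)^2-\frac14\delta(x,y)^2$ for all $z\in M$. Geodesics are parametrized proportionally to arc length on $[0,1]$. *)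

theory Defs
  imports "HOL-Analysis.Analysis" "HOL-Library.Multiset"
begin

section \<open>Euclidean Jordan algebras\<close>

class euclidean_jordan_algebra = euclidean_space +
  fixes jmult :: "'a \<Rightarrow> 'a \<Rightarrow> 'a"  (infixl "\<odot>" 70)
    and jone :: 'a
  assumes jmult_commute: "x \<odot> y = y \<odot> x"
    and jmult_add_left: "(x + y) \<odot> z = x \<odot> z + y \<odot> z"
    and jmult_scaleR_left: "(r *\<^sub>R x) \<odot> y = r *\<^sub>R (x \<odot> y)"
    and jordan_identity: "x \<odot> ((x \<odot> x) \<odot> y) = (x \<odot> x) \<odot> (x \<odot> y)"
    and jmult_inner: "inner (x \<odot> y) z = inner y (x \<odot> z)"
    and jone_left: "jone \<odot> x = x"

definition (in euclidean_jordan_algebra) jordan_ideal :: "'a set \<Rightarrow> bool" where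
  "jordan_ideal I \<longleftrightarrow> 0 \<in> I \<and> (\<forall>x\<in>I. \<forall>y\<in>I. x + y \<in> I) \<and>
     (\<forall>r. \<forall>x\<in>I. r *\<^sub>R x \<in> I) \<and> (\<forall>x. \<forall>y\<in>I. x \<odot> y \<in> I)"

class simple_euclidean_jordan_algebra = euclidean_jordan_algebra +
  assumes jordan_simple: "jordan_ideal I \<Longrightarrow> I = {0} \<or> I = UNIV"

definition sym_cone :: "'a::euclidean_jordan_algebra set" where
  "sym_cone = interior {x \<odot> x | x. True}"

definition quad_rep :: "'a::euclidean_jordan_algebra \<Rightarrow> 'a \<Rightarrow> 'a" where
  "quad_rep x y = 2 *\<^sub>R (x \<odot> (x \<odot> y)) - (x \<odot> x) \<odot> y"

definition idempotent_elt :: "'a::euclidean_jordan_algebra \<Rightarrow> bool" where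
  "idempotent_elt c \<longleftrightarrow> c \<odot> c = c"

definition primitive_idempotent :: "'a::euclidean_jordan_algebra \<Rightarrow> bool" where
  "primitive_idempotent c \<longleftrightarrow> idempotent_elt c \<and> c \<noteq> 0 \<and>
     \<not> (\<exists>u v. idempotent_elt u \<and> idempotent_elt v \<and> u \<noteq> 0 \<and> v \<noteq> 0 \<and> u \<odot> v = 0 \<and> c = u + v)"

text \<open>
  Members of a Jordan frame are pairwise distinct (orthogonal and nonzero), so the frame is
  given as a finite set and the coefficients as a function on it. Distinct members may carry
  equal coefficients; this is the multiplicity of a spectral value.
\<close>

definition jordan_frame :: "'a::euclidean_jordan_algebra set \<Rightarrow> bool" where
  "jordan_frame C \<longleftrightarrow> finite C \<and> (\<forall>c\<in>C. primitive_idempotent c) \<and>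
     pairwise (\<lambda>c d. c \<odot> d = 0) C \<and> (\<Sum>c\<in>C. c) = jone"

definition spectral_decomp ::
  "'a::euclidean_jordan_algebra \<Rightarrow> 'a set \<Rightarrow> ('a \<Rightarrow> real) \<Rightarrow> bool" where
  "spectral_decomp x C l \<longleftrightarrow> jordan_frame C \<and> x = (\<Sum>c\<in>C. l c *\<^sub>R c)"

definition spectral_values :: "'a::euclidean_jordan_algebra \<Rightarrow> real multiset" where
  "spectral_values x =
     (THE S. \<exists>C l. spectral_decomp x C l \<and> S = image_mset l (mset_set C))"

text \<open>Meaningful for \<open>x\<close> in the symmetric cone, where all spectral values are positive.\<close>

definition jpow :: "'a::euclidean_jordan_algebra \<Rightarrow> real \<Rightarrow> 'a" where
  "jpow x \<alpha> = (THE y. \<exists>C l. spectral_decomp x C l \<and> y = (\<Sum>c\<in>C. (l c powr \<alpha>) *\<^sub>R c))"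

text \<open>
  The locale \<^term>\<open>Metric_space\<close> asks for symmetry and nonnegativity also off the carrier, hence
  the value 0 there.
\<close>

definition cone_dist :: "'a::euclidean_jordan_algebra \<Rightarrow> 'a \<Rightarrow> real" where
  "cone_dist a b =
     (if a \<in> sym_cone \<and> b \<in> sym_cone
      then sqrt (\<Sum>s\<in>#spectral_values (quad_rep (jpow a (-1/2)) b). (ln s)\<^sup>2)
      else 0)"

definition wgeo_mean :: "real \<Rightarrow> 'a::euclidean_jordan_algebra \<Rightarrow> 'a \<Rightarrow> 'a" where
  "wgeo_mean t a b = quad_rep (jpow a (1/2)) (jpow (quad_rep (jpow a (-1/2)) b) t)"

definition geo_mean :: "'a::euclidean_jordan_algebra \<Rightarrow> 'a \<Rightarrow> 'a" where
  "geo_mean a b = wgeo_mean (1/2) a b"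

definition spec_mean :: "'a::euclidean_jordan_algebra \<Rightarrow> 'a \<Rightarrow> 'a" where
  "spec_mean a b = quad_rep (jpow (geo_mean (jpow a (-1)) b) (1/2)) a"


section \<open>The factorization attached to an involution\<close>

definition involutive_jordan_automorphism ::
  "('a::euclidean_jordan_algebra \<Rightarrow> 'a) \<Rightarrow> bool" where
  "involutive_jordan_automorphism \<sigma> \<longleftrightarrow> linear \<sigma> \<and> bij \<sigma> \<and>
     (\<forall>x y. \<sigma> (x \<odot> y) = \<sigma> x \<odot> \<sigma> y) \<and> (\<forall>x. \<sigma> (\<sigma> x) = x)"

definition cone_plus :: "('a::euclidean_jordan_algebra \<Rightarrow> 'a) \<Rightarrow> 'a set" where
  "cone_plus \<sigma> = {a \<in> sym_cone. \<sigma> a = a}"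

definition cone_minus :: "('a::euclidean_jordan_algebra \<Rightarrow> 'a) \<Rightarrow> 'a set" where
  "cone_minus \<sigma> = {b \<in> sym_cone. \<sigma> b = jpow b (-1)}"

text \<open>
  The involution enters the map \<open>f\<^sub>\<sigma>\<close> only through its domain
  \<^term>\<open>cone_plus \<sigma> \<times> cone_minus \<sigma>\<close>.
\<close>

definition factor_map :: "'a::euclidean_jordan_algebra \<times> 'a \<Rightarrow> 'a" where
  "factor_map = (\<lambda>(a, b). quad_rep (jpow a (1/2)) b)"

definition factors :: "('a::euclidean_jordan_algebra \<Rightarrow> 'a) \<Rightarrow> 'a \<Rightarrow> 'a \<times> 'a" where
  "factors \<sigma> = inv_into (cone_plus \<sigma> \<times> cone_minus \<sigma>) factor_map"

definition sigma_dist :: "('a::euclidean_jordan_algebra \<Rightarrow> 'a) \<Rightarrow> 'a \<Rightarrow> 'a \<Rightarrow> real" where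
  "sigma_dist \<sigma> x y =
     (if x \<in> sym_cone \<and> y \<in> sym_cone
      then let (a1, b1) = factors \<sigma> x; (a2, b2) = factors \<sigma> y
           in sqrt ((cone_dist a1 a2)\<^sup>2 + (cone_dist b1 b2)\<^sup>2)
      else 0)"

definition sigma_geod ::
  "('a::euclidean_jordan_algebra \<Rightarrow> 'a) \<Rightarrow> real \<Rightarrow> 'a \<Rightarrow> 'a \<Rightarrow> 'a" where
  "sigma_geod \<sigma> t x y =
     (let (a1, b1) = factors \<sigma> x; (a2, b2) = factors \<sigma> y
      in factor_map (wgeo_mean t a1 a2, wgeo_mean t b1 b2))"


section \<open>Hadamard metric spaces, isometries, geodesics\<close>

definition hadamard_space :: "'b set \<Rightarrow> ('b \<Rightarrow> 'b \<Rightarrow> real) \<Rightarrow> bool" where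
  "hadamard_space M d \<longleftrightarrow> Metric_space M d \<and> Metric_space.mcomplete M d \<and>
     (\<forall>x\<in>M. \<forall>y\<in>M. \<exists>m\<in>M. \<forall>z\<in>M.
        (d m z)\<^sup>2 \<le> (d x z)\<^sup>2 / 2 + (d y z)\<^sup>2 / 2 - (d x y)\<^sup>2 / 4)"

definition metric_isometry ::
  "'b set \<Rightarrow> ('b \<Rightarrow> 'b \<Rightarrow> real) \<Rightarrow> 'c set \<Rightarrow> ('c \<Rightarrow> 'c \<Rightarrow> real) \<Rightarrow> ('b \<Rightarrow> 'c) \<Rightarrow> bool" where
  "metric_isometry M1 d1 M2 d2 f \<longleftrightarrow> Metric_space M1 d1 \<and> Metric_space M2 d2 \<and>
     bij_betw f M1 M2 \<and> (\<forall>p\<in>M1. \<forall>q\<in>M1. d2 (f p) (f q) = d1 p q)"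

text \<open>Geodesics are parametrized proportionally to arc length on the unit interval.\<close>

definition geodesic_joining ::
  "'b set \<Rightarrow> ('b \<Rightarrow> 'b \<Rightarrow> real) \<Rightarrow> 'b \<Rightarrow> 'b \<Rightarrow> (real \<Rightarrow> 'b) \<Rightarrow> bool" where
  "geodesic_joining M d x y \<gamma> \<longleftrightarrow> \<gamma> \<in> {0..1} \<rightarrow> M \<and> \<gamma> 0 = x \<and> \<gamma> 1 = y \<and>
     (\<forall>s\<in>{0..1}. \<forall>t\<in>{0..1}. d (\<gamma> s) (\<gamma> t) = \<bar>s - t\<bar> * d x y)"

definition unique_geodesic_joining ::
  "'b set \<Rightarrow> ('b \<Rightarrow> 'b \<Rightarrow> real) \<Rightarrow> 'b \<Rightarrow> 'b \<Rightarrow> (real \<Rightarrow> 'b) \<Rightarrow> bool" where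
  "unique_geodesic_joining M d x y \<gamma> \<longleftrightarrow> geodesic_joining M d x y \<gamma> \<and>
     (\<forall>\<eta>. geodesic_joining M d x y \<eta> \<longrightarrow> (\<forall>t\<in>{0..1}. \<eta> t = \<gamma> t))"

definition metric_midpoint :: "'b set \<Rightarrow> ('b \<Rightarrow> 'b \<Rightarrow> real) \<Rightarrow> 'b \<Rightarrow> 'b \<Rightarrow> 'b \<Rightarrow> bool" where
  "metric_midpoint M d x y m \<longleftrightarrow> m \<in> M \<and> d x m = d x y / 2 \<and> d m y = d x y / 2"

end

theory Submission
  imports Defs
begin

text \<open>
  Write \<open>\<Omega>\<close> for the symmetric cone, \<open>d\<close> for its distance, \<open>P\<close> for the quadratic representation
  and \<open>e\<close> for the unit. The distance \<open>d\<^sub>\<sigma>\<close> is the product distance of the two factors, carried to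
  \<open>\<Omega>\<close> by the bijection \<open>f\<^sub>\<sigma>\<close>. Hence the theorem follows once \<open>(\<Omega>, d)\<close> is a Hadamard space with the
  weighted means as geodesics, and the two factors are complete and closed under weighted means.

  The function \<open>\<parallel>log (P(a\<^sup>-\<^sup>1\<^sup>/\<^sup>2) b)\<parallel>\<close> (\<open>log_dist\<close> below) is a constant multiple of \<open>d(a,b)\<close>:
  in a simple algebra all primitive idempotents have the same norm (\<open>simple_primitive_norm\<close>), so
  counting a spectral value with multiplicity amounts to measuring in the given norm. The maps
  \<open>P(g)\<close> with \<open>g \<in> \<Omega>\<close> preserve \<open>log_dist\<close> (\<open>log_dist_quad_rep\<close>), because an element of the group that
  they generate which fixes \<open>e\<close> is an orthogonal Jordan automorphism; this rests on the fundamental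
  formula \<open>P(P(a)x) = P(a)P(x)P(a)\<close>, obtained here by differentiating along \<open>a = exp(tu)\<close>.

  The heart of the matter is that the exponential map does not decrease distances,
  \<open>\<parallel>u - v\<parallel> \<le> log_dist (exp u) (exp v)\<close> (\<open>norm_jln_diff_le_log_dist\<close>). Consider
  \<open>G(x,y) = \<langle>x, y\<^sup>-\<^sup>1\<rangle> + \<langle>y, x\<^sup>-\<^sup>1\<rangle> - 2\<langle>e, e\<rangle>\<close>. If \<open>u = \<Sum> l\<^sub>i c\<^sub>i\<close> and \<open>v = \<Sum> m\<^sub>j d\<^sub>j\<close> are spectral
  decompositions, then \<open>G(exp u, exp v) = \<Sum> (2 cosh(l\<^sub>i - m\<^sub>j) - 2) \<langle>c\<^sub>i, d\<^sub>j\<rangle>\<close>, and since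
  \<open>\<langle>c\<^sub>i, d\<^sub>j\<rangle> \<ge> 0\<close> this is at least \<open>\<Sum> (l\<^sub>i - m\<^sub>j)\<^sup>2 \<langle>c\<^sub>i, d\<^sub>j\<rangle> = \<parallel>u - v\<parallel>\<^sup>2\<close>. On the other hand \<open>G\<close> is
  invariant under the maps \<open>P(g)\<close>, and for neighbouring points of a geodesic it is the squared
  distance up to a factor tending to 1. Cutting the geodesic into \<open>n\<close> equal pieces and
  letting \<open>n\<close> grow gives the claim, without the derivative of the exponential map.

  Consequences: moving one vertex to \<open>e\<close> gives the triangle inequality; moving a point of a geodesic
  to \<open>e\<close> reduces the Hadamard inequality to an identity between squared norms
  (\<open>log_dist_wgeo_mean_le\<close>); and the logarithms of a Cauchy sequence form a Cauchy sequence in \<open>V\<close>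
  (\<open>mcomplete_jexp_closed\<close>), which also covers the two factors, since these are the exponential
  images of the eigenspaces of \<open>\<sigma>\<close>. Uniqueness of geodesics is a formal consequence of the
  Hadamard inequality (\<open>cat0_point_unique\<close>).

  The map \<open>f\<^sub>\<sigma>\<close> is bijective because \<open>x = P(a\<^sup>1\<^sup>/\<^sup>2)b\<close> with \<open>\<sigma>(a) = a\<close>, \<open>\<sigma>(b) = b\<^sup>-\<^sup>1\<close> holds exactly if \<open>a\<close>
  solves the Riccati equation \<open>P(a)x\<^sup>-\<^sup>1 = \<sigma>(x)\<close>, whose only solution in \<open>\<Omega>\<close> is \<open>x # \<sigma>(x)\<close>
  (\<open>riccati_iff\<close>).
\<close>

section \<open>Linearizations of the Jordan identity\<close>

lemma jmult_add_right: "x \<odot> (y + z) = x \<odot> y + x \<odot> (z::'a::euclidean_jordan_algebra)"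
  by (metis jmult_add_left jmult_commute)

lemma jmult_scaleR_right: "x \<odot> (r *\<^sub>R y) = r *\<^sub>R (x \<odot> (y::'a::euclidean_jordan_algebra))"
  by (metis jmult_scaleR_left jmult_commute)

lemma bounded_bilinear_jmult:
  "bounded_bilinear (jmult :: 'a \<Rightarrow> 'a \<Rightarrow> 'a::euclidean_jordan_algebra)"
  unfolding bilinear_conv_bounded_bilinear[symmetric] bilinear_def
  by (auto intro!: linearI simp: jmult_add_left jmult_add_right jmult_scaleR_left jmult_scaleR_right)

interpretation jmult: bounded_bilinear "jmult :: 'a \<Rightarrow> 'a \<Rightarrow> 'a::euclidean_jordan_algebra"
  by (rule bounded_bilinear_jmult)

lemma jone_right [simp]: "x \<odot> jone = (x::'a::euclidean_jordan_algebra)"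
  by (metis jone_left jmult_commute)

declare jone_left [simp]

lemma jmult_inner_left: "inner (x \<odot> y) z = inner x (y \<odot> (z::'a::euclidean_jordan_algebra))"
  by (metis jmult_inner jmult_commute)

lemmas jmult_expand = jmult.add_left jmult.add_right jmult.diff_left jmult.diff_right
  jmult.minus_left jmult.minus_right jmult.scaleR_left jmult.scaleR_right

text \<open>
  The part of the Jordan identity that is quadratic in \<open>x\<close> and linear in \<open>z\<close>, isolated by comparing
  \<open>x + z\<close> with \<open>x - z\<close>. In terms of multiplication operators it reads
  \<open>[L(x\<^sup>2), L(z)] + 2 [L(xz), L(x)] = 0\<close>.
\<close>

lemma jordan_identity_polarized:
  fixes x z w :: "'a::euclidean_jordan_algebra"
  shows "z \<odot> ((x \<odot> x) \<odot> w) + 2 *\<^sub>R (x \<odot> ((x \<odot> z) \<odot> w)) =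
         (x \<odot> x) \<odot> (z \<odot> w) + 2 *\<^sub>R ((x \<odot> z) \<odot> (x \<odot> w))"
proof -
  define F where "F v = v \<odot> ((v \<odot> v) \<odot> w) - (v \<odot> v) \<odot> (v \<odot> w)" for v
  have 0: "F v = 0" for v by (simp add: F_def jordan_identity)
  have zx: "z \<odot> x = x \<odot> z" by (rule jmult_commute)
  define R where "R = z \<odot> ((x \<odot> x) \<odot> w) + 2 *\<^sub>R (x \<odot> ((x \<odot> z) \<odot> w)) -
         ((x \<odot> x) \<odot> (z \<odot> w) + 2 *\<^sub>R ((x \<odot> z) \<odot> (x \<odot> w)))"
  \<comment> \<open>The parts cubic in \<open>x\<close> and linear in \<open>x\<close> cancel.\<close>
  have "F (x + z) - F (x - z) = 2 *\<^sub>R F z + 2 *\<^sub>R R"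
    unfolding F_def R_def by (simp add: jmult_expand zx algebra_simps scaleR_2)
  then have "R = 0" by (simp add: 0)
  then show ?thesis by (simp add: R_def)
qed

lemma jordan_identity_linearized:
  fixes x y z w :: "'a::euclidean_jordan_algebra"
  shows "z \<odot> ((x \<odot> y) \<odot> w) + x \<odot> ((y \<odot> z) \<odot> w) + y \<odot> ((x \<odot> z) \<odot> w) =
         (x \<odot> y) \<odot> (z \<odot> w) + (y \<odot> z) \<odot> (x \<odot> w) + (x \<odot> z) \<odot> (y \<odot> w)"
proof -
  define F where "F v = z \<odot> ((v \<odot> v) \<odot> w) + 2 *\<^sub>R (v \<odot> ((v \<odot> z) \<odot> w)) -
         ((v \<odot> v) \<odot> (z \<odot> w) + 2 *\<^sub>R ((v \<odot> z) \<odot> (v \<odot> w)))" for v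
  have 0: "F v = 0" for v using jordan_identity_polarized[of z v w] by (simp add: F_def)
  have yx: "y \<odot> x = x \<odot> y" by (rule jmult_commute)
  define R where "R = z \<odot> ((x \<odot> y) \<odot> w) + x \<odot> ((y \<odot> z) \<odot> w) + y \<odot> ((x \<odot> z) \<odot> w) -
         ((x \<odot> y) \<odot> (z \<odot> w) + (y \<odot> z) \<odot> (x \<odot> w) + (x \<odot> z) \<odot> (y \<odot> w))"
  have "F (x + y) - F x - F y = 2 *\<^sub>R R"
    unfolding F_def R_def by (simp add: jmult_expand yx algebra_simps scaleR_2)
  then have "R = 0" by (simp add: 0)
  then show ?thesis by (simp add: R_def)
qed

text \<open>
  The right-hand side of the linearized identity is symmetric in its four arguments; reading the
  left-hand side as a function of \<open>y\<close> expresses \<open>L((zx)w)\<close> through \<open>L\<close> of products of two factors.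
  This yields both the Peirce relation for idempotents and the recursion for \<open>L(x\<^sup>n)\<close>.
\<close>

lemma jmult_triple:
  fixes x y z w :: "'a::euclidean_jordan_algebra"
  shows "((z \<odot> x) \<odot> w) \<odot> y = (z \<odot> w) \<odot> (x \<odot> y) + (x \<odot> w) \<odot> (z \<odot> y) + (z \<odot> x) \<odot> (w \<odot> y)
     - z \<odot> (w \<odot> (x \<odot> y)) - x \<odot> (w \<odot> (z \<odot> y))"
  using jordan_identity_linearized[of z x y w]
  by (simp add: jmult_commute algebra_simps)

text \<open>
  The left-hand side is the derivative of \<open>x \<mapsto> P(x)y\<close> in the direction \<open>ux\<close>. So this is the
  infinitesimal form of the fundamental formula, for the one-parameter group generated by \<open>L(u)\<close>.
\<close>

lemma quad_rep_derivation:
  fixes x u y :: "'a::euclidean_jordan_algebra"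
  shows "2 *\<^sub>R (x \<odot> ((u \<odot> x) \<odot> y) + (u \<odot> x) \<odot> (x \<odot> y) - (x \<odot> (u \<odot> x)) \<odot> y) =
         u \<odot> quad_rep x y + quad_rep x (u \<odot> y)"
proof -
  have ux: "u \<odot> x = x \<odot> u" "x \<odot> (x \<odot> u) = (x \<odot> u) \<odot> x" by (rule jmult_commute)+
  show ?thesis
    using jordan_identity_polarized[of u x y]
    unfolding ux jmult_triple[of x u x y] quad_rep_def
    by (simp add: jmult_expand algebra_simps scaleR_2 ux(1))
qed


section \<open>Idempotents and powers\<close>

lemma idempotent_cubic:
  fixes c y :: "'a::euclidean_jordan_algebra"
  assumes "idempotent_elt c"
  shows "2 *\<^sub>R (c \<odot> (c \<odot> (c \<odot> y))) = 3 *\<^sub>R (c \<odot> (c \<odot> y)) - c \<odot> y"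
proof -
  have "c \<odot> c = c" using assms by (simp add: idempotent_elt_def)
  moreover have "(3::real) *\<^sub>R z = z + z + z" for z :: 'a
    using scaleR_left_distrib[of 2 1 z] by (simp add: scaleR_2)
  ultimately show ?thesis using jmult_triple[of c c c y]
    by (simp add: algebra_simps scaleR_2)
qed

text \<open>
  By the cubic relation \<open>L(c)\<close> has the eigenvalues 0, 1/2 and 1 only. On these three numbers
  \<open>t = t\<^sup>2 + 4 (t - t\<^sup>2)\<^sup>2\<close>, which exhibits \<open>L(c)\<close> as a sum of squares of symmetric operators.
\<close>

lemma idempotent_inner_mult:
  fixes c y :: "'a::euclidean_jordan_algebra"
  assumes "idempotent_elt c"
  shows "inner (c \<odot> y) y = (norm (c \<odot> y))\<^sup>2 + 4 * (norm (c \<odot> y - c \<odot> (c \<odot> y)))\<^sup>2"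
proof -
  define a0 where "a0 = inner y (c \<odot> y)"
  define a1 where "a1 = inner (c \<odot> y) (c \<odot> y)"
  define a2 where "a2 = inner (c \<odot> y) (c \<odot> (c \<odot> y))"
  define a3 where "a3 = inner (c \<odot> (c \<odot> y)) (c \<odot> (c \<odot> y))"
  have cub: "2 * inner v (c \<odot> (c \<odot> (c \<odot> y))) = 3 * inner v (c \<odot> (c \<odot> y)) - inner v (c \<odot> y)" for v
    using arg_cong[OF idempotent_cubic[OF assms, of y], of "inner v"] by (simp add: inner_diff_right)
  have 1: "inner y (c \<odot> (c \<odot> y)) = a1" by (simp add: a1_def jmult_inner)
  have 2: "inner y (c \<odot> (c \<odot> (c \<odot> y))) = a2"
    by (simp add: a2_def jmult_inner)
  have 3: "inner (c \<odot> y) (c \<odot> (c \<odot> (c \<odot> y))) = a3"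
    by (simp add: a3_def jmult_inner)
  have e1: "2 * a2 = 3 * a1 - a0" using cub[of y] by (simp add: 1 2 a0_def)
  have e2: "2 * a3 = 3 * a2 - a1" using cub[of "c \<odot> y"] by (simp add: 3 a1_def a2_def)
  have n: "(norm (c \<odot> y - c \<odot> (c \<odot> y)))\<^sup>2 = a1 - 2 * a2 + a3"
    unfolding power2_norm_eq_inner a1_def a2_def a3_def
    by (simp add: inner_diff_left inner_diff_right inner_commute)
  show ?thesis unfolding n power2_norm_eq_inner[of "c \<odot> y"] a1_def[symmetric]
    using e1 e2 by (simp add: inner_commute[of "c \<odot> y" y] a0_def[symmetric])
qed

lemma idempotent_inner_nonneg:
  fixes c y :: "'a::euclidean_jordan_algebra"
  assumes "idempotent_elt c"
  shows "0 \<le> inner (c \<odot> y) y"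
  by (simp add: idempotent_inner_mult[OF assms])

lemma idempotent_inner_eq_0:
  fixes c y :: "'a::euclidean_jordan_algebra"
  assumes "idempotent_elt c" "inner (c \<odot> y) y = 0"
  shows "c \<odot> y = 0"
proof -
  have "(norm (c \<odot> y))\<^sup>2 \<le> inner (c \<odot> y) y" by (simp add: idempotent_inner_mult[OF assms(1)])
  then show ?thesis using assms(2) by simp
qed

lemma inner_square:
  "inner x (y \<odot> y) = inner (x \<odot> y) (y::'a::euclidean_jordan_algebra)"
  by (simp add: jmult_inner_left)

lemma inner_idempotent:
  fixes c x :: "'a::euclidean_jordan_algebra"
  assumes "idempotent_elt c"
  shows "inner x c = inner (x \<odot> c) c"
  using inner_square[of x c] assms by (simp add: idempotent_elt_def)

lemma idempotents_inner_nonneg: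
  fixes c d :: "'a::euclidean_jordan_algebra"
  assumes "idempotent_elt c" "idempotent_elt d"
  shows "0 \<le> inner c d"
  using idempotent_inner_nonneg[OF assms(1)] inner_idempotent[OF assms(2)] by metis

lemma idempotents_orthogonal_iff:
  fixes c d :: "'a::euclidean_jordan_algebra"
  assumes "idempotent_elt c" "idempotent_elt d"
  shows "inner c d = 0 \<longleftrightarrow> c \<odot> d = 0"
  using idempotent_inner_eq_0[OF assms(1)] inner_idempotent[OF assms(2), of c] by auto

text \<open>
  The polarized identity with \<open>x = c\<close> and \<open>cz = 0\<close> reduces to \<open>[L(c), L(z)] = 0\<close>.
\<close>

lemma orthogonal_idempotents_commute:
  fixes c d y :: "'a::euclidean_jordan_algebra"
  assumes "idempotent_elt c" "c \<odot> d = 0"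
  shows "c \<odot> (d \<odot> y) = d \<odot> (c \<odot> y)"
  using jordan_identity_polarized[of d c y] assms by (simp add: idempotent_elt_def jmult.zero_left jmult.zero_right)

fun jpower :: "'a::euclidean_jordan_algebra \<Rightarrow> nat \<Rightarrow> 'a" where
  "jpower x 0 = jone"
| "jpower x (Suc n) = x \<odot> jpower x n"

text \<open>
  \<open>L(x\<^sup>n)\<close> is a polynomial in \<open>L(x)\<close> and \<open>L(x\<^sup>2)\<close>, which commute. The recursion has two steps, hence the
  induction on two consecutive exponents.
\<close>

lemma jpower_commute_joint:
  fixes x y :: "'a::euclidean_jordan_algebra"
  shows "(\<forall>y. jpower x n \<odot> (x \<odot> y) = x \<odot> (jpower x n \<odot> y)) \<and>
         (\<forall>y. jpower x n \<odot> ((x \<odot> x) \<odot> y) = (x \<odot> x) \<odot> (jpower x n \<odot> y)) \<and>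
         (\<forall>y. jpower x (Suc n) \<odot> (x \<odot> y) = x \<odot> (jpower x (Suc n) \<odot> y)) \<and>
         (\<forall>y. jpower x (Suc n) \<odot> ((x \<odot> x) \<odot> y) = (x \<odot> x) \<odot> (jpower x (Suc n) \<odot> y))"
proof (induction n)
  case 0
  show ?case by (simp add: jordan_identity)
next
  case (Suc n)
  let ?p = "jpower x n" and ?q = "jpower x (Suc n)"
  have q: "?p \<odot> x = ?q" by (simp add: jmult_commute)
  have rec: "jpower x (Suc (Suc n)) \<odot> y = 2 *\<^sub>R (?q \<odot> (x \<odot> y)) + (x \<odot> x) \<odot> (?p \<odot> y)
     - ?p \<odot> (x \<odot> (x \<odot> y)) - x \<odot> (x \<odot> (?p \<odot> y))" for y
    using jmult_triple[of ?p x x y] unfolding q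
    by (simp add: jmult_commute[of "x \<odot> jpower x n" x] scaleR_2 algebra_simps)
  have a: "?p \<odot> (x \<odot> y) = x \<odot> (?p \<odot> y)" "?p \<odot> ((x \<odot> x) \<odot> y) = (x \<odot> x) \<odot> (?p \<odot> y)"
    "?q \<odot> (x \<odot> y) = x \<odot> (?q \<odot> y)" "?q \<odot> ((x \<odot> x) \<odot> y) = (x \<odot> x) \<odot> (?q \<odot> y)" for y
    using Suc.IH by auto
  show ?case
    using Suc.IH unfolding rec
    by (simp del: jpower.simps add: a jmult_expand jordan_identity)
qed

lemma jpower_commute:
  "jpower x n \<odot> (x \<odot> y) = x \<odot> (jpower x n \<odot> (y::'a::euclidean_jordan_algebra))"
  using jpower_commute_joint by blast

lemma jpower_add:
  "jpower x m \<odot> jpower x n = jpower x (m + n :: nat)" for x :: "'a::euclidean_jordan_algebra"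
proof (induction n)
  case 0
  show ?case by simp
next
  case (Suc n)
  have "jpower x m \<odot> jpower x (Suc n) = x \<odot> (jpower x m \<odot> jpower x n)"
    by (simp add: jpower_commute)
  then show ?case using Suc by simp
qed

section \<open>Eigenvectors of symmetric operators\<close>

text \<open>
  A maximizer \<open>v\<close> of the Rayleigh quotient on the unit sphere of the invariant subspace is an
  eigenvector: otherwise the quotient increases in the direction \<open>f v - l v\<close>.
\<close>

lemma symmetric_eigenvector_exists:
  fixes f :: "'a::euclidean_space \<Rightarrow> 'a"
  assumes f: "linear f" and S: "subspace S" "S \<noteq> {0}" and inv: "f ` S \<subseteq> S"
    and sym: "\<And>x y. inner (f x) y = inner x (f y)"
  shows "\<exists>v\<in>S. norm v = 1 \<and> (\<exists>l. f v = l *\<^sub>R v)"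
proof -
  let ?U = "S \<inter> sphere 0 1"
  have "compact ?U" using closed_subspace[OF S(1)] compact_sphere by (simp add: closed_Int_compact)
  moreover have "?U \<noteq> {}"
  proof -
    obtain w where "w \<in> S" "w \<noteq> 0" using S subspace_0 by fastforce
    then have "(1 / norm w) *\<^sub>R w \<in> ?U" using S(1) by (simp add: subspace_scale)
    then show ?thesis by blast
  qed
  moreover have "continuous_on ?U (\<lambda>x. inner (f x) x)"
    by (rule continuous_on_inner[OF linear_continuous_on continuous_on_id])
      (use f linear_conv_bounded_linear in blast)
  ultimately have "\<exists>v\<in>?U. \<forall>y\<in>?U. inner (f y) y \<le> inner (f v) v"
    by (rule continuous_attains_sup)
  then obtain v where v: "v \<in> ?U" and max: "\<And>y. y \<in> ?U \<Longrightarrow> inner (f y) y \<le> inner (f v) v"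
    by metis
  define l where "l = inner (f v) v"
  have nv: "norm v = 1" "v \<in> S" using v by auto
  have max': "inner (f y) y \<le> l * inner y y" if "y \<in> S" for y
  proof (cases "y = 0")
    case True then show ?thesis using linear_0[OF f] by simp
  next
    case False
    have "(1 / norm y) *\<^sub>R y \<in> ?U" using that False S(1) by (simp add: subspace_scale)
    from max[OF this] have "inner (f y) y / (norm y)\<^sup>2 \<le> l"
      by (simp add: l_def linear_scale[OF f] power2_eq_square)
    then show ?thesis using False by (simp add: divide_le_eq power2_norm_eq_inner)
  qed
  have "f v = l *\<^sub>R v"
  proof (rule ccontr)
    assume "f v \<noteq> l *\<^sub>R v"
    define w where "w = f v - l *\<^sub>R v"
    have w: "w \<noteq> 0" "w \<in> S" using \<open>f v \<noteq> _\<close> inv nv S(1)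
      by (auto simp: w_def intro!: subspace_diff subspace_scale)
    define b where "b = l * inner w w - inner (f w) w"
    have b: "b \<ge> 0" using max'[OF w(2)] by (simp add: b_def)
    have key: "2 * t * inner w w \<le> t\<^sup>2 * b" for t
    proof -
      have "v + t *\<^sub>R w \<in> S" using nv w S(1) by (simp add: subspace_add subspace_scale)
      from max'[OF this]
      have "inner (f v) v + 2 * t * inner (f v) w + t\<^sup>2 * inner (f w) w
        \<le> l * (inner v v + 2 * t * inner v w + t\<^sup>2 * inner w w)"
        using sym[of w v] by (simp add: linear_add[OF f] linear_scale[OF f] inner_add_left inner_add_right
          inner_commute power2_eq_square algebra_simps)
      moreover have "inner v v = 1" using nv by (simp add: dot_square_norm)
      moreover have "inner (f v) w = inner w w + l * inner v w"
        by (simp add: w_def inner_diff_left)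
      ultimately have "l + 2 * t * (inner w w + l * inner v w) + t\<^sup>2 * inner (f w) w
        \<le> l * (1 + 2 * t * inner v w + t\<^sup>2 * inner w w)"
        by (simp only: l_def[symmetric])
      then show ?thesis by (simp add: b_def algebra_simps)
    qed
    have ww: "inner w w > 0" using w by simp
    \<comment> \<open>Small enough that the quadratic term \<open>t\<^sup>2 * b\<close> of \<open>key\<close> cannot compensate the linear one.\<close>
    define t where "t = inner w w / (b + 1)"
    have "t > 0" using b ww by (simp add: t_def)
    have "2 * inner w w \<le> t * b"
      using key[of t] \<open>t > 0\<close> by (simp add: power2_eq_square mult.assoc)
    also have "\<dots> \<le> inner w w" unfolding t_def using b ww by (simp add: field_simps)
    finally show False using ww by simp
  qed
  then show ?thesis using nv by blast
qed

lemma symmetric_orthogonal_eigenbasis: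
  fixes f :: "'a::euclidean_space \<Rightarrow> 'a"
  assumes f: "linear f" and sym: "\<And>x y. inner (f x) y = inner x (f y)"
  shows "subspace S \<Longrightarrow> f ` S \<subseteq> S \<Longrightarrow>
    \<exists>B. finite B \<and> B \<subseteq> S \<and> 0 \<notin> B \<and> pairwise orthogonal B \<and> S \<subseteq> span B \<and> (\<forall>v\<in>B. \<exists>l. f v = l *\<^sub>R v)"
proof (induction "dim S" arbitrary: S rule: less_induct)
  case less
  show ?case
  proof (cases "S = {0}")
    case True
    then show ?thesis by (intro exI[of _ "{}"]) auto
  next
    case False
    obtain v l where v: "v \<in> S" "norm v = 1" "f v = l *\<^sub>R v"
      using symmetric_eigenvector_exists[OF f less.prems(1) False less.prems(2) sym] by blast
    define T where "T = {y \<in> S. inner v y = 0}"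
    have T: "subspace T"
      using less.prems(1) unfolding T_def subspace_def by (auto simp: inner_add_right)
    have "v \<notin> T" using v(2) by (auto simp: T_def)
    then have "T \<subset> S" using v(1) unfolding T_def by blast
    then have dT: "dim T < dim S"
      using T less.prems(1) by (intro dim_psubset) (simp add: span_eq_iff[THEN iffD2])
    have fT: "f ` T \<subseteq> T"
    proof -
      have "inner v (f y) = 0" if "inner v y = 0" for y
        using sym[of v y] v(3) that by simp
      then show ?thesis using less.prems(2) by (auto simp: T_def)
    qed
    from less.hyps[OF dT T fT] obtain B where B: "finite B" "B \<subseteq> T" "0 \<notin> B" "pairwise orthogonal B"
      "T \<subseteq> span B" "\<forall>v\<in>B. \<exists>l. f v = l *\<^sub>R v" by blast
    have "S \<subseteq> span (insert v B)"
    proof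
      fix y assume y: "y \<in> S"
      define a where "a = inner v y"
      have "y - a *\<^sub>R v \<in> T" using y v less.prems(1)
        by (auto simp: T_def a_def inner_diff_right dot_square_norm intro!: subspace_diff subspace_scale)
      then have "y - a *\<^sub>R v \<in> span (insert v B)" using B(5) span_mono[of B "insert v B"] by blast
      moreover have "a *\<^sub>R v \<in> span (insert v B)" by (simp add: span_base span_scale)
      ultimately show "y \<in> span (insert v B)" using span_add by fastforce
    qed
    moreover have "pairwise orthogonal (insert v B)"
      using B(2,4) by (auto simp: pairwise_insert orthogonal_def T_def inner_commute)
    moreover have "v \<noteq> 0" using v(2) by auto
    ultimately show ?thesis using B v \<open>T \<subset> S\<close>
      by (intro exI[of _ "insert v B"]) auto
  qed
qed


section \<open>Complete systems of orthogonal idempotents\<close>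

text \<open>
  Like a Jordan frame, except that the members may be decomposable: the idempotents belonging to the
  distinct spectral values of a single element form such a system.
\<close>

definition complete_system :: "'a::euclidean_jordan_algebra set \<Rightarrow> bool" where
  "complete_system C \<longleftrightarrow> finite C \<and> 0 \<notin> C \<and> (\<forall>c\<in>C. idempotent_elt c) \<and>
     pairwise (\<lambda>c d. c \<odot> d = 0) C \<and> (\<Sum>c\<in>C. c) = jone"

definition lincomb :: "'a::euclidean_jordan_algebra set \<Rightarrow> ('a \<Rightarrow> real) \<Rightarrow> 'a" where
  "lincomb C l = (\<Sum>c\<in>C. l c *\<^sub>R c)"

lemma complete_systemD:
  assumes "complete_system C"
  shows "finite C" "0 \<notin> C" "\<And>c. c \<in> C \<Longrightarrow> idempotent_elt c"
    "\<And>c d. c \<in> C \<Longrightarrow> d \<in> C \<Longrightarrow> c \<odot> d = (if c = d then c else 0)" "(\<Sum>c\<in>C. c) = jone"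
  using assms by (auto simp: complete_system_def pairwise_def idempotent_elt_def)

lemma jordan_frame_complete_system: "jordan_frame C \<Longrightarrow> complete_system C"
  by (auto simp: jordan_frame_def complete_system_def primitive_idempotent_def)

lemma complete_system_inner:
  assumes "complete_system C" "c \<in> C" "d \<in> C"
  shows "inner c d = (if c = d then inner c c else 0)"
proof (cases "c = d")
  case False
  have "idempotent_elt c" "idempotent_elt d" "c \<odot> d = 0"
    using complete_systemD[OF assms(1)] assms(2,3) False by auto
  then show ?thesis using idempotents_orthogonal_iff False by auto
qed simp

lemma lincomb_const: "complete_system C \<Longrightarrow> lincomb C (\<lambda>_. r) = r *\<^sub>R jone"
  by (simp add: lincomb_def scaleR_sum_right[symmetric] complete_systemD(5))

lemma lincomb_mult_member:
  assumes "complete_system C" "d \<in> C"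
  shows "lincomb C l \<odot> d = l d *\<^sub>R d"
proof -
  have "lincomb C l \<odot> d = (\<Sum>c\<in>C. if c = d then l d *\<^sub>R d else 0)"
    unfolding lincomb_def jmult.sum_left
    by (rule sum.cong) (use complete_systemD(4)[OF assms(1) _ assms(2)] in \<open>auto simp: jmult.scaleR_left\<close>)
  then show ?thesis using assms complete_systemD(1)[OF assms(1)] by simp
qed

lemma lincomb_mult:
  assumes "complete_system C"
  shows "lincomb C l \<odot> lincomb C m = lincomb C (\<lambda>c. l c * m c)"
proof -
  have "lincomb C l \<odot> lincomb C m = (\<Sum>d\<in>C. m d *\<^sub>R (lincomb C l \<odot> d))"
    by (simp add: lincomb_def[of C m] jmult.sum_right jmult.scaleR_right)
  then show ?thesis
    by (simp add: lincomb_mult_member[OF assms]) (simp add: lincomb_def mult.commute)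
qed

lemma lincomb_add: "lincomb C l + lincomb C m = lincomb C (\<lambda>c. l c + m c)"
  by (simp add: lincomb_def sum.distrib scaleR_left_distrib)

lemma lincomb_scaleR: "r *\<^sub>R lincomb C l = lincomb C (\<lambda>c. r * l c)"
  by (simp add: lincomb_def scaleR_sum_right)

lemma lincomb_diff: "lincomb C l - lincomb C m = lincomb C (\<lambda>c. l c - m c)"
  by (simp add: lincomb_def sum_subtractf scaleR_left_diff_distrib)

lemma lincomb_commute:
  assumes C: "complete_system C"
  shows "lincomb C l \<odot> (lincomb C m \<odot> y) = lincomb C m \<odot> (lincomb C l \<odot> y)"
proof -
  have comm: "c \<odot> (d \<odot> y) = d \<odot> (c \<odot> y)" if "c \<in> C" "d \<in> C" for c d
    using orthogonal_idempotents_commute[of c d y] complete_systemD(3,4)[OF C] that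
    by (cases "c = d") auto
  have ex: "lincomb C l \<odot> (lincomb C m \<odot> y) = (\<Sum>d\<in>C. \<Sum>c\<in>C. (m d * l c) *\<^sub>R (c \<odot> (d \<odot> y)))" for l m
    by (simp add: lincomb_def jmult.sum_left jmult.sum_right jmult.scaleR_left jmult.scaleR_right
        scaleR_sum_right)
  have "lincomb C l \<odot> (lincomb C m \<odot> y) = (\<Sum>c\<in>C. \<Sum>d\<in>C. (l c * m d) *\<^sub>R (d \<odot> (c \<odot> y)))"
    unfolding ex by (subst sum.swap) (simp add: comm mult.commute)
  also have "\<dots> = lincomb C m \<odot> (lincomb C l \<odot> y)" unfolding ex ..
  finally show ?thesis .
qed

lemma complete_system_sum_inner:
  assumes "complete_system C"
  shows "(\<Sum>c\<in>C. inner c x) = inner jone x" "(\<Sum>c\<in>C. inner x c) = inner x jone"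
  using complete_systemD(5)[OF assms] by (simp_all flip: inner_sum_left inner_sum_right)

lemma inner_jone_idempotent: "idempotent_elt c \<Longrightarrow> inner jone c = inner c c"
  using inner_square[of jone c] by (simp add: idempotent_elt_def)

lemma lincomb_inner_lincomb:
  "inner (lincomb C l) (lincomb D m) = (\<Sum>c\<in>C. \<Sum>d\<in>D. l c * m d * inner c d)"
  unfolding lincomb_def inner_sum_left inner_sum_right
  by (subst sum.swap) (simp add: ac_simps)

lemma sum_sum_inner_left:
  assumes "complete_system C" "complete_system D"
  shows "(\<Sum>c\<in>C. \<Sum>d\<in>D. f c * inner c d) = (\<Sum>c\<in>C. f c * inner c c)"
proof -
  have "(\<Sum>c\<in>C. \<Sum>d\<in>D. f c * inner c d) = (\<Sum>c\<in>C. f c * (\<Sum>d\<in>D. inner c d))"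
    by (simp add: sum_distrib_left)
  also have "\<dots> = (\<Sum>c\<in>C. f c * inner c c)"
    by (rule sum.cong) (use complete_systemD(3)[OF assms(1)] in
      \<open>auto simp: complete_system_sum_inner[OF assms(2)] inner_jone_idempotent inner_commute[of _ jone]\<close>)
  finally show ?thesis .
qed

lemma norm_lincomb:
  assumes "complete_system C"
  shows "(norm (lincomb C l))\<^sup>2 = (\<Sum>c\<in>C. (l c)\<^sup>2 * inner c c)"
proof -
  have "(\<Sum>d\<in>C. l c * l d * inner c d) = (l c)\<^sup>2 * inner c c" if "c \<in> C" for c
  proof -
    have "(\<Sum>d\<in>C. l c * l d * inner c d) = (\<Sum>d\<in>C. if d = c then (l c)\<^sup>2 * inner c c else 0)"
      by (rule sum.cong) (auto simp: complete_system_inner[OF assms that] power2_eq_square)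
    then show ?thesis using that complete_systemD(1)[OF assms] by simp
  qed
  then show ?thesis unfolding power2_norm_eq_inner lincomb_inner_lincomb by simp
qed

text \<open>
  Each index of one system is weighted by the other, since \<open>\<Sum>\<^sub>d \<langle>c, d\<rangle> = \<langle>c, e\<rangle> = \<langle>c, c\<rangle>\<close>. As
  the weights \<open>\<langle>c, d\<rangle>\<close> are nonnegative, estimates for real numbers transfer to elements that
  do not commute. Well-definedness and continuity of the functional calculus and the comparison
  of distances below all come from this formula.
\<close>

lemma norm_lincomb_diff:
  assumes C: "complete_system C" and D: "complete_system D"
  shows "(norm (lincomb C l - lincomb D m))\<^sup>2 = (\<Sum>c\<in>C. \<Sum>d\<in>D. (l c - m d)\<^sup>2 * inner c d)"
proof -
  have 1: "(\<Sum>c\<in>C. \<Sum>d\<in>D. (l c)\<^sup>2 * inner c d) = (norm (lincomb C l))\<^sup>2"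
    by (simp add: sum_sum_inner_left[OF C D] norm_lincomb[OF C])
  have "(\<Sum>c\<in>C. \<Sum>d\<in>D. (m d)\<^sup>2 * inner c d) = (\<Sum>d\<in>D. \<Sum>c\<in>C. (m d)\<^sup>2 * inner d c)"
    by (subst sum.swap) (simp add: inner_commute)
  then have 2: "(\<Sum>c\<in>C. \<Sum>d\<in>D. (m d)\<^sup>2 * inner c d) = (norm (lincomb D m))\<^sup>2"
    by (simp add: sum_sum_inner_left[OF D C] norm_lincomb[OF D])
  have "(\<Sum>c\<in>C. \<Sum>d\<in>D. (l c - m d)\<^sup>2 * inner c d) =
     (\<Sum>c\<in>C. \<Sum>d\<in>D. (l c)\<^sup>2 * inner c d) + (\<Sum>c\<in>C. \<Sum>d\<in>D. (m d)\<^sup>2 * inner c d)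
      - 2 * (\<Sum>c\<in>C. \<Sum>d\<in>D. l c * m d * inner c d)"
    by (simp add: power2_diff algebra_simps sum.distrib sum_subtractf sum_distrib_left)
  then show ?thesis unfolding 1 2 lincomb_inner_lincomb[symmetric]
    by (simp add: power2_norm_eq_inner inner_diff_left inner_diff_right inner_commute)
qed

lemma complete_system_inner_nonneg:
  assumes "complete_system C" "complete_system D" "c \<in> C" "d \<in> D"
  shows "0 \<le> inner c d"
  using assms complete_systemD(3) idempotents_inner_nonneg by blast

lemma complete_system_eigen_orthogonal:
  assumes C: "complete_system C" and D: "complete_system D" and cd: "c \<in> C" "d \<in> D"
    and eq: "lincomb C l = lincomb D m" and ne: "l c \<noteq> m d"
  shows "inner c d = 0"
proof -
  have "l c * inner c d = inner (lincomb C l \<odot> c) d"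
    by (simp add: lincomb_mult_member[OF C cd(1)])
  also have "\<dots> = inner c (lincomb D m \<odot> d)" by (simp add: eq jmult_inner)
  also have "\<dots> = m d * inner c d" by (simp add: lincomb_mult_member[OF D cd(2)])
  finally show ?thesis using ne by simp
qed

text \<open>
  If two systems represent the same element, then \<open>\<langle>c, d\<rangle> = 0\<close> unless \<open>c\<close> and \<open>d\<close> carry the same
  coefficient, so every term of the double sum for the difference vanishes.
\<close>

lemma lincomb_apply_eq:
  assumes C: "complete_system C" and D: "complete_system D" and eq: "lincomb C l = lincomb D m"
  shows "lincomb C (\<lambda>c. f (l c)) = lincomb D (\<lambda>d. f (m d))"
proof -
  have "(f (l c) - f (m d))\<^sup>2 * inner c d = 0" if "c \<in> C" "d \<in> D" for c d
    using complete_system_eigen_orthogonal[OF C D that eq] by (cases "l c = m d") auto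
  then have "(norm (lincomb C (\<lambda>c. f (l c)) - lincomb D (\<lambda>d. f (m d))))\<^sup>2 = 0"
    unfolding norm_lincomb_diff[OF C D] by (intro sum.neutral ballI)
  then show ?thesis by simp
qed

section \<open>The spectral theorem\<close>

lemma complete_system_card_le:
  assumes "complete_system (C :: 'a::euclidean_jordan_algebra set)"
  shows "card C \<le> DIM('a)"
proof -
  have "pairwise orthogonal C"
    using complete_system_inner[OF assms] by (auto simp: pairwise_def orthogonal_def)
  then have "independent C" using pairwise_orthogonal_independent complete_systemD(2)[OF assms] by blast
  then show ?thesis by (simp add: independent_card_le)
qed

text \<open>
  Multiplication by \<open>x\<close> is a symmetric operator on the span \<open>A\<close> of the powers of \<open>x\<close>. By power
  associativity an eigenvector \<open>v\<close> in \<open>A\<close> is an eigenvector of multiplication by every element of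
  \<open>A\<close>, in particular by \<open>v\<close>, so a multiple of \<open>v\<close> is idempotent. The idempotents from an eigenbasis
  annihilate one another, and expanding the unit in this basis shows that they sum to it.
\<close>

lemma spectral_complete_system:
  fixes x :: "'a::euclidean_jordan_algebra"
  shows "\<exists>C l. complete_system C \<and> x = lincomb C l"
proof -
  define A where "A = span (range (jpower x))"
  have pA: "jpower x n \<in> A" for n by (simp add: A_def span_base)
  have lin: "linear (\<lambda>y. z \<odot> y)" for z :: 'a
    by (rule bounded_linear.linear[OF jmult.bounded_linear_right])
  have pow_mult: "jpower x n \<odot> y \<in> A \<and> jpower x (Suc n) \<odot> y = x \<odot> (jpower x n \<odot> y)" if "y \<in> A" for n y
    using that unfolding A_def
  proof (induction rule: span_induct)
    case base
    have "subspace {y. z \<odot> y \<in> span (range (jpower x))}" for z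
      using linear_subspace_vimage[OF lin[of z] subspace_span] by (simp add: vimage_def)
    moreover have "subspace {y. jpower x (Suc n) \<odot> y = x \<odot> (jpower x n \<odot> y)}"
      by (auto simp: subspace_def jmult_expand jmult.zero_left jmult.zero_right)
    ultimately show ?case unfolding Collect_conj_eq by (rule subspace_inter)
  next
    case (step y)
    then obtain m where "y = jpower x m" by blast
    then have y: "jpower x k \<odot> y = jpower x (k + m)" for k by (simp only: jpower_add)
    have "jpower x (k + m) \<in> span (range (jpower x))" for k by (simp add: span_base)
    then show ?case unfolding y by simp
  qed
  have inv: "(\<lambda>y. x \<odot> y) ` A \<subseteq> A"
    using pow_mult[of _ 1] by auto
  obtain B where B: "finite B" "B \<subseteq> A" "0 \<notin> B" "pairwise orthogonal B" "A \<subseteq> span B"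
    "\<forall>v\<in>B. \<exists>l. x \<odot> v = l *\<^sub>R v"
    using symmetric_orthogonal_eigenbasis[OF lin[of x], of A] inv
    by (auto simp: jmult_inner A_def)
  have scal: "\<exists>s. z \<odot> v = s *\<^sub>R v" if vB: "v \<in> B" and zA: "z \<in> A" for v z
  proof -
    obtain l where l: "x \<odot> v = l *\<^sub>R v" using bspec[OF B(6) vB] ..
    have vA: "v \<in> A" by (rule subsetD[OF B(2) vB])
    have p: "jpower x n \<odot> v = (l ^ n) *\<^sub>R v" for n
    proof (induction n)
      case (Suc n)
      then show ?case using pow_mult[OF vA, of n] by (simp del: jpower.simps add: jmult.scaleR_right l)
    qed simp
    have "z \<odot> v \<in> span {v}" using zA unfolding A_def
    proof (induction rule: span_induct)
      case base
      show ?case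
        by (auto simp: subspace_def jmult_expand jmult.zero_left span_add span_scale span_zero)
    next
      case (step z)
      then show ?case using p by (auto simp: span_base span_scale)
    qed
    then show ?thesis unfolding span_singleton by auto
  qed
  have sq: "\<exists>s. s \<noteq> 0 \<and> v \<odot> v = s *\<^sub>R v" if vB: "v \<in> B" for v
  proof -
    have "v \<in> A" by (rule subsetD[OF B(2) vB])
    then obtain s where s: "v \<odot> v = s *\<^sub>R v" using scal[OF vB] by blast
    have "inner (v \<odot> v) jone = inner v v" by (simp add: jmult_inner)
    then have "s \<noteq> 0" using s B(3) vB by auto
    then show ?thesis using s by blast
  qed
  then obtain s where s: "\<And>v. v \<in> B \<Longrightarrow> s v \<noteq> 0 \<and> v \<odot> v = s v *\<^sub>R v" by metis
  define g where "g v = (1 / s v) *\<^sub>R v" for v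
  define C where "C = g ` B"
  have orth: "v \<odot> w = 0" if vw: "v \<in> B" "w \<in> B" "v \<noteq> w" for v w
  proof -
    have "v \<in> A" "w \<in> A" using B(2) vw by auto
    then obtain a b where a: "v \<odot> w = a *\<^sub>R w" and b: "w \<odot> v = b *\<^sub>R v"
      using scal[of w v] scal[of v w] vw by blast
    have b': "v \<odot> w = b *\<^sub>R v" unfolding jmult_commute[of v w] by (rule b)
    have "inner w v = 0" using B(4) vw by (auto simp: pairwise_def orthogonal_def)
    then have "inner (v \<odot> w) (v \<odot> w) = 0" using arg_cong2[OF a b', of inner] by simp
    then show ?thesis by simp
  qed
  have idem: "g v \<odot> g v = g v" if "v \<in> B" for v
    using s[OF that] by (simp add: g_def jmult_expand)
  have g0: "g v \<noteq> 0" if "v \<in> B" for v using s[OF that] B(3) that by (auto simp: g_def)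
  have gorth: "g v \<odot> g w = 0" if "v \<in> B" "w \<in> B" "v \<noteq> w" for v w
    using orth[OF that] by (simp add: g_def jmult_expand)
  have inj: "inj_on g B"
    by (rule inj_onI) (metis idem g0 gorth)
  have "jone \<in> span B" using pA[of 0] B(5) by auto
  then obtain u where u: "jone = (\<Sum>v\<in>B. u v *\<^sub>R v)"
    using span_finite[OF B(1)] by auto
  \<comment> \<open>Multiplying the expansion of the unit by \<open>g w\<close> isolates the term at \<open>w\<close>.\<close>
  have ug: "u w *\<^sub>R w = g w" if w: "w \<in> B" for w
  proof -
    have "g w = jone \<odot> g w" by simp
    also have "\<dots> = (\<Sum>v\<in>B. if v = w then u w *\<^sub>R w else 0)"
      unfolding u jmult.sum_left
      by (rule sum.cong) (use w s in \<open>auto simp: g_def jmult_expand orth\<close>)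
    finally show ?thesis using w B(1) by simp
  qed
  have "(\<Sum>c\<in>C. c) = jone"
    unfolding C_def sum.reindex[OF inj] u by (simp add: ug)
  moreover have "pairwise (\<lambda>c d. c \<odot> d = 0) C"
    using gorth by (auto simp: C_def pairwise_def)
  ultimately have C: "complete_system C"
    using B(1) g0 idem by (auto simp: complete_system_def C_def idempotent_elt_def)
  have "\<exists>l. x \<odot> c = l *\<^sub>R c" if "c \<in> C" for c
    using that B(6) unfolding C_def g_def by (auto simp: jmult.scaleR_right)
  then obtain l where l: "\<And>c. c \<in> C \<Longrightarrow> x \<odot> c = l c *\<^sub>R c" by metis
  have "x = x \<odot> (\<Sum>c\<in>C. c)" using complete_systemD(5)[OF C] by simp
  also have "\<dots> = lincomb C l" unfolding jmult.sum_right lincomb_def using l by simp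
  finally show ?thesis using C by blast
qed

text \<open>
  The two parts of \<open>c\<close> remain orthogonal to the other members: inner products of idempotents are
  nonnegative, and those of \<open>u\<close> and \<open>v\<close> with a member \<open>d\<close> add up to \<open>\<langle>c, d\<rangle> = 0\<close>.
\<close>

lemma complete_system_split:
  assumes C: "complete_system C" and c: "c \<in> C" "c = u + v"
    and u: "idempotent_elt u" "u \<noteq> 0" and v: "idempotent_elt v" "v \<noteq> 0" and uv: "u \<odot> v = 0"
  defines "D \<equiv> insert u (insert v (C - {c}))"
  shows "complete_system D" "card D = Suc (card C)" "u \<notin> insert v (C - {c})" "v \<notin> C - {c}"
proof -
  have orth: "u \<odot> d = 0 \<and> v \<odot> d = 0" if d: "d \<in> C - {c}" for d
  proof -
    have di: "idempotent_elt d" and "c \<odot> d = 0" using complete_systemD[OF C] d c by auto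
    have "inner u d + inner v d = inner c d" by (simp add: c(2) inner_add_left)
    also have "\<dots> = 0" using complete_system_inner[OF C c(1)] d by auto
    finally have "inner u d = 0" "inner v d = 0"
      using idempotents_inner_nonneg[OF u(1) di] idempotents_inner_nonneg[OF v(1) di] by auto
    then show ?thesis using idempotents_orthogonal_iff u v di by blast
  qed
  have uu: "u \<odot> u = u" "v \<odot> v = v" using u v by (auto simp: idempotent_elt_def)
  show 1: "u \<notin> insert v (C - {c})" and 2: "v \<notin> C - {c}"
    using orth[of u] orth[of v] uu u(2) v(2) uv by auto
  have "sum (\<lambda>c. c) C = c + sum (\<lambda>c. c) (C - {c})"
    using complete_systemD(1)[OF C] c by (simp add: sum.remove)
  then have "(\<Sum>d\<in>D. d) = jone"
    unfolding D_def using 1 2 complete_systemD(1,5)[OF C] c(2) by (simp add: add.assoc)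
  moreover have "pairwise (\<lambda>c d. c \<odot> d = 0) D"
    using orth orth[unfolded jmult_commute[of u] jmult_commute[of v]] uv uv[unfolded jmult_commute[of u]]
      complete_systemD(4)[OF C] unfolding D_def pairwise_def
    by auto
  ultimately show "complete_system D"
    using complete_systemD(1-3)[OF C] u v by (auto simp: complete_system_def D_def)
  show "card D = Suc (card C)"
    unfolding D_def using 1 2 complete_systemD(1)[OF C] c(1) card_Suc_Diff1[of C c]
    by simp
qed

text \<open>
  Among the complete systems that represent \<open>x\<close> one of maximal cardinality consists of
  primitive idempotents, because a decomposable member could be split. The maximum exists since the
  members are linearly independent.
\<close>

theorem spectral_decomp_exists:
  fixes x :: "'a::euclidean_jordan_algebra"
  shows "\<exists>C l. spectral_decomp x C l"
proof -
  define Q where "Q n \<longleftrightarrow> (\<exists>C l. complete_system C \<and> x = lincomb C l \<and> card C = n)" for n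
  have "\<exists>n. Q n" using spectral_complete_system[of x] by (auto simp: Q_def)
  moreover have "Q n \<Longrightarrow> n \<le> DIM('a)" for n
    using complete_system_card_le by (auto simp: Q_def)
  ultimately obtain n where "Q n" and max: "\<And>k. Q k \<Longrightarrow> k \<le> n"
    using GreatestI_nat[of Q _ "DIM('a)"] Greatest_le_nat[of Q _ "DIM('a)"] by metis
  then obtain C l where C: "complete_system C" "x = lincomb C l" "card C = n" by (auto simp: Q_def)
  have "primitive_idempotent c" if c: "c \<in> C" for c
  proof (rule ccontr)
    assume "\<not> primitive_idempotent c"
    then obtain u v where uv: "idempotent_elt u" "idempotent_elt v" "u \<noteq> 0" "v \<noteq> 0" "u \<odot> v = 0" "c = u + v"
      using complete_systemD(2,3)[OF C(1)] c unfolding primitive_idempotent_def by blast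
    note D = complete_system_split[OF C(1) c uv(6,1,3,2,4,5)]
    \<comment> \<open>Both halves of \<open>c\<close> inherit its coefficient.\<close>
    define m where "m d = (if d = u \<or> d = v then l c else l d)" for d
    have "(\<Sum>d\<in>C-{c}. m d *\<^sub>R d) = (\<Sum>d\<in>C-{c}. l d *\<^sub>R d)"
      by (rule sum.cong) (use D(3,4) in \<open>auto simp: m_def\<close>)
    then have "lincomb (insert u (insert v (C - {c}))) m = l c *\<^sub>R u + (l c *\<^sub>R v + (\<Sum>d\<in>C-{c}. l d *\<^sub>R d))"
      unfolding lincomb_def using D(3,4) complete_systemD(1)[OF C(1)] by (simp add: m_def)
    also have "\<dots> = l c *\<^sub>R c + (\<Sum>d\<in>C-{c}. l d *\<^sub>R d)"
      by (simp add: uv(6) scaleR_right_distrib)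
    also have "\<dots> = x"
      unfolding C(2) lincomb_def using complete_systemD(1)[OF C(1)] c by (simp add: sum.remove)
    finally have "Q (Suc n)" unfolding Q_def using D(1,2) C(3) by metis
    then show False using max by fastforce
  qed
  then have "jordan_frame C" using C(1) by (auto simp: jordan_frame_def complete_system_def)
  then show ?thesis using C(2) by (auto simp: spectral_decomp_def lincomb_def)
qed


section \<open>Functional calculus\<close>

lemma spectralE:
  fixes x :: "'a::euclidean_jordan_algebra"
  obtains C l where "jordan_frame C" "complete_system C" "x = lincomb C l"
  using spectral_decomp_exists[of x] jordan_frame_complete_system
  unfolding spectral_decomp_def lincomb_def by blast

text \<open>
  By \<open>lincomb_apply_eq\<close> the result does not depend on the system that represents \<open>x\<close>.
\<close>

definition jfun :: "(real \<Rightarrow> real) \<Rightarrow> 'a::euclidean_jordan_algebra \<Rightarrow> 'a" where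
  "jfun f x = (THE y. \<exists>C l. complete_system C \<and> x = lincomb C l \<and> y = lincomb C (\<lambda>c. f (l c)))"

lemma jfun_lincomb:
  assumes "complete_system C"
  shows "jfun f (lincomb C l) = lincomb C (\<lambda>c. f (l c))"
  unfolding jfun_def using assms lincomb_apply_eq[OF assms] by (intro the_equality) (blast, metis)

lemma lincomb_cong: "(\<And>c. c \<in> C \<Longrightarrow> l c = m c) \<Longrightarrow> lincomb C l = lincomb C m"
  by (simp add: lincomb_def)

definition jexp :: "'a::euclidean_jordan_algebra \<Rightarrow> 'a" where "jexp = jfun exp"
definition jln :: "'a::euclidean_jordan_algebra \<Rightarrow> 'a" where "jln = jfun ln"

lemma jexp_lincomb: "complete_system C \<Longrightarrow> jexp (lincomb C l) = lincomb C (\<lambda>c. exp (l c))"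
  by (simp add: jexp_def jfun_lincomb)

lemma jln_jexp [simp]: "jln (jexp u) = u"
  by (rule spectralE[of u]) (simp add: jexp_def jln_def jfun_lincomb)

lemma jexp_inj [simp]: "jexp u = jexp v \<longleftrightarrow> u = v"
  by (metis jln_jexp)

lemma jexp_0 [simp]: "jexp 0 = (jone :: 'a::euclidean_jordan_algebra)"
proof -
  obtain C :: "'a set" where C: "complete_system C" using spectralE by blast
  have "lincomb C (\<lambda>_. 0) = 0" by (simp add: lincomb_def)
  then show ?thesis using lincomb_const[OF C, of 1] jexp_lincomb[OF C, of "\<lambda>_. 0"] by simp
qed

lemma jln_jone [simp]: "jln jone = 0"
  by (metis jexp_0 jln_jexp)

text \<open>
  Every element of the cone is an exponential, so powers can be computed on logarithms, where they
  become multiplication by a scalar.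
\<close>

lemma jpow_jexp: "jpow (jexp u) \<alpha> = jexp (\<alpha> *\<^sub>R u)"
proof -
  obtain C l where C: "jordan_frame C" "complete_system C" "u = lincomb C l" by (rule spectralE)
  let ?y = "lincomb C (\<lambda>c. exp (\<alpha> * l c))"
  have e: "jexp u = lincomb C (\<lambda>c. exp (l c))" by (simp add: C jexp_lincomb)
  have "(THE y. \<exists>C l. spectral_decomp (jexp u) C l \<and> y = (\<Sum>c\<in>C. (l c powr \<alpha>) *\<^sub>R c)) = ?y"
  proof (rule the_equality)
    show "\<exists>C l. spectral_decomp (jexp u) C l \<and> ?y = (\<Sum>c\<in>C. (l c powr \<alpha>) *\<^sub>R c)"
      by (rule exI[of _ C], rule exI[of _ "\<lambda>c. exp (l c)"])
        (simp add: C(1) e spectral_decomp_def, simp add: lincomb_def powr_def)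
  next
    fix y assume "\<exists>D m. spectral_decomp (jexp u) D m \<and> y = (\<Sum>c\<in>D. (m c powr \<alpha>) *\<^sub>R c)"
    then obtain D m where D: "complete_system D" "jexp u = lincomb D m" "y = lincomb D (\<lambda>c. m c powr \<alpha>)"
      unfolding spectral_decomp_def lincomb_def using jordan_frame_complete_system by blast
    show "y = ?y"
      using lincomb_apply_eq[OF D(1) C(2), of m "\<lambda>c. exp (l c)" "\<lambda>t. t powr \<alpha>"] D(2,3) e
      by (simp add: powr_def)
  qed
  then show ?thesis unfolding jpow_def by (simp add: C(3) lincomb_scaleR jexp_lincomb[OF C(2)])
qed

section \<open>The symmetric cone\<close>

text \<open>
  On one side \<open>\<langle>y\<^sup>2, c\<rangle> = \<langle>cy, y\<rangle> \<ge> 0\<close>. On the other the spectral coefficients of \<open>x\<close> are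
  \<open>\<langle>x, c\<rangle> / \<langle>c, c\<rangle>\<close>, and when they are nonnegative a square root can be formed.
\<close>

lemma squares_iff:
  fixes x :: "'a::euclidean_jordan_algebra"
  shows "x \<in> {y \<odot> y | y. True} \<longleftrightarrow> (\<forall>c. idempotent_elt c \<longrightarrow> 0 \<le> inner x c)"
proof
  assume "x \<in> {y \<odot> y | y. True}"
  then obtain y where "x = y \<odot> y" by auto
  then show "\<forall>c. idempotent_elt c \<longrightarrow> 0 \<le> inner x c"
    using inner_square[of _ y] idempotent_inner_nonneg[of _ y] by (metis inner_commute)
next
  assume *: "\<forall>c. idempotent_elt c \<longrightarrow> 0 \<le> inner x c"
  obtain C l where C: "complete_system C" "x = lincomb C l" by (rule spectralE)
  have "0 \<le> l c" if "c \<in> C" for c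
  proof -
    have "0 \<le> inner x c" using * complete_systemD(3)[OF C(1) that] by blast
    also have "\<dots> = l c * inner c c"
      using inner_idempotent[OF complete_systemD(3)[OF C(1) that], of x] lincomb_mult_member[OF C(1) that]
      by (simp add: C(2))
    finally show ?thesis using complete_systemD(2)[OF C(1)] that
      by (metis inner_gt_zero_iff zero_le_mult_iff linorder_not_le)
  qed
  then have "lincomb C (\<lambda>c. sqrt (l c)) \<odot> lincomb C (\<lambda>c. sqrt (l c)) = x"
    unfolding lincomb_mult[OF C(1)] C(2) by (intro lincomb_cong) simp
  then show "x \<in> {y \<odot> y | y. True}" by blast
qed

lemma inner_lincomb_member:
  assumes C: "complete_system C" and c: "c \<in> C"
  shows "inner (lincomb C l) c = l c * inner c c"
  using inner_idempotent[OF complete_systemD(3)[OF C c], of "lincomb C l"] lincomb_mult_member[OF C c] by simp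

lemma closed_squares: "closed {y \<odot> y | y::'a::euclidean_jordan_algebra. True}"
proof -
  have "{y \<odot> y | y::'a. True} = (\<Inter>c\<in>{c. idempotent_elt c}. {x. 0 \<le> inner x c})"
    using squares_iff by auto
  moreover have "closed {x::'a. 0 \<le> inner x c}" for c
    by (intro closed_Collect_le continuous_intros)
  ultimately show ?thesis by auto
qed

lemma jone_neq_0 [simp]: "jone \<noteq> (0::'a::euclidean_jordan_algebra)"
proof
  assume "jone = (0::'a)"
  then have "x = 0" for x :: 'a using jone_left[of x] by (simp add: jmult.zero_left)
  then show False using nonempty_Basis[where 'a='a] nonzero_Basis[where 'a='a] by blast
qed

lemma idempotent_pos: "complete_system C \<Longrightarrow> c \<in> C \<Longrightarrow> 0 < inner c c"
  using complete_systemD(2) by fastforce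

text \<open>
  If a coefficient at \<open>c\<close> is not positive, subtracting a small multiple of \<open>c\<close> leaves the squares.
  If all coefficients are at least \<open>r > 0\<close>, then \<open>\<langle>x, d\<rangle> \<ge> r \<langle>d, d\<rangle>\<close> for every idempotent \<open>d\<close>, which
  dominates a perturbation of norm less than \<open>r / B\<close>, \<open>B\<close> being a bound of the multiplication.
\<close>

lemma lincomb_sym_cone_iff:
  assumes C: "complete_system (C::'a::euclidean_jordan_algebra set)"
  shows "lincomb C l \<in> sym_cone \<longleftrightarrow> (\<forall>c\<in>C. 0 < l c)"
proof
  let ?K = "{y \<odot> y | y::'a. True}" and ?x = "lincomb C l"
  assume "?x \<in> sym_cone"
  then obtain e where e: "e > 0" "ball ?x e \<subseteq> ?K" unfolding sym_cone_def mem_interior by auto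
  show "\<forall>c\<in>C. 0 < l c"
  proof
    fix c assume c: "c \<in> C"
    define r where "r = e / (2 * norm c)"
    have c0: "norm c > 0" using complete_systemD(2)[OF C] c by auto
    have r: "r > 0" using e(1) c0 by (simp add: r_def)
    have "dist ?x (?x - r *\<^sub>R c) < e" using e(1) c0 by (simp add: dist_norm r_def)
    then have "?x - r *\<^sub>R c \<in> ?K" by (intro subsetD[OF e(2)]) simp
    then have "0 \<le> inner (?x - r *\<^sub>R c) c" using squares_iff complete_systemD(3)[OF C c] by blast
    also have "\<dots> = (l c - r) * inner c c"
      by (simp add: inner_diff_left inner_lincomb_member[OF C c] left_diff_distrib)
    finally have "r \<le> l c" using idempotent_pos[OF C c] by (simp add: zero_le_mult_iff)
    then show "0 < l c" using r by simp
  qed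
next
  let ?K = "{y \<odot> y | y::'a. True}" and ?x = "lincomb C l"
  assume pos: "\<forall>c\<in>C. 0 < l c"
  obtain B where B: "B > 0" "\<And>x y :: 'a. norm (x \<odot> y) \<le> norm x * norm y * B"
    using jmult.pos_bounded by blast
  have fin: "finite C" and ne: "C \<noteq> {}"
    using complete_systemD(1,5)[OF C] jone_neq_0 by auto
  define r where "r = Min (l ` C)"
  have r: "r > 0" and rl: "\<And>c. c \<in> C \<Longrightarrow> r \<le> l c"
    using fin ne pos by (auto simp: r_def)
  have "ball ?x (r / B) \<subseteq> ?K"
  proof
    fix z assume z: "z \<in> ball ?x (r / B)"
    show "z \<in> ?K" unfolding squares_iff
    proof (intro allI impI)
      fix d :: 'a assume d: "idempotent_elt d"
      define h where "h = z - ?x"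
      have h: "norm h * B \<le> r" using z B(1) by (simp add: h_def dist_norm norm_minus_commute field_simps)
      have "\<bar>inner (h \<odot> d) d\<bar> \<le> norm (h \<odot> d) * norm d" by (rule Cauchy_Schwarz_ineq2)
      also have "\<dots> \<le> norm h * norm d * B * norm d" using B(2)[of h d] by (intro mult_right_mono) auto
      also have "\<dots> \<le> r * inner d d"
        using mult_right_mono[OF h, of "inner d d"]
        by (simp add: dot_square_norm power2_eq_square ac_simps)
      finally have 1: "- (r * inner d d) \<le> inner h d" using inner_idempotent[OF d, of h] by simp
      have "r * inner d d = (\<Sum>c\<in>C. r * inner c d)"
        by (simp add: sum_distrib_left[symmetric] complete_system_sum_inner[OF C] inner_jone_idempotent[OF d])
      also have "\<dots> \<le> (\<Sum>c\<in>C. l c * inner c d)"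
        by (intro sum_mono mult_right_mono rl idempotents_inner_nonneg[OF complete_systemD(3)[OF C] d])
      also have "\<dots> = inner ?x d" by (simp add: lincomb_def inner_sum_left)
      finally show "0 \<le> inner z d" using 1 by (simp add: h_def inner_diff_left)
    qed
  qed
  then show "?x \<in> sym_cone" unfolding sym_cone_def mem_interior using r B(1) by (intro exI[of _ "r / B"]) auto
qed

lemma sym_cone_eq_range_jexp: "sym_cone = range jexp"
proof (intro equalityI subsetI)
  fix x :: 'a assume x: "x \<in> sym_cone"
  obtain C l where C: "complete_system C" "x = lincomb C l" by (rule spectralE)
  have "jexp (lincomb C (\<lambda>c. ln (l c))) = x"
    unfolding jexp_lincomb[OF C(1)] C(2)
    using x lincomb_sym_cone_iff[OF C(1)] C(2) by (intro lincomb_cong) auto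
  then show "x \<in> range jexp" by blast
next
  fix x :: 'a assume "x \<in> range jexp"
  then obtain u where u: "x = jexp u" by blast
  obtain C l where C: "complete_system C" "u = lincomb C l" by (rule spectralE)
  show "x \<in> sym_cone" unfolding u C jexp_lincomb[OF C(1)] lincomb_sym_cone_iff[OF C(1)] by simp
qed

lemma jexp_in_sym_cone [simp, intro]: "jexp u \<in> sym_cone"
  by (simp add: sym_cone_eq_range_jexp)

lemma sym_coneE:
  assumes "x \<in> sym_cone" obtains u where "x = jexp u"
  using assms unfolding sym_cone_eq_range_jexp by blast

lemma jexp_jln [simp]: "x \<in> sym_cone \<Longrightarrow> jexp (jln x) = x"
  by (metis sym_coneE jln_jexp)

lemma jone_in_sym_cone [simp, intro]: "jone \<in> sym_cone"
  by (metis jexp_0 jexp_in_sym_cone)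

lemma open_sym_cone: "open sym_cone"
  by (simp add: sym_cone_def)

section \<open>Lipschitz estimates and continuity\<close>

lemma spectral_bound:
  "\<exists>B>0. \<forall>C l. \<forall>c\<in>C. complete_system (C::'a::euclidean_jordan_algebra set) \<longrightarrow> \<bar>l c\<bar> \<le> B * norm (lincomb C l)"
proof -
  obtain B where B: "B > 0" "\<And>x y :: 'a. norm (x \<odot> y) \<le> norm x * norm y * B"
    using jmult.pos_bounded by blast
  have "\<bar>l c\<bar> \<le> B * norm (lincomb C l)" if C: "complete_system C" and c: "c \<in> C" for C and l :: "'a \<Rightarrow> real" and c
  proof -
    have n: "norm c > 0" using complete_systemD(2)[OF C] c by auto
    have "\<bar>l c\<bar> * norm c \<le> (B * norm (lincomb C l)) * norm c"
      using B(2)[of "lincomb C l" c] unfolding lincomb_mult_member[OF C c] by (simp add: ac_simps)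
    then show ?thesis using n by simp
  qed
  then show ?thesis using B(1) by blast
qed

lemma jfun_lipschitz:
  assumes "complete_system C" "complete_system D" "0 \<le> L"
    and "\<And>c d. c \<in> C \<Longrightarrow> d \<in> D \<Longrightarrow> \<bar>f (l c) - f (m d)\<bar> \<le> L * \<bar>l c - m d\<bar>"
  shows "norm (jfun f (lincomb C l) - jfun f (lincomb D m)) \<le> L * norm (lincomb C l - lincomb D m)"
proof -
  have "(norm (jfun f (lincomb C l) - jfun f (lincomb D m)))\<^sup>2 =
     (\<Sum>c\<in>C. \<Sum>d\<in>D. (f (l c) - f (m d))\<^sup>2 * inner c d)"
    by (simp add: jfun_lincomb assms(1,2) norm_lincomb_diff)
  also have "\<dots> \<le> (\<Sum>c\<in>C. \<Sum>d\<in>D. (L\<^sup>2 * (l c - m d)\<^sup>2) * inner c d)"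
  proof (intro sum_mono mult_right_mono)
    fix c d assume cd: "c \<in> C" "d \<in> D"
    have "\<bar>f (l c) - f (m d)\<bar>\<^sup>2 \<le> (L * \<bar>l c - m d\<bar>)\<^sup>2" by (intro power_mono assms(4) cd) auto
    then show "(f (l c) - f (m d))\<^sup>2 \<le> L\<^sup>2 * (l c - m d)\<^sup>2" by (simp add: power_mult_distrib)
    show "0 \<le> inner c d" by (rule complete_system_inner_nonneg[OF assms(1,2) cd])
  qed
  also have "\<dots> = (L * norm (lincomb C l - lincomb D m))\<^sup>2"
    by (simp add: power_mult_distrib norm_lincomb_diff[OF assms(1,2)] sum_distrib_left mult.assoc)
  finally show ?thesis by (rule power2_le_imp_le) (use assms(3) in simp)
qed

lemma exp_lipschitz:
  fixes a b :: real
  assumes "\<bar>a\<bar> \<le> R" "\<bar>b\<bar> \<le> R"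
  shows "\<bar>exp a - exp b\<bar> \<le> exp R * \<bar>a - b\<bar>"
proof -
  have *: "exp t - exp s \<le> exp R * (t - s)" if "s \<le> t" "t \<le> R" for s t :: real
  proof -
    have "exp t - exp s = exp t * (1 - exp (s - t))" by (simp add: right_diff_distrib flip: exp_add)
    also have "\<dots> \<le> exp t * (t - s)"
    proof (rule mult_left_mono)
      show "1 - exp (s - t) \<le> t - s" using exp_ge_add_one_self[of "s - t"] by linarith
    qed simp
    also have "\<dots> \<le> exp R * (t - s)" using that by (intro mult_right_mono) auto
    finally show ?thesis .
  qed
  show ?thesis using *[of a b] *[of b a] assms by (cases "a \<le> b") auto
qed

lemma tendsto_jexp:
  assumes "u \<longlonglongrightarrow> (v::'a::euclidean_jordan_algebra)"
  shows "(\<lambda>n. jexp (u n)) \<longlonglongrightarrow> jexp v"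
proof -
  obtain B where B: "B > 0" "\<And>C l c. complete_system (C::'a set) \<Longrightarrow> c \<in> C \<Longrightarrow> \<bar>l c\<bar> \<le> B * norm (lincomb C l)"
    using spectral_bound by metis
  have "Bseq u" using assms convergentI convergent_imp_Bseq by blast
  then obtain M where M: "\<And>n. norm (u n) \<le> M" using Bseq_def by auto
  define R where "R = B * max M (norm v)"
  have "norm (jexp (u n) - jexp v) \<le> exp R * norm (u n - v)" for n
  proof -
    obtain C l where C: "complete_system C" "u n = lincomb C l" by (rule spectralE)
    obtain D m where D: "complete_system D" "v = lincomb D m" by (rule spectralE)
    have b: "B * norm (u n) \<le> R" "B * norm v \<le> R"
      unfolding R_def using B(1) M[of n] by (intro mult_left_mono; simp)+
    have 1: "\<bar>l c\<bar> \<le> R" if "c \<in> C" for c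
      using B(2)[OF C(1) that, of l] b(1) C(2) by simp
    have 2: "\<bar>m c\<bar> \<le> R" if "c \<in> D" for c
      using B(2)[OF D(1) that, of m] b(2) D(2) by simp
    show ?thesis unfolding jexp_def C(2) D(2)
      by (intro jfun_lipschitz C(1) D(1) exp_lipschitz 1 2) auto
  qed
  then have bound: "\<forall>n. norm (jexp (u n) - jexp v) \<le> exp R * norm (u n - v)" by blast
  have "(\<lambda>n. u n - v) \<longlonglongrightarrow> 0" using assms by (simp add: LIM_zero)
  then have "(\<lambda>n. exp R * norm (u n - v)) \<longlonglongrightarrow> 0"
    by (intro tendsto_mult_right_zero tendsto_norm_zero)
  then have "(\<lambda>n. jexp (u n) - jexp v) \<longlonglongrightarrow> 0"
    by (rule Lim_null_comparison[OF always_eventually[OF bound]])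
  then show ?thesis by (simp add: LIM_zero_iff)
qed

section \<open>Jordan automorphisms\<close>

definition jordan_automorphism :: "('a::euclidean_jordan_algebra \<Rightarrow> 'a) \<Rightarrow> bool" where
  "jordan_automorphism k \<longleftrightarrow> linear k \<and> bij k \<and> (\<forall>x y. k (x \<odot> y) = k x \<odot> k y)"

lemma jordan_automorphism_jone:
  assumes "jordan_automorphism k" shows "k jone = jone"
proof -
  obtain z where z: "k z = jone" using assms by (metis jordan_automorphism_def bij_is_surj surjD)
  have "k (jone \<odot> z) = k jone \<odot> k z" using assms unfolding jordan_automorphism_def by blast
  then show ?thesis by (simp add: z)
qed

text \<open>
  An automorphism carries a complete system to a complete system with the same coefficients.
\<close>

lemma jordan_automorphism_jfun:
  assumes k: "jordan_automorphism k"
  shows "k (jfun f x) = jfun f (k x)"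
proof -
  obtain C l where C: "complete_system C" "x = lincomb C l" by (rule spectralE)
  have lin: "linear k" and inj: "inj k" and mult: "\<And>x y. k (x \<odot> y) = k x \<odot> k y"
    using k by (auto simp: jordan_automorphism_def bij_def)
  have i: "inj_on k C" using inj inj_on_subset by blast
  have 1: "k (lincomb C m) = lincomb (k ` C) (\<lambda>d. m (the_inv k d))" for m
    by (simp add: lincomb_def linear_sum[OF lin] linear_scale[OF lin] sum.reindex[OF i] the_inv_f_f[OF inj])
  have "(\<Sum>c\<in>k ` C. c) = k (\<Sum>c\<in>C. c)"
    by (simp add: linear_sum[OF lin] sum.reindex[OF i])
  then have "complete_system (k ` C)"
    using complete_systemD[OF C(1)] jordan_automorphism_jone[OF k] linear_0[OF lin] inj
    unfolding complete_system_def pairwise_def idempotent_elt_def mult[symmetric]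
    by (auto simp: inj_eq mult[symmetric]) (metis inj_eq)
  then show ?thesis unfolding C(2) jfun_lincomb[OF C(1)] 1 by (simp add: jfun_lincomb)
qed


section \<open>The quadratic representation\<close>

lemma quad_rep_jone_left [simp]: "quad_rep jone y = y"
  by (simp add: quad_rep_def scaleR_2)

lemma quad_rep_jone_right: "quad_rep x jone = x \<odot> x"
  by (simp add: quad_rep_def scaleR_2)

lemma quad_rep_add: "quad_rep x (y + z) = quad_rep x y + quad_rep x z"
  and quad_rep_scaleR: "quad_rep x (r *\<^sub>R y) = r *\<^sub>R quad_rep x y"
  and quad_rep_minus: "quad_rep x (- y) = - quad_rep x y"
  and quad_rep_0 [simp]: "quad_rep x 0 = 0"
  by (simp_all add: quad_rep_def jmult_expand jmult.zero_right algebra_simps)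

lemma linear_quad_rep: "linear (quad_rep x)"
  by (intro linearI quad_rep_add quad_rep_scaleR)

lemma quad_rep_scaleR_left: "quad_rep (r *\<^sub>R x) y = r\<^sup>2 *\<^sub>R quad_rep x y"
  by (simp add: quad_rep_def jmult_expand algebra_simps power2_eq_square)

lemma quad_rep_inner: "inner (quad_rep x y) z = inner y (quad_rep x z)"
  by (simp add: quad_rep_def inner_diff_left inner_diff_right jmult_inner)

lemma tendsto_quad_rep:
  assumes "(f \<longlongrightarrow> x) F" "(g \<longlongrightarrow> y) F"
  shows "((\<lambda>t. quad_rep (f t) (g t)) \<longlongrightarrow> quad_rep x y) F"
  unfolding quad_rep_def by (intro tendsto_intros jmult.tendsto assms)

lemma quad_rep_lincomb:
  assumes "complete_system C"
  shows "quad_rep (lincomb C l) (lincomb C m) = lincomb C (\<lambda>c. (l c)\<^sup>2 * m c)"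
  unfolding quad_rep_def lincomb_mult[OF assms] lincomb_scaleR lincomb_diff
  by (intro lincomb_cong) (simp add: power2_eq_square)

lemma quad_rep_lincomb_member:
  assumes "complete_system C" "c \<in> C"
  shows "quad_rep (lincomb C l) c = (l c)\<^sup>2 *\<^sub>R c"
  unfolding quad_rep_def lincomb_mult[OF assms(1)]
  by (simp add: lincomb_mult_member[OF assms] jmult.scaleR_right power2_eq_square
      scaleR_left_diff_distrib[symmetric])

lemma quad_rep_jexp_jexp: "quad_rep (jexp (s *\<^sub>R u)) (jexp (t *\<^sub>R u)) = jexp ((2 * s + t) *\<^sub>R u)"
proof -
  obtain C l where C: "complete_system C" "u = lincomb C l" by (rule spectralE)
  show ?thesis unfolding C(2) lincomb_scaleR jexp_lincomb[OF C(1)] quad_rep_lincomb[OF C(1)]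
    by (intro lincomb_cong) (simp add: power2_eq_square distrib_right flip: exp_add)
qed

lemma has_vector_derivative_quad_rep:
  assumes p: "(p has_vector_derivative p') (at t)" and q: "(q has_vector_derivative q') (at t)"
  shows "((\<lambda>t. quad_rep (p t) (q t)) has_vector_derivative
    2 *\<^sub>R (p t \<odot> (p' \<odot> q t) + p' \<odot> (p t \<odot> q t) - (p t \<odot> p') \<odot> q t) + quad_rep (p t) q') (at t)"
proof -
  note D = jmult.has_vector_derivative
  have "((\<lambda>t. 2 *\<^sub>R (p t \<odot> (p t \<odot> q t)) - (p t \<odot> p t) \<odot> q t) has_vector_derivative
    2 *\<^sub>R (p t \<odot> (p t \<odot> q' + p' \<odot> q t) + p' \<odot> (p t \<odot> q t)) -
    ((p t \<odot> p t) \<odot> q' + (p t \<odot> p' + p' \<odot> p t) \<odot> q t)) (at t)"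
    by (intro has_vector_derivative_diff bounded_linear.has_vector_derivative[OF bounded_linear_scaleR_right] D p q)
  then show ?thesis unfolding quad_rep_def
    by (rule has_vector_derivative_eq_rhs)
      (simp add: jmult_expand jmult_commute[of p' "p t"] algebra_simps scaleR_2)
qed

lemma has_vector_derivative_jexp_line:
  "((\<lambda>t. jexp ((a + b * t) *\<^sub>R u)) has_vector_derivative b *\<^sub>R (u \<odot> jexp ((a + b * t) *\<^sub>R u))) (at t)"
proof -
  obtain C l where C: "complete_system C" "u = lincomb C l" by (rule spectralE)
  have e: "jexp ((a + b * t) *\<^sub>R u) = (\<Sum>c\<in>C. exp ((a + b * t) * l c) *\<^sub>R c)" for t
    by (simp add: C lincomb_scaleR jexp_lincomb) (simp add: lincomb_def)
  have "((\<lambda>t. \<Sum>c\<in>C. exp ((a + b * t) * l c) *\<^sub>R c) has_vector_derivative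
    (\<Sum>c\<in>C. (exp ((a + b * t) * l c) * (b * l c)) *\<^sub>R c)) (at t)"
    by (intro has_vector_derivative_sum)
      (auto intro!: derivative_eq_intros has_vector_derivative_scaleR[where g'=0, simplified]
        simp: has_real_derivative_iff_has_vector_derivative[symmetric])
  moreover have "(\<Sum>c\<in>C. (exp ((a + b * t) * l c) * (b * l c)) *\<^sub>R c) =
      b *\<^sub>R (u \<odot> jexp ((a + b * t) *\<^sub>R u))"
    by (simp add: C lincomb_scaleR jexp_lincomb lincomb_mult) (simp add: lincomb_def ac_simps)
  ultimately show ?thesis by (simp add: e)
qed

lemma quad_rep_jexp_commute:
  "quad_rep (jexp (t *\<^sub>R u)) (u \<odot> y) = u \<odot> quad_rep (jexp (t *\<^sub>R u)) y"
proof -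
  obtain C l where C: "complete_system C" "u = lincomb C l" by (rule spectralE)
  show ?thesis
    by (simp add: quad_rep_def C lincomb_scaleR jexp_lincomb lincomb_mult lincomb_commute[OF C(1), of _ l]
        jmult_expand)
qed

text \<open>
  With \<open>p(t) = exp((a + bt)u)\<close> one has \<open>p' = b u p\<close>, so \<open>quad_rep_derivation\<close> computes the derivative of
  \<open>P(p(t))\<close>; as \<open>L(u)\<close> commutes with \<open>P(p(t))\<close>, both terms agree.
\<close>

lemma has_vector_derivative_quad_rep_jexp_line:
  assumes q: "(q has_vector_derivative q') (at t)"
  shows "((\<lambda>t. quad_rep (jexp ((a + b * t) *\<^sub>R u)) (q t)) has_vector_derivative
    (2 * b) *\<^sub>R (u \<odot> quad_rep (jexp ((a + b * t) *\<^sub>R u)) (q t)) + quad_rep (jexp ((a + b * t) *\<^sub>R u)) q') (at t)"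
proof -
  define x where "x = jexp ((a + b * t) *\<^sub>R u)"
  have "2 *\<^sub>R (x \<odot> ((b *\<^sub>R (u \<odot> x)) \<odot> q t) + (b *\<^sub>R (u \<odot> x)) \<odot> (x \<odot> q t) - (x \<odot> (b *\<^sub>R (u \<odot> x))) \<odot> q t)
    = b *\<^sub>R (2 *\<^sub>R (x \<odot> ((u \<odot> x) \<odot> q t) + (u \<odot> x) \<odot> (x \<odot> q t) - (x \<odot> (u \<odot> x)) \<odot> q t))"
    by (simp add: jmult_expand algebra_simps)
  also have "\<dots> = b *\<^sub>R (u \<odot> quad_rep x (q t) + quad_rep x (u \<odot> q t))"
    by (simp only: quad_rep_derivation)
  also have "\<dots> = (2 * b) *\<^sub>R (u \<odot> quad_rep x (q t))"
    by (simp add: x_def quad_rep_jexp_commute scaleR_2 flip: scaleR_scaleR) (simp add: scaleR_2[symmetric] mult.commute)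
  finally show ?thesis
    using has_vector_derivative_quad_rep[OF has_vector_derivative_jexp_line[of a b u t] q]
    by (simp add: x_def)
qed

lemma constant_if_derivative_0:
  assumes "\<And>t. (f has_vector_derivative 0) (at t)"
  shows "f s = f (t::real)"
  using has_vector_derivative_zero_constant[of UNIV f] assms by (metis UNIV_I convex_UNIV)

text \<open>
  The map \<open>t \<mapsto> P(exp(tu)) P(exp((s + r - t)u)) y\<close> has derivative 0; compare \<open>t = s\<close> with \<open>t = 0\<close>.
\<close>

lemma quad_rep_jexp_add:
  "quad_rep (jexp (s *\<^sub>R u)) (quad_rep (jexp (r *\<^sub>R u)) y) = quad_rep (jexp ((s + r) *\<^sub>R u)) y"
proof -
  define f where "f t = quad_rep (jexp ((0 + 1 * t) *\<^sub>R u)) (quad_rep (jexp (((s + r) + (-1) * t) *\<^sub>R u)) y)" for t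
  have "(f has_vector_derivative 0) (at t)" for t
    unfolding f_def
    by (rule has_vector_derivative_eq_rhs[OF has_vector_derivative_quad_rep_jexp_line[OF
        has_vector_derivative_quad_rep_jexp_line[OF has_vector_derivative_const]]])
      (simp only: quad_rep_jexp_commute quad_rep_scaleR quad_rep_0 quad_rep_add, simp)
  from constant_if_derivative_0[OF this, of s 0] show ?thesis
    by (simp add: f_def)
qed

lemma quad_rep_jexp_inverse:
  "quad_rep (jexp u) (quad_rep (jexp (- u)) y) = y" "quad_rep (jexp (- u)) (quad_rep (jexp u) y) = y"
  using quad_rep_jexp_add[of 1 u "-1" y] quad_rep_jexp_add[of "-1" u 1 y] by simp_all

text \<open>
  Put \<open>Q\<^sub>t = P(exp(tu))\<close>. By \<open>quad_rep_derivation\<close> the derivative of \<open>P(Q\<^sub>t x)\<close> is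
  \<open>2 L(u) P(Q\<^sub>t x) + 2 P(Q\<^sub>t x) L(u)\<close>, so \<open>Q\<^sub>-\<^sub>t P(Q\<^sub>t x) Q\<^sub>-\<^sub>t\<close> does not depend on \<open>t\<close>. Its value at
  \<open>t = 0\<close> is \<open>P(x)\<close>.
\<close>

lemma quad_rep_fundamental_jexp:
  "quad_rep (quad_rep (jexp u) x) y = quad_rep (jexp u) (quad_rep x (quad_rep (jexp u) y))"
proof -
  define q where "q t z = quad_rep (jexp ((0 + (-1) * t) *\<^sub>R u)) z" for t z
  define g where "g t = quad_rep (jexp ((0 + 1 * t) *\<^sub>R u)) x" for t
  define f where "f t = q t (quad_rep (g t) (q t (quad_rep (jexp u) y)))" for t
  have g': "(g has_vector_derivative 2 *\<^sub>R (u \<odot> g t)) (at t)" for t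
    unfolding g_def
    by (rule has_vector_derivative_eq_rhs[OF has_vector_derivative_quad_rep_jexp_line[OF
        has_vector_derivative_const]]) simp
  have q': "((\<lambda>t. q t (r t)) has_vector_derivative (-2) *\<^sub>R (u \<odot> q t (r t)) + q t r') (at t)"
    if "(r has_vector_derivative r') (at t)" for r r' t
    unfolding q_def
    by (rule has_vector_derivative_eq_rhs[OF has_vector_derivative_quad_rep_jexp_line[OF that]]) simp
  have comm: "q t (u \<odot> z) = u \<odot> q t z" for t z by (simp only: q_def quad_rep_jexp_commute)
  have q0: "q t 0 = 0" for t by (simp add: q_def)
  have qs: "q t (r *\<^sub>R z) = r *\<^sub>R q t z" for t r z by (simp add: q_def quad_rep_scaleR)
  have "(f has_vector_derivative 0) (at t)" for t
  proof -
    define w where "w = q t (quad_rep (jexp u) y)"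
    have w': "((\<lambda>t. q t (quad_rep (jexp u) y)) has_vector_derivative (-2) *\<^sub>R (u \<odot> w)) (at t)"
      by (rule has_vector_derivative_eq_rhs[OF q'[OF has_vector_derivative_const]]) (simp add: q0 w_def)
    have "2 *\<^sub>R (g t \<odot> ((2 *\<^sub>R (u \<odot> g t)) \<odot> w) + (2 *\<^sub>R (u \<odot> g t)) \<odot> (g t \<odot> w) - (g t \<odot> (2 *\<^sub>R (u \<odot> g t))) \<odot> w)
      + quad_rep (g t) ((-2) *\<^sub>R (u \<odot> w)) =
      2 *\<^sub>R (2 *\<^sub>R (g t \<odot> ((u \<odot> g t) \<odot> w) + (u \<odot> g t) \<odot> (g t \<odot> w) - (g t \<odot> (u \<odot> g t)) \<odot> w)) 
      - 2 *\<^sub>R quad_rep (g t) (u \<odot> w)"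
      by (simp add: jmult_expand quad_rep_scaleR quad_rep_minus algebra_simps del: scaleR_scaleR)
    also have "\<dots> = 2 *\<^sub>R (u \<odot> quad_rep (g t) w)"
      by (simp only: quad_rep_derivation) (simp add: scaleR_right_distrib)
    finally have r': "((\<lambda>t. quad_rep (g t) (q t (quad_rep (jexp u) y))) has_vector_derivative
        2 *\<^sub>R (u \<odot> quad_rep (g t) w)) (at t)"
      using has_vector_derivative_quad_rep[OF g' w'] by (simp only: w_def)
    show ?thesis unfolding f_def
      by (rule has_vector_derivative_eq_rhs[OF q'[OF r']]) (simp add: qs comm w_def)
  qed
  from constant_if_derivative_0[OF this, of 1 0]
  have "quad_rep (jexp (- u)) (quad_rep (quad_rep (jexp u) x) y) = quad_rep x (quad_rep (jexp u) y)"
    by (simp add: f_def q_def g_def quad_rep_jexp_inverse)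
  then show ?thesis by (metis quad_rep_jexp_inverse(1))
qed

lemma quad_rep_fundamental:
  assumes "a \<in> sym_cone"
  shows "quad_rep (quad_rep a x) y = quad_rep a (quad_rep x (quad_rep a y))"
  using assms by (auto elim!: sym_coneE simp: quad_rep_fundamental_jexp)

lemma square_add_jone_in_sym_cone:
  assumes "\<epsilon> > 0"
  shows "z \<odot> z + \<epsilon> *\<^sub>R jone \<in> sym_cone"
proof -
  obtain C l where C: "complete_system C" "z = lincomb C l" by (rule spectralE)
  have "z \<odot> z + \<epsilon> *\<^sub>R jone = lincomb C (\<lambda>c. l c * l c + \<epsilon>)"
    by (simp add: C lincomb_mult lincomb_const[OF C(1), symmetric] lincomb_add)
  then show ?thesis using assms by (simp add: lincomb_sym_cone_iff[OF C(1)] add_nonneg_pos)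
qed

text \<open>
  The fundamental formula extends to the closure of the cone by continuity. It is wanted for
  idempotents, which are squares.
\<close>

lemma quad_rep_fundamental_square:
  "quad_rep (quad_rep (z \<odot> z) x) y = quad_rep (z \<odot> z) (quad_rep x (quad_rep (z \<odot> z) y))"
proof (rule LIMSEQ_unique)
  define a where "a n = z \<odot> z + inverse (real (Suc n)) *\<^sub>R jone" for n
  have "a \<longlonglongrightarrow> z \<odot> z + 0 *\<^sub>R jone"
    unfolding a_def by (intro tendsto_intros LIMSEQ_inverse_real_of_nat)
  then have a: "a \<longlonglongrightarrow> z \<odot> z" by simp
  show "(\<lambda>n. quad_rep (quad_rep (a n) x) y) \<longlonglongrightarrow> quad_rep (quad_rep (z \<odot> z) x) y"
    by (intro tendsto_quad_rep a tendsto_const)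
  have "a n \<in> sym_cone" for n unfolding a_def by (intro square_add_jone_in_sym_cone) simp
  then have "(\<lambda>n. quad_rep (quad_rep (a n) x) y) = (\<lambda>n. quad_rep (a n) (quad_rep x (quad_rep (a n) y)))"
    using quad_rep_fundamental by blast
  then show "(\<lambda>n. quad_rep (quad_rep (a n) x) y) \<longlonglongrightarrow> quad_rep (z \<odot> z) (quad_rep x (quad_rep (z \<odot> z) y))"
    by (simp only:) (intro tendsto_quad_rep a tendsto_const)
qed

text \<open>
  Along \<open>x(t) = P(exp(tu))b\<close> the operator \<open>P(x(t)) = P(exp(tu)) P(b) P(exp(tu))\<close> is injective, so no
  spectral value of \<open>x(t)\<close> is 0. Therefore \<open>x(t)\<close> lies in the closed set of squares exactly if it lies
  in the open cone, and the set of such \<open>t\<close> is open, closed and contains 0.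
\<close>

lemma quad_rep_jexp_sym_cone:
  assumes b: "b \<in> sym_cone"
  shows "quad_rep (jexp u) b \<in> sym_cone"
proof -
  let ?K = "{y \<odot> y | y::'a. True}"
  define x where "x t = quad_rep (jexp ((0 + 1 * t) *\<^sub>R u)) b" for t
  \<comment> \<open>A spectral value 0 at \<open>c\<close> would give \<open>P(x(t))c = 0\<close>, contradicting injectivity.\<close>
  have KO: "x t \<in> ?K \<longleftrightarrow> x t \<in> sym_cone" for t
  proof
    assume K: "x t \<in> ?K"
    obtain C l where C: "complete_system C" "x t = lincomb C l" by (rule spectralE)
    obtain v where v: "b = jexp v" using b by (rule sym_coneE)
    have "0 < l c" if c: "c \<in> C" for c
    proof -
      have "0 \<le> inner (x t) c" using K squares_iff complete_systemD(3)[OF C(1) c] by blast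
      then have "0 \<le> l c" unfolding C(2) inner_lincomb_member[OF C(1) c]
        using idempotent_pos[OF C(1) c] by (simp add: zero_le_mult_iff)
      moreover have "l c \<noteq> 0"
      proof
        assume "l c = 0"
        then have "quad_rep (x t) c = 0" by (simp add: C(2) quad_rep_lincomb_member[OF C(1) c])
        then have "quad_rep (jexp (t *\<^sub>R u)) (quad_rep b (quad_rep (jexp (t *\<^sub>R u)) c)) = 0"
          unfolding x_def by (simp add: quad_rep_fundamental_jexp)
        then have "c = 0" unfolding v by (metis quad_rep_jexp_inverse(2) quad_rep_0)
        then show False using complete_systemD(2)[OF C(1)] c by simp
      qed
      ultimately show ?thesis by simp
    qed
    then show "x t \<in> sym_cone" unfolding C(2) lincomb_sym_cone_iff[OF C(1)] by blast
  next
    show "x t \<in> sym_cone \<Longrightarrow> x t \<in> ?K" using interior_subset unfolding sym_cone_def by blast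
  qed
  have "(x has_vector_derivative (2 * 1) *\<^sub>R (u \<odot> x t) + quad_rep (jexp ((0 + 1 * t) *\<^sub>R u)) 0) (at t)" for t
    unfolding x_def by (rule has_vector_derivative_quad_rep_jexp_line[OF has_vector_derivative_const])
  then have cont: "continuous_on UNIV x"
    by (meson continuous_at_imp_continuous_on has_vector_derivative_continuous)
  have "x -` sym_cone = x -` ?K" using KO by blast
  moreover have "open (x -` sym_cone)" by (rule open_vimage[OF open_sym_cone cont])
  moreover have "closed (x -` ?K)" by (rule closed_vimage[OF closed_squares cont])
  ultimately have "x -` sym_cone = {} \<or> x -` sym_cone = UNIV"
    using clopen by metis
  moreover have "0 \<in> x -` sym_cone" using b by (simp add: x_def)
  ultimately have "x 1 \<in> sym_cone" by blast
  then show ?thesis by (simp add: x_def)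
qed

lemma quad_rep_in_sym_cone [simp, intro]: "a \<in> sym_cone \<Longrightarrow> b \<in> sym_cone \<Longrightarrow> quad_rep a b \<in> sym_cone"
  by (auto elim!: sym_coneE[of a] intro: quad_rep_jexp_sym_cone)

section \<open>Powers\<close>

lemma jpow_in_sym_cone [simp, intro]: "a \<in> sym_cone \<Longrightarrow> jpow a s \<in> sym_cone"
  by (auto elim!: sym_coneE simp: jpow_jexp)

lemma jln_jpow: "a \<in> sym_cone \<Longrightarrow> jln (jpow a s) = s *\<^sub>R jln a"
  by (auto elim!: sym_coneE simp: jpow_jexp)

lemma jpow_jpow: "a \<in> sym_cone \<Longrightarrow> jpow (jpow a s) t = jpow a (s * t)"
  by (auto elim!: sym_coneE simp: jpow_jexp mult.commute)

lemma jpow_0 [simp]: "a \<in> sym_cone \<Longrightarrow> jpow a 0 = jone"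
  by (auto elim!: sym_coneE simp: jpow_jexp)

lemma jpow_1 [simp]: "a \<in> sym_cone \<Longrightarrow> jpow a 1 = a"
  by (auto elim!: sym_coneE simp: jpow_jexp)

lemma jpow_jone [simp]: "jpow jone s = jone"
  using jpow_jexp[of 0 s] by simp

lemma quad_rep_jpow_jpow: "a \<in> sym_cone \<Longrightarrow> quad_rep (jpow a s) (jpow a t) = jpow a (2 * s + t)"
  by (auto elim!: sym_coneE simp: jpow_jexp quad_rep_jexp_jexp)

lemma quad_rep_jpow_add:
  "a \<in> sym_cone \<Longrightarrow> quad_rep (jpow a s) (quad_rep (jpow a t) y) = quad_rep (jpow a (s + t)) y"
  by (auto elim!: sym_coneE simp: jpow_jexp quad_rep_jexp_add)

lemma quad_rep_cancel:
  assumes "a \<in> sym_cone"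
  shows "quad_rep (jpow a s) (quad_rep (jpow a (- s)) y) = y"
    "quad_rep (jpow a (- s)) (quad_rep (jpow a s) y) = y"
    "quad_rep a (quad_rep (jpow a (- 1)) y) = y" "quad_rep (jpow a (- 1)) (quad_rep a y) = y"
  using quad_rep_jpow_add[OF assms, of s "-s" y] quad_rep_jpow_add[OF assms, of "-s" s y]
    quad_rep_jpow_add[OF assms, of 1 "-1" y] quad_rep_jpow_add[OF assms, of "-1" 1 y] assms by simp_all

text \<open>
  On the cone the inverse is determined by \<open>P(x) x\<^sup>-\<^sup>1 = x\<close>; this turns the fundamental formula into
  the rule \<open>(P(a)b)\<^sup>-\<^sup>1 = P(a\<^sup>-\<^sup>1) b\<^sup>-\<^sup>1\<close>.
\<close>

lemma quad_rep_inverse_unique: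
  assumes "x \<in> sym_cone" "quad_rep x y = x"
  shows "y = jpow x (-1)"
proof -
  have "y = quad_rep (jpow x (-1)) x" using quad_rep_cancel(4)[OF assms(1), of y] assms(2) by simp
  also have "\<dots> = jpow x (-1)" using quad_rep_jpow_jpow[OF assms(1), of "-1" 1] assms(1) by simp
  finally show ?thesis .
qed

lemma jpow_minus_1_quad_rep:
  assumes a: "a \<in> sym_cone" and b: "b \<in> sym_cone"
  shows "jpow (quad_rep a b) (-1) = quad_rep (jpow a (-1)) (jpow b (-1))"
proof -
  have bb: "quad_rep b (jpow b (-1)) = b" using quad_rep_jpow_jpow[OF b, of 1 "-1"] b by simp
  have "quad_rep (quad_rep a b) (quad_rep (jpow a (-1)) (jpow b (-1))) = quad_rep a b"
    by (simp add: quad_rep_fundamental[OF a] quad_rep_cancel(3)[OF a] bb)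
  from quad_rep_inverse_unique[OF _ this] show ?thesis using a b by simp
qed


text \<open>
  The exponent \<open>-1/2\<close> appears both as a quotient and as a negated quotient, the latter being its
  normal form under simplification.
\<close>

lemma quad_rep_half_cancel:
  assumes "a \<in> sym_cone"
  shows "quad_rep (jpow a (1/2)) (quad_rep (jpow a (-1/2)) y) = y"
    "quad_rep (jpow a (-1/2)) (quad_rep (jpow a (1/2)) y) = y"
    "quad_rep (jpow a (1/2)) (quad_rep (jpow a (- (1/2))) y) = y"
    "quad_rep (jpow a (- (1/2))) (quad_rep (jpow a (1/2)) y) = y"
  using quad_rep_cancel(1,2)[OF assms, of "1/2" y] by simp_all

lemma quad_rep_half_jone:
  assumes "a \<in> sym_cone"
  shows "quad_rep (jpow a (1/2)) jone = a" "quad_rep (jpow a (-1/2)) a = jone"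
  using quad_rep_jpow_jpow[OF assms, of "1/2" 0] quad_rep_jpow_jpow[OF assms, of "-1/2" 1] assms
  by simp_all

section \<open>The logarithmic distance and its invariance\<close>

text \<open>
  The distance of the cone up to normalization: the norm of the algebra replaces the sum over
  spectral values.
\<close>

definition log_dist :: "'a::euclidean_jordan_algebra \<Rightarrow> 'a \<Rightarrow> real" where
  "log_dist a b = norm (jln (quad_rep (jpow a (-1/2)) b))"

lemma log_dist_jone: "log_dist jone b = norm (jln b)"
  by (simp add: log_dist_def)

lemma jordan_automorphismI:
  assumes "linear k" "bij k" and sq: "\<And>x. k (x \<odot> x) = k x \<odot> k x"
  shows "jordan_automorphism k"
proof -
  have "k (x \<odot> y) = k x \<odot> k y" for x y
  proof -
    have "(x + y) \<odot> (x + y) - x \<odot> x - y \<odot> y = 2 *\<^sub>R (x \<odot> y)" for x y :: 'a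
      by (simp add: jmult_expand jmult_commute[of y x] scaleR_2)
    note e = this
    have "2 *\<^sub>R k (x \<odot> y) = k ((x + y) \<odot> (x + y) - x \<odot> x - y \<odot> y)"
      by (simp only: e linear_scale[OF assms(1)])
    also have "\<dots> = (k x + k y) \<odot> (k x + k y) - k x \<odot> k x - k y \<odot> k y"
      by (simp only: linear_diff[OF assms(1)] sq linear_add[OF assms(1)])
    also have "\<dots> = 2 *\<^sub>R (k x \<odot> k y)" by (rule e)
    finally show ?thesis by simp
  qed
  then show ?thesis using assms by (simp add: jordan_automorphism_def)
qed

text \<open>
  Let \<open>h = (P(g)a)\<^sup>-\<^sup>1\<^sup>/\<^sup>2\<close>. Then \<open>k = P(h) P(g) P(a\<^sup>1\<^sup>/\<^sup>2)\<close> fixes the unit and maps the argument of the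
  logarithm for \<open>(a, b)\<close> to that for \<open>(P(g)a, P(g)b)\<close>. The fundamental formula gives
  \<open>P(kx) = k P(x) k'\<close> with \<open>k'\<close> the adjoint of \<open>k\<close>. For \<open>x = e\<close> this says that \<open>k\<close> is orthogonal; applied
  to \<open>e\<close> it says that \<open>k\<close> preserves squares. So \<open>k\<close> commutes with the logarithm and keeps norms.
\<close>

lemma log_dist_quad_rep:
  fixes g :: "'a::euclidean_jordan_algebra"
  assumes g: "g \<in> sym_cone" and a: "a \<in> sym_cone"
  shows "log_dist (quad_rep g a) (quad_rep g b) = log_dist a b"
proof -
  let ?r = "jpow a (1/2)"
  define h where "h = jpow (quad_rep g a) (-1/2)"
  define k where "k y = quad_rep h (quad_rep g (quad_rep ?r y))" for y
  define k' where "k' y = quad_rep ?r (quad_rep g (quad_rep h y))" for y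
  have ga: "quad_rep g a \<in> sym_cone" using g a by simp
  have h: "h \<in> sym_cone" and r: "?r \<in> sym_cone" using ga a by (simp_all add: h_def)
  have k1: "k jone = jone"
    unfolding k_def h_def by (simp only: quad_rep_half_jone[OF a] quad_rep_half_jone[OF ga])
  have FF: "quad_rep (k x) y = k (quad_rep x (k' y))" for x y
    unfolding k_def k'_def by (simp add: quad_rep_fundamental h r g)
  have kk': "k (k' y) = y" for y using FF[of jone y] by (simp add: k1)
  have lin: "linear k"
    unfolding k_def using linear_compose[OF linear_compose[OF linear_quad_rep linear_quad_rep] linear_quad_rep]
    by (simp add: o_def)
  have surj: "surj k" using kk' by (metis surjI)
  have inj: "inj k" using linear_surjective_imp_injective[OF lin surj] by blast
  have k'k: "k' (k y) = y" for y using kk' inj by (metis injD)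
  have adj: "inner (k x) y = inner x (k' y)" for x y by (simp add: k_def k'_def quad_rep_inner)
  have "k (x \<odot> x) = k x \<odot> k x" for x
  proof -
    have "k' jone = jone" using k'k[of jone] k1 by simp
    then show ?thesis using FF[of x jone] by (simp add: quad_rep_jone_right)
  qed
  then have aut: "jordan_automorphism k"
    using lin surj inj by (intro jordan_automorphismI) (auto simp: bij_def)
  have iso: "norm (k y) = norm y" for y by (simp add: norm_eq_sqrt_inner adj k'k)
  have "log_dist (quad_rep g a) (quad_rep g b) = norm (jln (k (quad_rep (jpow a (-1/2)) b)))"
    unfolding log_dist_def k_def h_def quad_rep_half_cancel(1)[OF a] ..
  also have "\<dots> = log_dist a b"
    by (simp add: jln_def jordan_automorphism_jfun[OF aut, symmetric] iso log_dist_def)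
  finally show ?thesis .
qed

lemma log_dist_translate:
  assumes a: "a \<in> sym_cone" and b: "b \<in> sym_cone"
  shows "log_dist b c = log_dist (quad_rep (jpow a (-1/2)) b) (quad_rep (jpow a (-1/2)) c)"
  using log_dist_quad_rep[OF _ b] a by simp

lemma log_dist_jpow_jpow:
  assumes "z \<in> sym_cone"
  shows "log_dist (jpow z s) (jpow z t) = \<bar>s - t\<bar> * norm (jln z)"
  using assms unfolding log_dist_def
  by (simp add: jpow_jpow quad_rep_jpow_jpow jln_jpow abs_minus_commute)

lemma log_dist_sym:
  assumes "a \<in> sym_cone" "b \<in> sym_cone"
  shows "log_dist a b = log_dist b a"
proof -
  define z where "z = quad_rep (jpow a (-1/2)) b"
  have z: "z \<in> sym_cone" using assms by (simp add: z_def)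
  have "log_dist b a = log_dist z jone"
    using log_dist_translate[OF assms, of a] assms(1) by (simp only: z_def quad_rep_half_jone)
  also have "\<dots> = norm (jln z)" using log_dist_jpow_jpow[OF z, of 1 0] z by simp
  finally show ?thesis by (simp add: z_def log_dist_def)
qed

lemma log_dist_eq_0_iff:
  assumes "a \<in> sym_cone" "b \<in> sym_cone"
  shows "log_dist a b = 0 \<longleftrightarrow> a = b"
proof
  define z where "z = quad_rep (jpow a (-1/2)) b"
  assume "log_dist a b = 0"
  then have "jexp (jln z) = jone" by (simp add: log_dist_def z_def)
  then have "z = jone" using assms by (simp add: z_def)
  then show "a = b" using quad_rep_half_cancel(1)[OF assms(1), of b] quad_rep_half_jone[OF assms(1)]
    by (simp add: z_def)
next
  assume "a = b"
  then show "log_dist a b = 0" using quad_rep_half_jone(2)[OF assms(1)] by (simp add: log_dist_def)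
qed

section \<open>The exponential map increases distances\<close>

text \<open>
  With \<open>z = P(x\<^sup>-\<^sup>1\<^sup>/\<^sup>2) y\<close> this is \<open>\<langle>z + z\<^sup>-\<^sup>1 - 2e, e\<rangle>\<close>, that is, the sum of
  \<open>4 sinh\<^sup>2(m/2)\<close> over the logarithms \<open>m\<close> of the spectral values of \<open>z\<close>, weighted by the squared
  norms of the idempotents.
\<close>

definition inv_gap :: "'a::euclidean_jordan_algebra \<Rightarrow> 'a \<Rightarrow> real" where
  "inv_gap x y = inner x (jpow y (-1)) + inner y (jpow x (-1)) - 2 * inner jone (jone :: 'a)"

lemma exp_symmetric_bounds:
  fixes t :: real
  shows "t\<^sup>2 \<le> exp t + exp (- t) - 2" "exp t + exp (- t) - 2 \<le> t\<^sup>2 * exp \<bar>t\<bar>"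
proof -
  define s where "s = \<bar>t\<bar> / 2"
  have s: "s \<ge> 0" "\<bar>t\<bar> = 2 * s" by (auto simp: s_def)
  have sq: "(exp s - exp (- s))\<^sup>2 = exp t + exp (- t) - 2"
    by (cases "t \<ge> 0") (simp_all add: s_def power2_diff flip: exp_double exp_add)
  \<comment> \<open>The quadratic Taylor bound for \<open>exp s\<close> gives \<open>2 * s \<le> exp s - exp (- s)\<close>, because \<open>2 * s \<le> q - 1 / q\<close>.\<close>
  define q where "q = 1 + s + s\<^sup>2 / 2"
  have q: "q \<ge> 1" using s(1) by (simp add: q_def)
  have eq: "q \<le> exp s" unfolding q_def by (rule exp_lower_Taylor_quadratic[OF s(1)])
  have "(1 + s\<^sup>2 / 2)\<^sup>2 \<ge> 1 + s\<^sup>2" by (simp add: power2_sum)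
  moreover have "q\<^sup>2 - 2 * s * q = (1 + s\<^sup>2 / 2)\<^sup>2 - s\<^sup>2"
    by (simp add: q_def power2_eq_square algebra_simps)
  ultimately have "2 * s * q \<le> q\<^sup>2 - 1" by simp
  then have "2 * s \<le> q - 1 / q" using q by (simp add: field_simps power2_eq_square)
  also have "\<dots> \<le> exp s - exp (- s)"
  proof -
    have "exp (- s) \<le> 1 / q" using eq q by (simp add: exp_minus field_simps)
    then show ?thesis using eq by simp
  qed
  finally have l: "2 * s \<le> exp s - exp (- s)" .
  then have "(2 * s)\<^sup>2 \<le> (exp s - exp (- s))\<^sup>2" using s(1) by (intro power_mono) auto
  then show "t\<^sup>2 \<le> exp t + exp (- t) - 2" unfolding sq s(2)[symmetric] by simp
  have "exp s - exp (- s) = exp s * (1 - exp (- 2 * s))"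
    by (simp add: right_diff_distrib flip: exp_add)
  also have "\<dots> \<le> exp s * (2 * s)"
  proof (rule mult_left_mono)
    show "1 - exp (- 2 * s) \<le> 2 * s" using exp_ge_add_one_self[of "- 2 * s"] by linarith
  qed simp
  finally have "(exp s - exp (- s))\<^sup>2 \<le> (exp s * (2 * s))\<^sup>2" using l s(1) by (intro power_mono) auto
  also have "\<dots> = \<bar>t\<bar>\<^sup>2 * exp \<bar>t\<bar>" by (simp only: s(2) power_mult_distrib exp_double) (simp add: ac_simps)
  finally show "exp t + exp (- t) - 2 \<le> t\<^sup>2 * exp \<bar>t\<bar>" unfolding sq by simp
qed

lemma norm_diff_le_inv_gap:
  fixes u v :: "'a::euclidean_jordan_algebra"
  shows "(norm (u - v))\<^sup>2 \<le> inv_gap (jexp u) (jexp v)"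
proof -
  obtain C l where C: "complete_system C" "u = lincomb C l" by (rule spectralE)
  obtain D m where D: "complete_system D" "v = lincomb D m" by (rule spectralE)
  have i1: "inner (jexp u) (jexp (- v)) = (\<Sum>c\<in>C. \<Sum>d\<in>D. exp (l c - m d) * inner c d)"
    using lincomb_scaleR[of "-1" D m]
    by (simp add: C D jexp_lincomb lincomb_inner_lincomb flip: exp_add)
  have i2: "inner (jexp v) (jexp (- u)) = (\<Sum>c\<in>C. \<Sum>d\<in>D. exp (- (l c - m d)) * inner c d)"
    using lincomb_scaleR[of "-1" C l]
    by (subst inner_commute) (simp add: C D jexp_lincomb lincomb_inner_lincomb flip: exp_add)
  have i3: "inner jone (jone::'a) = (\<Sum>c\<in>C. \<Sum>d\<in>D. inner c d)"
    by (simp add: complete_system_sum_inner[OF C(1)] complete_system_sum_inner[OF D(1)])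
  have "(norm (u - v))\<^sup>2 = (\<Sum>c\<in>C. \<Sum>d\<in>D. (l c - m d)\<^sup>2 * inner c d)"
    by (simp add: C D norm_lincomb_diff)
  also have "\<dots> \<le> (\<Sum>c\<in>C. \<Sum>d\<in>D. (exp (l c - m d) + exp (- (l c - m d)) - 2) * inner c d)"
    by (intro sum_mono mult_right_mono exp_symmetric_bounds complete_system_inner_nonneg[OF C(1) D(1)])
  also have "\<dots> = inv_gap (jexp u) (jexp v)"
    unfolding inv_gap_def jpow_jexp scaleR_minus1_left i1 i2 i3
    by (simp add: left_diff_distrib distrib_right sum.distrib sum_subtractf sum_distrib_left)
  finally show ?thesis .
qed

lemma inner_jexp_jexp: "inner (jexp (s *\<^sub>R u)) (jexp (t *\<^sub>R u)) = inner jone (jexp ((s + t) *\<^sub>R u))"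
proof -
  have "jexp (s *\<^sub>R u) = quad_rep (jexp ((s/2) *\<^sub>R u)) jone"
    using quad_rep_jexp_jexp[of "s/2" u 0] by simp
  then show ?thesis using quad_rep_jexp_jexp[of "s/2" u t] by (simp add: quad_rep_inner)
qed

text \<open>
  Since \<open>(P(g)y)\<^sup>-\<^sup>1 = P(g\<^sup>-\<^sup>1) y\<^sup>-\<^sup>1\<close> and \<open>P(g)\<close> is symmetric, \<open>g\<close> cancels from both inner products.
\<close>

lemma inv_gap_geodesic:
  assumes g: "g \<in> sym_cone"
  shows "inv_gap (quad_rep g (jexp (s *\<^sub>R u))) (quad_rep g (jexp (t *\<^sub>R u))) = inv_gap jone (jexp ((t - s) *\<^sub>R u))"
proof -
  have "inner (quad_rep g (jexp (s *\<^sub>R u))) (jpow (quad_rep g (jexp (t *\<^sub>R u))) (-1)) =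
    inner jone (jexp ((s - t) *\<^sub>R u))" for s t
    using inner_jexp_jexp[of s u "-t"]
    by (simp add: jpow_minus_1_quad_rep g quad_rep_inner quad_rep_cancel(3)[OF g] jpow_jexp)
  then show ?thesis
    by (simp add: inv_gap_def jpow_jexp flip: scaleR_minus_left) (simp add: inner_commute)
qed

lemma inv_gap_upper:
  fixes u :: "'a::euclidean_jordan_algebra"
  shows "\<exists>M\<ge>0. \<forall>s. inv_gap jone (jexp (s *\<^sub>R u)) \<le> s\<^sup>2 * exp (\<bar>s\<bar> * M) * (norm u)\<^sup>2"
proof -
  obtain B where B: "B > 0" "\<And>C l c. complete_system (C::'a set) \<Longrightarrow> c \<in> C \<Longrightarrow> \<bar>l c\<bar> \<le> B * norm (lincomb C l)"
    using spectral_bound by metis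
  obtain C l where C: "complete_system C" "u = lincomb C l" by (rule spectralE)
  define M where "M = B * norm u"
  have one: "jone = lincomb C (\<lambda>_. 1)" using lincomb_const[OF C(1), of 1] by simp
  have i: "inner jone (lincomb C m) = (\<Sum>c\<in>C. m c * inner c c)" for m
    unfolding lincomb_def inner_sum_right
    by (intro sum.cong refl) (simp add: inner_jone_idempotent complete_systemD(3)[OF C(1)])
  have j: "inner jone (jone::'a) = (\<Sum>c\<in>C. inner c c)"
    using i[of "\<lambda>_. 1"] by (simp flip: one)
  have "inv_gap jone (jexp (s *\<^sub>R u)) \<le> s\<^sup>2 * exp (\<bar>s\<bar> * M) * (norm u)\<^sup>2" for s
  proof -
    have "inv_gap jone (jexp (s *\<^sub>R u)) = inner jone (jexp (s *\<^sub>R u)) + inner jone (jexp ((- s) *\<^sub>R u)) - 2 * inner jone (jone::'a)"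
      by (simp add: inv_gap_def jpow_jexp inner_commute)
    also have "\<dots> = (\<Sum>c\<in>C. (exp (s * l c) + exp (- (s * l c)) - 2) * inner c c)"
      unfolding C(2) lincomb_scaleR jexp_lincomb[OF C(1)] i
      unfolding j by (simp add: left_diff_distrib distrib_right sum.distrib sum_subtractf sum_distrib_left)
    also have "\<dots> \<le> (\<Sum>c\<in>C. (s\<^sup>2 * exp (\<bar>s\<bar> * M)) * ((l c)\<^sup>2 * inner c c))"
    proof (intro sum_mono)
      fix c assume c: "c \<in> C"
      have "\<bar>s * l c\<bar> \<le> \<bar>s\<bar> * M"
        using B(2)[OF C(1) c, of l] by (simp add: abs_mult M_def C(2) mult_left_mono)
      then have "(s * l c)\<^sup>2 * exp \<bar>s * l c\<bar> \<le> (s * l c)\<^sup>2 * exp (\<bar>s\<bar> * M)" by (simp add: mult_left_mono)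
      with exp_symmetric_bounds(2)[of "s * l c"]
      have "exp (s * l c) + exp (- (s * l c)) - 2 \<le> (s\<^sup>2 * exp (\<bar>s\<bar> * M)) * (l c)\<^sup>2"
        by (simp add: power_mult_distrib ac_simps)
      then show "(exp (s * l c) + exp (- (s * l c)) - 2) * inner c c \<le> (s\<^sup>2 * exp (\<bar>s\<bar> * M)) * ((l c)\<^sup>2 * inner c c)"
        unfolding mult.assoc[symmetric] by (intro mult_right_mono) auto
    qed
    also have "\<dots> = s\<^sup>2 * exp (\<bar>s\<bar> * M) * (norm u)\<^sup>2"
      by (simp only: C(2) norm_lincomb[OF C(1)] sum_distrib_left)
    finally show ?thesis .
  qed
  moreover have "M \<ge> 0" using B(1) by (simp add: M_def)
  ultimately show ?thesis by blast
qed

lemma log_dist_le_inv_gap: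
  assumes "x \<in> sym_cone" "y \<in> sym_cone"
  shows "(log_dist x y)\<^sup>2 \<le> inv_gap x y"
proof -
  define u where "u = jln (quad_rep (jpow x (-1/2)) y)"
  let ?g = "jpow x (1/2)"
  have y: "y = quad_rep ?g (jexp (1 *\<^sub>R u))" using assms by (simp add: u_def quad_rep_half_cancel)
  have x: "x = quad_rep ?g (jexp (0 *\<^sub>R u))" using quad_rep_half_jone(1)[OF assms(1)] by simp
  have "(norm (0 - u))\<^sup>2 \<le> inv_gap (jexp 0) (jexp u)" by (rule norm_diff_le_inv_gap)
  also have "\<dots> = inv_gap x y"
    using inv_gap_geodesic[of ?g 0 u 1] x y assms by simp
  finally show ?thesis by (simp add: log_dist_def u_def)
qed

text \<open>
  The geodesic from \<open>x\<close> to \<open>y\<close> is cut into \<open>n\<close> equal pieces. Each piece moves the logarithm by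
  at most the square root of the gap of its end points, which is at most \<open>exp(M/(2n)) \<parallel>u\<parallel> / n\<close>; the sum
  tends to \<open>\<parallel>u\<parallel> = log_dist x y\<close>.
\<close>

lemma norm_jln_diff_le_log_dist:
  assumes "x \<in> sym_cone" "y \<in> sym_cone"
  shows "norm (jln x - jln y) \<le> log_dist x y"
proof -
  define u where "u = jln (quad_rep (jpow x (-1/2)) y)"
  let ?g = "jpow x (1/2)"
  have g: "?g \<in> sym_cone" using assms by simp
  define p where "p s = quad_rep ?g (jexp (s *\<^sub>R u))" for s
  have y: "y = p 1" using assms by (simp add: p_def u_def quad_rep_half_cancel)
  have x: "x = p 0" using quad_rep_half_jone(1)[OF assms(1)] by (simp add: p_def)
  have p: "p s \<in> sym_cone" for s using assms by (simp add: p_def)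
  obtain M where M: "M \<ge> 0" "\<And>s. inv_gap jone (jexp (s *\<^sub>R u)) \<le> s\<^sup>2 * exp (\<bar>s\<bar> * M) * (norm u)\<^sup>2"
    using inv_gap_upper by blast
  have bound: "norm (jln x - jln y) \<le> exp (M / 2 / real (Suc k)) * norm u" for k
  proof -
    define n where "n = Suc k"
    have n: "real n > 0" by (simp add: n_def)
    define v where "v i = jln (p (real i / real n))" for i :: nat
    have step: "norm (v (Suc i) - v i) \<le> exp (M / 2 / real n) * norm u / real n" for i
    proof (rule power2_le_imp_le)
      have "(norm (v (Suc i) - v i))\<^sup>2 = (norm (v i - v (Suc i)))\<^sup>2" by (simp add: norm_minus_commute)
      also have "\<dots> \<le> inv_gap (jexp (v i)) (jexp (v (Suc i)))"
        by (rule norm_diff_le_inv_gap)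
      also have "\<dots> = inv_gap jone (jexp ((1 / real n) *\<^sub>R u))"
        using inv_gap_geodesic[OF g, of "real i / real n" u "real (Suc i) / real n"]
        by (simp add: v_def p) (simp add: p_def add_divide_distrib)
      also have "\<dots> \<le> (1 / real n)\<^sup>2 * exp (\<bar>1 / real n\<bar> * M) * (norm u)\<^sup>2" by (rule M(2))
      also have "\<dots> = (exp (M / 2 / real n) * norm u / real n)\<^sup>2"
        by (simp add: power_mult_distrib power_divide flip: exp_double)
      finally show "(norm (v (Suc i) - v i))\<^sup>2 \<le> (exp (M / 2 / real n) * norm u / real n)\<^sup>2" .
    qed simp
    have "norm (jln x - jln y) = norm (\<Sum>i<n. v (Suc i) - v i)"
      using n unfolding sum_lessThan_telescope by (simp add: v_def x y norm_minus_commute)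
    also have "\<dots> \<le> (\<Sum>i<n. exp (M / 2 / real n) * norm u / real n)"
      by (rule order_trans[OF norm_sum]) (intro sum_mono step)
    also have "\<dots> = exp (M / 2 / real n) * norm u" using n by simp
    finally show ?thesis by (simp add: n_def)
  qed
  have "(\<lambda>k. M / 2 / real (Suc k)) \<longlonglongrightarrow> 0"
    by (rule LIMSEQ_Suc[OF lim_const_over_n])
  then have "(\<lambda>k. exp (M / 2 / real (Suc k)) * norm u) \<longlonglongrightarrow> exp 0 * norm u"
    by (intro tendsto_mult tendsto_exp tendsto_const)
  then have "norm (jln x - jln y) \<le> exp 0 * norm u"
    by (rule LIMSEQ_le_const) (use bound in blast)
  then show ?thesis by (simp add: log_dist_def u_def)
qed

section \<open>Triangle inequality and convexity\<close>

text \<open>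
  For \<open>x = e\<close> the claim is the triangle inequality of the norm for the logarithms of \<open>y\<close> and \<open>z\<close>,
  together with the fact that logarithms do not increase distances.
\<close>

lemma log_dist_triangle:
  assumes "x \<in> sym_cone" "y \<in> sym_cone" "z \<in> sym_cone"
  shows "log_dist x z \<le> log_dist x y + log_dist y z"
proof -
  let ?P = "quad_rep (jpow x (-1/2))"
  have "jln (?P z) = jln (?P y) + (jln (?P z) - jln (?P y))" by simp
  then have "norm (jln (?P z)) \<le> norm (jln (?P y)) + norm (jln (?P z) - jln (?P y))"
    using norm_triangle_ineq by metis
  also have "norm (jln (?P z) - jln (?P y)) \<le> log_dist (?P y) (?P z)"
    using norm_jln_diff_le_log_dist[of "?P y" "?P z"] assms by (simp add: norm_minus_commute)
  also have "log_dist (?P y) (?P z) = log_dist y z" using log_dist_translate[OF assms(1,2)] by simp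
  finally show ?thesis by (simp add: log_dist_def)
qed

lemma wgeo_mean_in_sym_cone [simp, intro]:
  "a \<in> sym_cone \<Longrightarrow> b \<in> sym_cone \<Longrightarrow> wgeo_mean t a b \<in> sym_cone"
  by (simp add: wgeo_mean_def)

lemma wgeo_mean_0: "a \<in> sym_cone \<Longrightarrow> b \<in> sym_cone \<Longrightarrow> wgeo_mean 0 a b = a"
  by (simp add: wgeo_mean_def quad_rep_half_jone)

lemma wgeo_mean_1: "a \<in> sym_cone \<Longrightarrow> b \<in> sym_cone \<Longrightarrow> wgeo_mean 1 a b = b"
  by (simp add: wgeo_mean_def quad_rep_half_cancel)

lemma log_dist_wgeo_mean:
  assumes "a \<in> sym_cone" "b \<in> sym_cone"
  shows "log_dist (wgeo_mean s a b) (wgeo_mean t a b) = \<bar>s - t\<bar> * log_dist a b"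
proof -
  have "log_dist a b = norm (jln (quad_rep (jpow a (-1/2)) b))" by (simp only: log_dist_def)
  then show ?thesis using assms by (simp add: wgeo_mean_def log_dist_quad_rep log_dist_jpow_jpow)
qed

text \<open>
  The map \<open>Q P(a\<^sup>-\<^sup>1\<^sup>/\<^sup>2)\<close>, with \<open>Q = P(z\<^sup>-\<^sup>t\<^sup>/\<^sup>2)\<close> and \<open>z = P(a\<^sup>-\<^sup>1\<^sup>/\<^sup>2) b\<close>, moves the point of the
  geodesic to the unit and its ends to \<open>z\<^sup>-\<^sup>t\<close> and \<open>z\<^sup>1\<^sup>-\<^sup>t\<close>. The distance from the unit is a norm of a
  logarithm, the other two distances to \<open>w\<close> are bounded below by norms of differences of
  logarithms, and for these norms the inequality is an identity of Euclidean geometry.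
\<close>

lemma log_dist_wgeo_mean_le:
  assumes a: "a \<in> sym_cone" and b: "b \<in> sym_cone" and w: "w \<in> sym_cone" and t: "0 \<le> t" "t \<le> 1"
  shows "(log_dist (wgeo_mean t a b) w)\<^sup>2 \<le>
    (1 - t) * (log_dist a w)\<^sup>2 + t * (log_dist b w)\<^sup>2 - t * (1 - t) * (log_dist a b)\<^sup>2"
proof -
  let ?P = "quad_rep (jpow a (-1/2))"
  define z where "z = ?P b"
  have z: "z \<in> sym_cone" using a b by (simp add: z_def)
  let ?Q = "quad_rep (jpow z (- t / 2))"
  define v where "v = ?Q (?P w)"
  have v: "v \<in> sym_cone" using a z w by (simp add: v_def)
  have red: "log_dist y w = log_dist (?Q (?P y)) v" if "y \<in> sym_cone" for y
    using that log_dist_translate[OF a that, of w] log_dist_quad_rep[of "jpow z (- t/2)" "?P y" "?P w"] a z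
    by (simp add: v_def)
  define ze where "ze = jln z"
  have 1: "log_dist (wgeo_mean t a b) w = norm (jln v)"
  proof -
    have "?P (wgeo_mean t a b) = jpow z t" by (simp add: wgeo_mean_def z_def quad_rep_half_cancel[OF a])
    then show ?thesis using red[of "wgeo_mean t a b"] a b z
      by (simp add: quad_rep_jpow_jpow log_dist_jone)
  qed
  have 2: "norm ((- t) *\<^sub>R ze - jln v) \<le> log_dist a w"
  proof -
    have "log_dist a w = log_dist (jpow z (-t)) v"
      using red[OF a] quad_rep_half_jone(2)[OF a] quad_rep_jpow_jpow[OF z, of "-t/2" 0] z by simp
    then show ?thesis
      using norm_jln_diff_le_log_dist[of "jpow z (-t)" v] z v by (simp add: jln_jpow ze_def)
  qed
  have 3: "norm ((1 - t) *\<^sub>R ze - jln v) \<le> log_dist b w"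
  proof -
    have "log_dist b w = log_dist (?Q z) v" using red[OF b] by (simp only: z_def)
    then have "log_dist b w = log_dist (jpow z (1 - t)) v"
      using quad_rep_jpow_jpow[OF z, of "-t/2" 1] z by simp
    then show ?thesis
      using norm_jln_diff_le_log_dist[of "jpow z (1-t)" v] z v by (simp add: jln_jpow ze_def)
  qed
  have 4: "log_dist a b = norm ze" by (simp add: log_dist_def ze_def z_def)
  have "(norm (jln v))\<^sup>2 = (1 - t) * (norm ((- t) *\<^sub>R ze - jln v))\<^sup>2 + t * (norm ((1 - t) *\<^sub>R ze - jln v))\<^sup>2
      - t * (1 - t) * (norm ze)\<^sup>2"
    unfolding power2_norm_eq_inner
    by (simp add: inner_diff_left inner_diff_right inner_commute[of "jln v" ze] algebra_simps power2_eq_square)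
  also have "\<dots> \<le> (1 - t) * (log_dist a w)\<^sup>2 + t * (log_dist b w)\<^sup>2 - t * (1 - t) * (norm ze)\<^sup>2"
    using 2 3 t by (intro diff_right_mono add_mono mult_left_mono power_mono) auto
  finally show ?thesis by (simp add: 1 4)
qed

text \<open>
  Together with \<open>log_dist_le_inv_gap\<close>: convergence of logarithms in norm implies convergence of the
  exponentials in the distance of the cone.
\<close>

lemma inv_gap_tendsto:
  fixes v :: "'a::euclidean_jordan_algebra"
  assumes "u \<longlonglongrightarrow> v"
  shows "(\<lambda>n. inv_gap (jexp (u n)) (jexp v)) \<longlonglongrightarrow> 0"
proof -
  have "(\<lambda>n. inv_gap (jexp (u n)) (jexp v)) \<longlonglongrightarrow>
      inner (jexp v) (jexp (- v)) + inner (jexp v) (jexp (- v)) - 2 * inner jone (jone::'a)"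
    unfolding inv_gap_def jpow_jexp scaleR_minus1_left
    by (intro tendsto_intros tendsto_jexp assms)
  moreover have "inner (jexp v) (jexp (- v)) = inner jone (jone::'a)"
    using inner_jexp_jexp[of 1 v "-1"] by simp
  ultimately show ?thesis by simp
qed


section \<open>Primitive idempotents in a simple algebra\<close>

text \<open>
  If \<open>cy = y\<close>, then \<open>e - c\<close> is orthogonal to \<open>y\<^sup>2\<close>, hence to every member \<open>d\<close> of a spectral system of \<open>y\<close>
  with nonzero coefficient. Such a \<open>d\<close> satisfies \<open>cd = d\<close>, so \<open>c = d + (c - d)\<close> is a decomposition of
  \<open>c\<close> and primitivity forces \<open>d = c\<close>.
\<close>

lemma primitive_peirce_one:
  fixes c y :: "'a::euclidean_jordan_algebra"
  assumes c: "primitive_idempotent c" and y: "c \<odot> y = y"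
  shows "\<exists>\<alpha>. y = \<alpha> *\<^sub>R c"
proof -
  obtain D l where D: "complete_system D" "y = lincomb D l" by (rule spectralE)
  have cc: "c \<odot> c = c" "idempotent_elt c" using c by (auto simp: primitive_idempotent_def idempotent_elt_def)
  define e where "e = jone - c"
  have e: "idempotent_elt e" by (simp add: idempotent_elt_def e_def jmult_expand cc)
  have "inner e (lincomb D (\<lambda>d. (l d)\<^sup>2)) = inner (e \<odot> y) y"
    unfolding inner_square[symmetric] by (simp add: D lincomb_mult power2_eq_square)
  also have "\<dots> = 0" by (simp add: e_def jmult_expand y)
  finally have "(\<Sum>d\<in>D. (l d)\<^sup>2 * inner e d) = 0" by (simp add: lincomb_def inner_sum_right)
  then have 0: "(l d)\<^sup>2 * inner e d = 0" if "d \<in> D" for d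
    using that complete_systemD(1,3)[OF D(1)] idempotents_inner_nonneg[OF e]
    by (subst (asm) sum_nonneg_eq_0_iff) auto
  have "d = c" if d: "d \<in> D" "l d \<noteq> 0" for d
  proof -
    have di: "idempotent_elt d" using complete_systemD(3)[OF D(1) d(1)] .
    then have "e \<odot> d = 0" using 0[OF d(1)] d(2) idempotents_orthogonal_iff[OF e di] by simp
    then have cd: "c \<odot> d = d" by (simp add: e_def jmult_expand)
    have dd: "d \<odot> d = d" using di by (simp add: idempotent_elt_def)
    have "idempotent_elt (c - d)" "d \<odot> (c - d) = 0" "c = d + (c - d)"
      by (simp_all add: idempotent_elt_def jmult_expand cc cd dd jmult_commute[of d c])
    moreover have "d \<noteq> 0" using complete_systemD(2)[OF D(1)] d(1) by auto
    ultimately have "c - d = 0" using c di unfolding primitive_idempotent_def by blast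
    then show ?thesis by simp
  qed
  then have "y = (\<Sum>d\<in>D. if d = c then l c *\<^sub>R c else 0)"
    unfolding D(2) lincomb_def by (intro sum.cong refl) auto
  also have "\<dots> = (if c \<in> D then l c else 0) *\<^sub>R c" using complete_systemD(1)[OF D(1)] by simp
  finally show ?thesis by blast
qed

lemma quad_rep_primitive:
  fixes c x :: "'a::euclidean_jordan_algebra"
  assumes c: "primitive_idempotent c"
  shows "quad_rep c x = (inner x c / inner c c) *\<^sub>R c"
proof -
  have cc: "c \<odot> c = c" "idempotent_elt c" and c0: "c \<noteq> 0"
    using c by (auto simp: primitive_idempotent_def idempotent_elt_def)
  have "c \<odot> quad_rep c x = quad_rep c x"
    using idempotent_cubic[OF cc(2), of x]
    by (simp add: quad_rep_def cc jmult_expand algebra_simps scaleR_2)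
      (simp add: scaleR_left_distrib[of 2 1, simplified] scaleR_2)
  then obtain \<alpha> where a: "quad_rep c x = \<alpha> *\<^sub>R c" using primitive_peirce_one[OF c] by blast
  have "\<alpha> * inner c c = inner (quad_rep c x) c" by (simp add: a)
  also have "\<dots> = inner x c" by (simp add: quad_rep_inner) (simp add: quad_rep_def cc scaleR_2)
  finally show ?thesis using a c0 by (simp add: field_simps)
qed

text \<open>
  Apply \<open>P(P(c)d) = P(c)P(d)P(c)\<close> to \<open>c\<close>. With \<open>P(c)d = \<alpha>c\<close> and \<open>P(d)c = \<beta>d\<close> this gives \<open>\<alpha>\<^sup>2 = \<alpha>\<beta>\<close>, where
  \<open>\<alpha>\<close> and \<open>\<beta>\<close> are \<open>\<langle>c, d\<rangle>\<close> divided by \<open>\<langle>c, c\<rangle>\<close> and \<open>\<langle>d, d\<rangle>\<close> respectively.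
\<close>

lemma primitive_norm_eq:
  fixes c d :: "'a::euclidean_jordan_algebra"
  assumes c: "primitive_idempotent c" and d: "primitive_idempotent d" and ne: "inner c d \<noteq> 0"
  shows "inner c c = inner d d"
proof -
  have cc: "c \<odot> c = c" and c0: "c \<noteq> 0" and d0: "d \<noteq> 0"
    using c d by (auto simp: primitive_idempotent_def idempotent_elt_def)
  have Pc: "quad_rep c c = c" by (simp add: quad_rep_def cc scaleR_2)
  let ?a = "inner c d / inner c c" and ?b = "inner c d / inner d d"
  have "quad_rep (quad_rep c d) c = quad_rep c (quad_rep d (quad_rep c c))"
    using quad_rep_fundamental_square[of c d c] by (simp add: cc)
  moreover have cd: "quad_rep c d = ?a *\<^sub>R c" and dc: "quad_rep d c = ?b *\<^sub>R d"
    using quad_rep_primitive[OF c, of d] quad_rep_primitive[OF d, of c] by (simp_all add: inner_commute)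
  ultimately have "?a\<^sup>2 *\<^sub>R c = (?a * ?b) *\<^sub>R c"
    by (simp only: Pc cd dc quad_rep_scaleR_left quad_rep_scaleR scaleR_scaleR mult.commute[of ?b])
  then have "?a\<^sup>2 = ?a * ?b" using c0 by (simp only: scaleR_cancel_right) simp
  then have "?a = ?b" using ne c0 by (simp add: power2_eq_square)
  then show ?thesis using ne c0 d0 by (simp add: field_simps)
qed

text \<open>
  Fix a primitive \<open>c\<^sub>0\<close> and let \<open>J\<close> be the set of primitive idempotents whose norm differs from that of
  \<open>c\<^sub>0\<close>. By \<open>primitive_norm_eq\<close> the members of \<open>J\<close> annihilate all other primitive idempotents. Hence
  the annihilator of \<open>J\<close> is an ideal, since multiplications by orthogonal idempotents commute. It
  contains \<open>c\<^sub>0\<close>, so by simplicity it contains the unit, and \<open>J\<close> is empty.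
\<close>

lemma simple_primitive_norm:
  "\<exists>\<tau>>0. \<forall>c::'a::simple_euclidean_jordan_algebra. primitive_idempotent c \<longrightarrow> inner c c = \<tau>"
proof -
  obtain C where C: "jordan_frame (C::'a set)" "complete_system C" using spectralE by blast
  have "C \<noteq> {}" using complete_systemD(5)[OF C(2)] by auto
  then obtain c0 where c0: "primitive_idempotent (c0::'a)" using C(1) by (auto simp: jordan_frame_def)
  define J where "J = {j::'a. primitive_idempotent j \<and> inner j j \<noteq> inner c0 c0}"
  define I where "I = {y::'a. \<forall>j\<in>J. j \<odot> y = 0}"
  have orth: "j \<odot> c = 0" if "j \<in> J" "primitive_idempotent c" "c \<notin> J" for j c
  proof -
    have "inner j c = 0" using primitive_norm_eq[of j c] that by (auto simp: J_def)
    then show ?thesis using idempotents_orthogonal_iff[of j c] that by (auto simp: J_def primitive_idempotent_def)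
  qed
  have "x \<odot> y \<in> I" if y: "y \<in> I" for x y
  proof -
    obtain D l where D: "jordan_frame D" "complete_system D" "x = lincomb D l" by (rule spectralE)
    have "j \<odot> (c \<odot> y) = 0" if j: "j \<in> J" and c: "c \<in> D" for j c
    proof (cases "c \<in> J")
      case True
      then show ?thesis using y by (simp add: I_def jmult.zero_right)
    next
      case False
      have "primitive_idempotent c" using D(1) c by (simp add: jordan_frame_def)
      then have "j \<odot> c = 0" using orth j False by blast
      moreover have "idempotent_elt j" using j by (simp add: J_def primitive_idempotent_def)
      ultimately have "j \<odot> (c \<odot> y) = c \<odot> (j \<odot> y)" by (simp add: orthogonal_idempotents_commute)
      then show ?thesis using y j by (simp add: I_def jmult.zero_right)
    qed
    then show ?thesis
      unfolding D(3) lincomb_def by (simp add: I_def jmult.sum_left jmult.sum_right jmult.scaleR_left jmult.scaleR_right)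
  qed
  then have "jordan_ideal I"
    unfolding jordan_ideal_def by (auto simp: I_def jmult_expand jmult.zero_right)
  then have "I = {0} \<or> I = UNIV" by (rule jordan_simple)
  moreover have "c0 \<in> I" using orth c0 by (auto simp: I_def J_def)
  moreover have c00: "c0 \<noteq> 0" using c0 by (simp add: primitive_idempotent_def)
  ultimately have "jone \<in> I" by auto
  then have "J = {}" by (auto simp: I_def J_def primitive_idempotent_def)
  then show ?thesis using c00 by (intro exI[of _ "inner c0 c0"]) (auto simp: J_def)
qed

text \<open>
  The multiplicity of \<open>s\<close> can be read off from the element itself: with \<open>f\<close> the indicator of \<open>s\<close>, it is
  \<open>\<langle>f(x), e\<rangle>\<close> divided by the common squared norm of the primitive idempotents.
\<close>

lemma spectral_values_lincomb:
  fixes C :: "'a::simple_euclidean_jordan_algebra set"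
  assumes C: "jordan_frame C"
  shows "spectral_values (lincomb C l) = image_mset l (mset_set C)"
  unfolding spectral_values_def
proof (rule the_equality)
  show "\<exists>D m. spectral_decomp (lincomb C l) D m \<and> image_mset l (mset_set C) = image_mset m (mset_set D)"
    using C by (auto simp: spectral_decomp_def lincomb_def)
next
  fix S assume "\<exists>D m. spectral_decomp (lincomb C l) D m \<and> S = image_mset m (mset_set D)"
  then obtain D m where D: "jordan_frame D" "lincomb C l = lincomb D m" and S: "S = image_mset m (mset_set D)"
    by (auto simp: spectral_decomp_def lincomb_def)
  obtain \<tau> where \<tau>: "\<tau> > 0" "\<And>c::'a. primitive_idempotent c \<Longrightarrow> inner c c = \<tau>"
    using simple_primitive_norm by blast
  have count: "inner (lincomb E (\<lambda>c. if k c = s then 1 else 0)) jone = \<tau> * count (image_mset k (mset_set E)) s"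
    if E: "jordan_frame E" for E and k :: "'a \<Rightarrow> real" and s
  proof -
    note E' = jordan_frame_complete_system[OF E]
    have "inner c jone = \<tau>" if "c \<in> E" for c
      using E that \<tau>(2)[of c] inner_jone_idempotent[OF complete_systemD(3)[OF E' that]]
      by (simp add: jordan_frame_def inner_commute)
    then have "inner (lincomb E (\<lambda>c. if k c = s then 1 else 0)) jone = (\<Sum>c\<in>E. if s = k c then \<tau> else 0)"
      unfolding lincomb_def inner_sum_left by (intro sum.cong refl) auto
    also have "\<dots> = (\<Sum>c\<in>{c \<in> E. s = k c}. \<tau>)"
      by (rule sum.inter_filter[symmetric, OF complete_systemD(1)[OF E']])
    also have "\<dots> = \<tau> * count (image_mset k (mset_set E)) s"
    proof -
      have "count (image_mset k (mset_set E)) s = (\<Sum>c\<in>{c \<in> E. s = k c}. 1)"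
        unfolding count_image_mset' by (rule sum.cong) (use complete_systemD(1)[OF E'] in auto)
      then show ?thesis by simp
    qed
    finally show ?thesis .
  qed
  show "S = image_mset l (mset_set C)"
  proof (rule multiset_eqI)
    fix s
    have "lincomb C (\<lambda>c. if l c = s then 1 else 0) = lincomb D (\<lambda>c. if m c = s then 1 else 0)"
      by (rule lincomb_apply_eq[where f="\<lambda>t. if t = s then 1 else 0", OF _ _ D(2)])
        (intro jordan_frame_complete_system C D(1))+
    then show "count S s = count (image_mset l (mset_set C)) s"
      using count[OF C, of l s] count[OF D(1), of m s] \<tau>(1) by (simp add: S)
  qed
qed

lemma cone_dist_eq_log_dist:
  "\<exists>\<kappa>>0. \<forall>a\<in>sym_cone. \<forall>b::'a::simple_euclidean_jordan_algebra\<in>sym_cone. cone_dist a b = \<kappa> * log_dist a b"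
proof -
  obtain \<tau> where \<tau>: "\<tau> > 0" "\<And>c::'a. primitive_idempotent c \<Longrightarrow> inner c c = \<tau>"
    using simple_primitive_norm by blast
  have "cone_dist a b = 1 / sqrt \<tau> * log_dist a b" if ab: "a \<in> sym_cone" "b \<in> sym_cone" for a b :: 'a
  proof -
    obtain C l where C: "jordan_frame C" "complete_system C" "quad_rep (jpow a (-1/2)) b = lincomb C l"
      by (rule spectralE)
    have "(log_dist a b)\<^sup>2 = (\<Sum>c\<in>C. (ln (l c))\<^sup>2 * inner c c)"
      unfolding log_dist_def C(3) jln_def by (simp add: jfun_lincomb norm_lincomb C(2))
    also have "\<dots> = \<tau> * (\<Sum>c\<in>C. (ln (l c))\<^sup>2)"
      unfolding sum_distrib_left using C(1) \<tau>(2)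
      by (intro sum.cong refl) (simp add: jordan_frame_def)
    also have "(\<Sum>c\<in>C. (ln (l c))\<^sup>2) = (\<Sum>s\<in>#spectral_values (quad_rep (jpow a (-1/2)) b). (ln s)\<^sup>2)"
      unfolding C(3) spectral_values_lincomb[OF C(1)] sum_unfold_sum_mset
      by (simp add: image_mset.compositionality comp_def)
    finally have "(log_dist a b)\<^sup>2 = \<tau> * (\<Sum>s\<in>#spectral_values (quad_rep (jpow a (-1/2)) b). (ln s)\<^sup>2)" .
    then have "log_dist a b = sqrt (\<tau> * (\<Sum>s\<in>#spectral_values (quad_rep (jpow a (-1/2)) b). (ln s)\<^sup>2))"
      by (metis log_dist_def norm_ge_zero real_sqrt_unique)
    then show ?thesis using \<tau>(1) ab by (simp add: cone_dist_def real_sqrt_mult)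
  qed
  then show ?thesis using \<tau>(1) by (intro exI[of _ "1 / sqrt \<tau>"]) simp
qed

section \<open>Metric spaces with convex geodesics\<close>

text \<open>
  The inequality for all \<open>t\<close> is the comparison with a Euclidean triangle. It passes to products and
  along bijections, and at \<open>t = 1/2\<close> it is the semiparallelogram law.
\<close>

definition cat0_geodesics :: "'b set \<Rightarrow> ('b \<Rightarrow> 'b \<Rightarrow> real) \<Rightarrow> (real \<Rightarrow> 'b \<Rightarrow> 'b \<Rightarrow> 'b) \<Rightarrow> bool" where
  "cat0_geodesics M d g \<longleftrightarrow> (\<forall>x\<in>M. \<forall>y\<in>M. g 0 x y = x \<and> g 1 x y = y \<and>
     (\<forall>s\<in>{0..1}. \<forall>t\<in>{0..1}. d (g s x y) (g t x y) = \<bar>s - t\<bar> * d x y) \<and>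
     (\<forall>t\<in>{0..1}. g t x y \<in> M \<and> (\<forall>z\<in>M.
        (d (g t x y) z)\<^sup>2 \<le> (1 - t) * (d x z)\<^sup>2 + t * (d y z)\<^sup>2 - t * (1 - t) * (d x y)\<^sup>2)))"

lemma cat0_geodesicsD:
  assumes "cat0_geodesics M d g" "x \<in> M" "y \<in> M"
  shows "g 0 x y = x" "g 1 x y = y"
    "\<And>s t. s \<in> {0..1} \<Longrightarrow> t \<in> {0..1} \<Longrightarrow> d (g s x y) (g t x y) = \<bar>s - t\<bar> * d x y"
    "\<And>t. t \<in> {0..1} \<Longrightarrow> g t x y \<in> M"
    "\<And>t z. t \<in> {0..1} \<Longrightarrow> z \<in> M \<Longrightarrow>
      (d (g t x y) z)\<^sup>2 \<le> (1 - t) * (d x z)\<^sup>2 + t * (d y z)\<^sup>2 - t * (1 - t) * (d x y)\<^sup>2"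
  using assms unfolding cat0_geodesics_def by blast+

text \<open>
  Taking \<open>z\<close> itself as the test point makes the right-hand side of the inequality vanish.
\<close>

lemma cat0_point_unique:
  assumes "Metric_space M d" and g: "cat0_geodesics M d g" and M: "x \<in> M" "y \<in> M" "z \<in> M"
    and t: "t \<in> {0..1}" and z: "d x z = t * d x y" "d z y = (1 - t) * d x y"
  shows "z = g t x y"
proof -
  interpret Metric_space M d by fact
  have "(d (g t x y) z)\<^sup>2 \<le> (1 - t) * (d x z)\<^sup>2 + t * (d y z)\<^sup>2 - t * (1 - t) * (d x y)\<^sup>2"
    by (rule cat0_geodesicsD(5)[OF g M(1,2) t M(3)])
  also have "\<dots> = 0" by (simp add: z commute[of y z] power2_eq_square algebra_simps)
  finally have "d (g t x y) z = 0" by simp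
  then show ?thesis using cat0_geodesicsD(4)[OF g M(1,2) t] M(3) by simp
qed

lemma cat0_unique_geodesic:
  assumes "Metric_space M d" and g: "cat0_geodesics M d g" and M: "x \<in> M" "y \<in> M"
  shows "unique_geodesic_joining M d x y (\<lambda>t. g t x y)"
  unfolding unique_geodesic_joining_def
proof (intro conjI allI impI ballI)
  show "geodesic_joining M d x y (\<lambda>t. g t x y)"
    using cat0_geodesicsD[OF g M] by (auto simp: geodesic_joining_def)
  fix \<eta> :: "real \<Rightarrow> 'a" and t :: real
  assume e: "geodesic_joining M d x y \<eta>" and t: "t \<in> {0..1}"
  have dist: "d (\<eta> r) (\<eta> s) = \<bar>r - s\<bar> * d x y" if "r \<in> {0..1}" "s \<in> {0..1}" for r s
    using e that by (simp add: geodesic_joining_def)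
  have ends: "\<eta> 0 = x" "\<eta> 1 = y" "\<eta> t \<in> M" using e t by (auto simp: geodesic_joining_def)
  show "\<eta> t = g t x y"
    using dist[of 0 t] dist[of t 1] t
    by (intro cat0_point_unique[OF assms ends(3) t]) (auto simp: ends)
qed

lemma cat0_midpoint_iff:
  assumes "Metric_space M d" and g: "cat0_geodesics M d g" and M: "x \<in> M" "y \<in> M"
  shows "metric_midpoint M d x y m \<longleftrightarrow> m = g (1/2) x y"
proof
  assume "metric_midpoint M d x y m"
  then show "m = g (1/2) x y"
    by (intro cat0_point_unique[OF assms]) (auto simp: metric_midpoint_def)
next
  have h: "(1/2::real) \<in> {0..1}" "(0::real) \<in> {0..1}" "(1::real) \<in> {0..1}" by auto
  note c = cat0_geodesicsD[OF g M]
  assume "m = g (1/2) x y"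
  then show "metric_midpoint M d x y m"
    using c(3)[OF h(2,1)] c(3)[OF h(1,3)] c(4)[OF h(1)] by (simp add: metric_midpoint_def c(1,2))
qed

lemma cat0_hadamard:
  assumes "Metric_space M d" "Metric_space.mcomplete M d" and g: "cat0_geodesics M d g"
  shows "hadamard_space M d"
  unfolding hadamard_space_def
proof (intro conjI ballI)
  fix x y assume M: "x \<in> M" "y \<in> M"
  have h: "(1/2::real) \<in> {0..1}" by auto
  show "\<exists>m\<in>M. \<forall>z\<in>M. (d m z)\<^sup>2 \<le> (d x z)\<^sup>2 / 2 + (d y z)\<^sup>2 / 2 - (d x y)\<^sup>2 / 4"
    using cat0_geodesicsD(4)[OF g M h] cat0_geodesicsD(5)[OF g M h]
    by (intro bexI[of _ "g (1/2) x y"]) auto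
qed (use assms in auto)

lemma cat0_prod:
  assumes g: "cat0_geodesics M d g" and h: "cat0_geodesics N e h"
  shows "cat0_geodesics (M \<times> N) (prod_dist d e) (\<lambda>t p q. (g t (fst p) (fst q), h t (snd p) (snd q)))"
  unfolding cat0_geodesics_def
proof (intro ballI conjI)
  fix p q assume pq: "p \<in> M \<times> N" "q \<in> M \<times> N"
  have M: "fst p \<in> M" "fst q \<in> M" and N: "snd p \<in> N" "snd q \<in> N" using pq by auto
  note G = cat0_geodesicsD[OF g M] and H = cat0_geodesicsD[OF h N]
  show "(g 0 (fst p) (fst q), h 0 (snd p) (snd q)) = p" "(g 1 (fst p) (fst q), h 1 (snd p) (snd q)) = q"
    by (simp_all add: G(1,2) H(1,2))
  have sq: "(prod_dist d e p q)\<^sup>2 = (d (fst p) (fst q))\<^sup>2 + (e (snd p) (snd q))\<^sup>2" for p q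
    by (simp add: prod_dist_def case_prod_beta)
  show "prod_dist d e (g s (fst p) (fst q), h s (snd p) (snd q)) (g t (fst p) (fst q), h t (snd p) (snd q)) =
    \<bar>s - t\<bar> * prod_dist d e p q" if "s \<in> {0..1}" "t \<in> {0..1}" for s t
  proof -
    have "(\<bar>s - t\<bar> * d (fst p) (fst q))\<^sup>2 + (\<bar>s - t\<bar> * e (snd p) (snd q))\<^sup>2 =
      \<bar>s - t\<bar>\<^sup>2 * ((d (fst p) (fst q))\<^sup>2 + (e (snd p) (snd q))\<^sup>2)"
      by (simp only: power_mult_distrib distrib_left)
    then show ?thesis
      by (simp only: prod_dist_def case_prod_beta fst_conv snd_conv G(3)[OF that] H(3)[OF that]
          real_sqrt_mult real_sqrt_abs abs_abs)
  qed
  fix t :: real assume t: "t \<in> {0..1}"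
  show "(g t (fst p) (fst q), h t (snd p) (snd q)) \<in> M \<times> N" using G(4) H(4) t by auto
  fix r assume "r \<in> M \<times> N"
  then have r: "fst r \<in> M" "snd r \<in> N" by auto
  show "(prod_dist d e (g t (fst p) (fst q), h t (snd p) (snd q)) r)\<^sup>2 \<le>
     (1 - t) * (prod_dist d e p r)\<^sup>2 + t * (prod_dist d e q r)\<^sup>2 - t * (1 - t) * (prod_dist d e p q)\<^sup>2"
    using G(5)[OF t r(1)] H(5)[OF t r(2)] unfolding sq by (simp add: algebra_simps)
qed

lemma cat0_transport:
  assumes g: "cat0_geodesics M d g" and f: "bij_betw f M N"
    and iso: "\<And>p q. p \<in> M \<Longrightarrow> q \<in> M \<Longrightarrow> e (f p) (f q) = d p q"
    and h: "\<And>p q t. p \<in> M \<Longrightarrow> q \<in> M \<Longrightarrow> t \<in> {0..1} \<Longrightarrow> h t (f p) (f q) = f (g t p q)"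
  shows "cat0_geodesics N e h"
  unfolding cat0_geodesics_def
proof (intro ballI)
  fix x y assume "x \<in> N" "y \<in> N"
  then obtain p q where pq: "p \<in> M" "q \<in> M" "x = f p" "y = f q" using f by (auto simp: bij_betw_def)
  note G = cat0_geodesicsD[OF g pq(1,2)]
  have h': "h t x y = f (g t p q)" if "t \<in> {0..1}" for t using h pq that by blast
  have fM: "f r \<in> N" if "r \<in> M" for r using f that by (auto simp: bij_betw_def)
  have N: "\<exists>r\<in>M. z = f r" if "z \<in> N" for z using f that by (auto simp: bij_betw_def)
  show "h 0 x y = x \<and> h 1 x y = y \<and>
     (\<forall>s\<in>{0..1}. \<forall>t\<in>{0..1}. e (h s x y) (h t x y) = \<bar>s - t\<bar> * e x y) \<and>
     (\<forall>t\<in>{0..1}. h t x y \<in> N \<and> (\<forall>z\<in>N.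
        (e (h t x y) z)\<^sup>2 \<le> (1 - t) * (e x z)\<^sup>2 + t * (e y z)\<^sup>2 - t * (1 - t) * (e x y)\<^sup>2))"
    using G h' fM by (auto simp: iso pq dest!: N)
qed

lemma mcomplete_transport:
  assumes "Metric_space M d" "Metric_space N e" "Metric_space.mcomplete M d" and f: "bij_betw f M N"
    and iso: "\<And>p q. p \<in> M \<Longrightarrow> q \<in> M \<Longrightarrow> e (f p) (f q) = d p q"
  shows "Metric_space.mcomplete N e"
proof -
  interpret M: Metric_space M d by fact
  interpret N: Metric_space N e by fact
  show ?thesis unfolding N.mcomplete_def
  proof (intro allI impI)
    fix s assume s: "N.MCauchy s"
    then have sN: "s n \<in> N" for n by (auto simp: N.MCauchy_def)
    have "\<forall>n. \<exists>p. p \<in> M \<and> s n = f p" using f sN by (auto simp: bij_betw_def)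
    then obtain p where p: "\<And>n. p n \<in> M" "\<And>n. s n = f (p n)" by metis
    have "M.MCauchy p" using s p by (auto simp: N.MCauchy_def M.MCauchy_def iso)
    then obtain x where "limitin M.mtopology p x sequentially" using assms(3) M.mcomplete_def by blast
    then have "limitin N.mtopology s (f x) sequentially"
      using f by (auto simp: M.limit_metric_sequentially N.limit_metric_sequentially sN p iso bij_betw_def)
    then show "\<exists>x. limitin N.mtopology s x sequentially" by blast
  qed
qed

section \<open>The cone as a Hadamard space\<close>

lemma Metric_space_cone_dist:
  "Metric_space sym_cone (cone_dist :: 'a::simple_euclidean_jordan_algebra \<Rightarrow> 'a \<Rightarrow> real)"
proof -
  obtain \<kappa> where k: "\<kappa> > 0" "\<And>a b::'a. a \<in> sym_cone \<Longrightarrow> b \<in> sym_cone \<Longrightarrow> cone_dist a b = \<kappa> * log_dist a b"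
    using cone_dist_eq_log_dist by blast
  show ?thesis
  proof
    fix x y :: 'a
    show "0 \<le> cone_dist x y"
    proof (cases "x \<in> sym_cone \<and> y \<in> sym_cone")
      case True
      then show ?thesis using k(1) by (simp add: k(2) log_dist_def)
    qed (auto simp: cone_dist_def)
    show "cone_dist x y = cone_dist y x"
    proof (cases "x \<in> sym_cone \<and> y \<in> sym_cone")
      case True
      then show ?thesis using log_dist_sym[of x y] by (simp add: k(2))
    qed (auto simp: cone_dist_def)
  next
    fix x y :: 'a assume xy: "x \<in> sym_cone" "y \<in> sym_cone"
    show "cone_dist x y = 0 \<longleftrightarrow> x = y"
      using k(1) by (simp add: k(2)[OF xy] log_dist_eq_0_iff[OF xy])
    fix z :: 'a assume z: "z \<in> sym_cone"
    show "cone_dist x z \<le> cone_dist x y + cone_dist y z"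
      using log_dist_triangle[OF xy z] k(1) xy z by (simp add: k(2) flip: distrib_left)
  qed
qed

lemma cat0_cone_dist:
  fixes M :: "'a::simple_euclidean_jordan_algebra set"
  assumes M: "M \<subseteq> sym_cone" and g: "\<And>x y t. x \<in> M \<Longrightarrow> y \<in> M \<Longrightarrow> t \<in> {0..1} \<Longrightarrow> wgeo_mean t x y \<in> M"
  shows "cat0_geodesics M cone_dist wgeo_mean"
proof -
  obtain \<kappa> where k: "\<kappa> > 0" "\<And>a b::'a. a \<in> sym_cone \<Longrightarrow> b \<in> sym_cone \<Longrightarrow> cone_dist a b = \<kappa> * log_dist a b"
    using cone_dist_eq_log_dist by blast
  show ?thesis unfolding cat0_geodesics_def
  proof (intro ballI conjI)
    fix x y assume "x \<in> M" "y \<in> M"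
    then have xy: "x \<in> sym_cone" "y \<in> sym_cone" using M by auto
    show "wgeo_mean 0 x y = x" "wgeo_mean 1 x y = y" using xy by (simp_all add: wgeo_mean_0 wgeo_mean_1)
    show "cone_dist (wgeo_mean s x y) (wgeo_mean t x y) = \<bar>s - t\<bar> * cone_dist x y" for s t
      using xy by (simp add: k(2) log_dist_wgeo_mean)
    fix t :: real assume t: "t \<in> {0..1}"
    show "wgeo_mean t x y \<in> M" by (rule g) fact+
    fix z assume "z \<in> M"
    then have z: "z \<in> sym_cone" using M by auto
    have "\<kappa>\<^sup>2 * (log_dist (wgeo_mean t x y) z)\<^sup>2 \<le>
      \<kappa>\<^sup>2 * ((1 - t) * (log_dist x z)\<^sup>2 + t * (log_dist y z)\<^sup>2 - t * (1 - t) * (log_dist x y)\<^sup>2)"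
      using log_dist_wgeo_mean_le[OF xy z, of t] t by (intro mult_left_mono) auto
    then show "(cone_dist (wgeo_mean t x y) z)\<^sup>2 \<le>
      (1 - t) * (cone_dist x z)\<^sup>2 + t * (cone_dist y z)\<^sup>2 - t * (1 - t) * (cone_dist x y)\<^sup>2"
      using xy z by (simp add: k(2) power_mult_distrib algebra_simps)
  qed
qed

text \<open>
  Logarithms of a Cauchy sequence form a Cauchy sequence in norm. Its limit stays in the closed set
  \<open>F\<close>, and the gap function shows that the exponentials converge in the distance.
\<close>

lemma mcomplete_jexp_closed:
  fixes F :: "'a::simple_euclidean_jordan_algebra set"
  assumes F: "closed F"
  shows "Metric_space.mcomplete (jexp ` F) cone_dist"
proof -
  interpret C: Metric_space sym_cone "cone_dist :: 'a \<Rightarrow> 'a \<Rightarrow> real" by (rule Metric_space_cone_dist)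
  interpret Metric_space "jexp ` F" cone_dist by (rule C.subspace) auto
  obtain \<kappa> where k: "\<kappa> > 0" "\<And>a b::'a. a \<in> sym_cone \<Longrightarrow> b \<in> sym_cone \<Longrightarrow> cone_dist a b = \<kappa> * log_dist a b"
    using cone_dist_eq_log_dist by blast
  show ?thesis unfolding mcomplete_def
  proof (intro allI impI)
    fix s assume s: "MCauchy s"
    define u where "u n = jln (s n)" for n
    have s1: "s n \<in> jexp ` F" for n using s by (auto simp: MCauchy_def)
    have sn: "s n \<in> sym_cone" for n using s1[of n] by auto
    have su: "s n = jexp (u n)" and uF: "u n \<in> F" for n using s1[of n] by (auto simp: u_def)
    have "Cauchy u"
    proof (rule metric_CauchyI)
      fix \<epsilon> :: real assume "\<epsilon> > 0"
      then obtain N where N: "\<And>m n. m \<ge> N \<Longrightarrow> n \<ge> N \<Longrightarrow> cone_dist (s m) (s n) < \<kappa> * \<epsilon>"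
        using s k(1) unfolding MCauchy_def by (metis mult_pos_pos)
      have "dist (u m) (u n) < \<epsilon>" if "m \<ge> N" "n \<ge> N" for m n
      proof -
        have "dist (u m) (u n) \<le> log_dist (s m) (s n)"
          using norm_jln_diff_le_log_dist[OF sn sn] by (simp add: dist_norm u_def)
        also have "\<dots> < \<epsilon>" using N[OF that] k(1) by (simp add: k(2) sn)
        finally show ?thesis .
      qed
      then show "\<exists>N. \<forall>m\<ge>N. \<forall>n\<ge>N. dist (u m) (u n) < \<epsilon>" by blast
    qed
    then obtain v where v: "u \<longlonglongrightarrow> v" using Cauchy_convergent_iff convergent_def by blast
    have vF: "v \<in> F" using closed_sequentially[OF F] uF v by blast
    have gap: "(\<lambda>n. inv_gap (s n) (jexp v)) \<longlonglongrightarrow> 0" unfolding su by (rule inv_gap_tendsto[OF v])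
    have "limitin mtopology s (jexp v) sequentially"
      unfolding limit_metric_sequentially
    proof (intro conjI allI impI)
      fix \<epsilon> :: real assume e: "\<epsilon> > 0"
      have "(\<epsilon> / \<kappa>)\<^sup>2 > 0" using e k(1) by simp
      then obtain N where N: "\<And>n. n \<ge> N \<Longrightarrow> inv_gap (s n) (jexp v) < (\<epsilon> / \<kappa>)\<^sup>2"
        using order_tendstoD(2)[OF gap] unfolding eventually_sequentially by blast
      have "cone_dist (s n) (jexp v) < \<epsilon>" if "n \<ge> N" for n
      proof -
        have "(log_dist (s n) (jexp v))\<^sup>2 < (\<epsilon> / \<kappa>)\<^sup>2"
          using log_dist_le_inv_gap[OF sn, of "jexp v" n] N[OF that] by simp
        then have "log_dist (s n) (jexp v) < \<epsilon> / \<kappa>" by (rule power2_less_imp_less) (use e k(1) in simp)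
        then show ?thesis using k(1) by (simp add: k(2) sn field_simps)
      qed
      then show "\<exists>N. \<forall>n\<ge>N. s n \<in> jexp ` F \<and> cone_dist (s n) (jexp v) < \<epsilon>" using s1 by blast
    qed (use vF in blast)
    then show "\<exists>x. limitin mtopology s x sequentially" by blast
  qed
qed


section \<open>The Riccati equation\<close>

lemma geo_mean_in_sym_cone [simp, intro]:
  "a \<in> sym_cone \<Longrightarrow> b \<in> sym_cone \<Longrightarrow> geo_mean a b \<in> sym_cone"
  by (simp add: geo_mean_def)

lemma jpow_half_square:
  assumes "w \<in> sym_cone" shows "jpow (w \<odot> w) (1/2) = w"
proof -
  have "w \<odot> w = jpow w 2"
    using quad_rep_jpow_jpow[OF assms, of 1 0] assms by (simp add: quad_rep_jone_right)
  then show ?thesis using assms by (simp add: jpow_jpow)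
qed

lemma quad_rep_inverse_half:
  assumes "x \<in> sym_cone"
  shows "quad_rep (jpow x (1/2)) (jpow x (-1)) = jone"
    "quad_rep (jpow x (-1/2)) jone = jpow x (-1)"
  using quad_rep_jpow_jpow[OF assms, of "1/2" "-1"] quad_rep_jpow_jpow[OF assms, of "-1/2" 0] assms
  by simp_all

text \<open>
  For \<open>w = P(x\<^sup>-\<^sup>1\<^sup>/\<^sup>2) a\<close> the fundamental formula gives \<open>w\<^sup>2 = P(x\<^sup>-\<^sup>1\<^sup>/\<^sup>2) P(a) x\<^sup>-\<^sup>1\<close>. So the equation
  says that \<open>w\<^sup>2 = P(x\<^sup>-\<^sup>1\<^sup>/\<^sup>2) y\<close>, and square roots in the cone are unique.
\<close>

lemma riccati_iff:
  assumes a: "a \<in> sym_cone" and x: "x \<in> sym_cone" and y: "y \<in> sym_cone"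
  shows "quad_rep a (jpow x (-1)) = y \<longleftrightarrow> a = geo_mean x y"
proof -
  let ?h = "jpow x (1/2)" and ?k = "jpow x (-1/2)"
  have h: "?h \<in> sym_cone" and k: "?k \<in> sym_cone" using x by simp_all
  define w where "w = quad_rep ?k a"
  have w: "w \<in> sym_cone" using a k by (simp add: w_def)
  have "w \<odot> w = quad_rep w jone" by (simp add: quad_rep_jone_right)
  also have "\<dots> = quad_rep ?k (quad_rep a (quad_rep ?k jone))"
    unfolding w_def by (rule quad_rep_fundamental[OF k])
  also have "\<dots> = quad_rep ?k (quad_rep a (jpow x (-1)))"
    by (simp only: quad_rep_inverse_half[OF x])
  finally have ww: "w \<odot> w = quad_rep ?k (quad_rep a (jpow x (-1)))" .
  have aw: "a = quad_rep ?h w" by (simp add: w_def quad_rep_half_cancel[OF x])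
  show ?thesis
  proof
    assume "quad_rep a (jpow x (-1)) = y"
    then have "jpow (quad_rep ?k y) (1/2) = w" using jpow_half_square[OF w] ww by simp
    then show "a = geo_mean x y" using aw by (simp add: geo_mean_def wgeo_mean_def)
  next
    assume "a = geo_mean x y"
    then have "w = jpow (quad_rep ?k y) (1/2)"
      by (simp add: w_def geo_mean_def wgeo_mean_def quad_rep_half_cancel[OF x])
    then have "w \<odot> w = quad_rep ?k y"
      using quad_rep_half_jone(1)[of "quad_rep ?k y"] k y by (simp add: quad_rep_jone_right)
    then have "quad_rep ?h (quad_rep ?k (quad_rep a (jpow x (-1)))) = quad_rep ?h (quad_rep ?k y)"
      unfolding ww by simp
    then show "quad_rep a (jpow x (-1)) = y" by (simp add: quad_rep_half_cancel[OF x])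
  qed
qed

lemma jpow_minus_1_minus_1: "x \<in> sym_cone \<Longrightarrow> jpow (jpow x (-1)) (-1) = x"
  by (simp add: jpow_jpow)

text \<open>
  Inverting \<open>P(a) x\<^sup>-\<^sup>1 = y\<close> gives the Riccati equation with \<open>x\<close> and \<open>y\<close> exchanged.
\<close>

lemma geo_mean_commute:
  assumes x: "x \<in> sym_cone" and y: "y \<in> sym_cone"
  shows "geo_mean x y = geo_mean y x"
proof -
  let ?a = "geo_mean x y"
  have a: "?a \<in> sym_cone" using x y by simp
  have "quad_rep ?a (jpow x (-1)) = y" by (simp add: riccati_iff[OF a x y])
  then have "jpow y (-1) = quad_rep (jpow ?a (-1)) x"
    using jpow_minus_1_quad_rep[OF a, of "jpow x (-1)"] x by (simp add: jpow_minus_1_minus_1)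
  then have "quad_rep ?a (jpow y (-1)) = x" by (simp add: quad_rep_cancel(3)[OF a])
  then show ?thesis using riccati_iff[OF a y x] by blast
qed

lemma geo_mean_inverse:
  assumes x: "x \<in> sym_cone" and y: "y \<in> sym_cone"
  shows "geo_mean (jpow x (-1)) (jpow y (-1)) = jpow (geo_mean x y) (-1)"
proof -
  let ?a = "geo_mean x y"
  have a: "?a \<in> sym_cone" using x y by simp
  have "quad_rep ?a (jpow x (-1)) = y" by (simp add: riccati_iff[OF a x y])
  then have "quad_rep (jpow ?a (-1)) (jpow (jpow x (-1)) (-1)) = jpow y (-1)"
    using jpow_minus_1_quad_rep[OF a, of "jpow x (-1)"] x by simp
  then show ?thesis using riccati_iff[of "jpow ?a (-1)" "jpow x (-1)" "jpow y (-1)"] a x y by simp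
qed

lemma wgeo_mean_inverse:
  assumes x: "x \<in> sym_cone" and y: "y \<in> sym_cone"
  shows "wgeo_mean t (jpow x (-1)) (jpow y (-1)) = jpow (wgeo_mean t x y) (-1)"
proof -
  have k: "jpow x (1/2) \<in> sym_cone" "jpow x (-1/2) \<in> sym_cone" using x by simp_all
  define z where "z = quad_rep (jpow x (-1/2)) y"
  have z: "z \<in> sym_cone" using x y by (simp add: z_def)
  have "quad_rep (jpow x (1/2)) (jpow y (-1)) = jpow z (-1)"
    using jpow_minus_1_quad_rep[OF k(2) y] x by (simp add: z_def jpow_jpow)
  moreover have "jpow (wgeo_mean t x y) (-1) = quad_rep (jpow x (-1/2)) (jpow z (-t))"
    using jpow_minus_1_quad_rep[OF k(1), of "jpow z t"] x z
    by (simp add: wgeo_mean_def jpow_jpow flip: z_def[simplified])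
  ultimately show ?thesis using x z by (simp add: wgeo_mean_def jpow_jpow flip: z_def[simplified])
qed

section \<open>The factorization attached to an involution\<close>

lemma jordan_automorphism_preserves:
  assumes k: "jordan_automorphism k"
  shows "k (quad_rep x y) = quad_rep (k x) (k y)"
    "a \<in> sym_cone \<Longrightarrow> k a \<in> sym_cone"
    "a \<in> sym_cone \<Longrightarrow> k (jpow a s) = jpow (k a) s"
    "a \<in> sym_cone \<Longrightarrow> b \<in> sym_cone \<Longrightarrow> k (wgeo_mean s a b) = wgeo_mean s (k a) (k b)"
    "k (jexp u) = jexp (k u)"
proof -
  have lin: "linear k" and mult: "\<And>x y. k (x \<odot> y) = k x \<odot> k y"
    using k by (auto simp: jordan_automorphism_def)
  show P: "k (quad_rep x y) = quad_rep (k x) (k y)" for x y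
    by (simp add: quad_rep_def linear_diff[OF lin] linear_scale[OF lin] mult)
  show e: "k (jexp u) = jexp (k u)" for u by (simp add: jexp_def jordan_automorphism_jfun[OF k])
  show c: "k a \<in> sym_cone" if "a \<in> sym_cone" for a using that by (auto elim!: sym_coneE simp: e)
  show p: "k (jpow a s) = jpow (k a) s" if "a \<in> sym_cone" for a s
    using that by (auto elim!: sym_coneE simp: e jpow_jexp linear_scale[OF lin])
  show "k (wgeo_mean s a b) = wgeo_mean s (k a) (k b)" if "a \<in> sym_cone" "b \<in> sym_cone"
    using that by (simp add: wgeo_mean_def P p c)
qed

context
  fixes \<sigma> :: "'a::euclidean_jordan_algebra \<Rightarrow> 'a"
  assumes \<sigma>: "involutive_jordan_automorphism \<sigma>"
begin

lemma invol_automorphism: "jordan_automorphism \<sigma>" and invol_invol: "\<sigma> (\<sigma> x) = x" and invol_linear: "linear \<sigma>"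
  using \<sigma> by (auto simp: involutive_jordan_automorphism_def jordan_automorphism_def)

lemmas invol_preserves = jordan_automorphism_preserves[OF invol_automorphism]

lemma cone_plus_eq: "cone_plus \<sigma> = jexp ` {u. \<sigma> u = u}"
proof (intro equalityI subsetI)
  fix x assume "x \<in> cone_plus \<sigma>"
  then have x: "x \<in> sym_cone" "\<sigma> x = x" by (auto simp: cone_plus_def)
  obtain u where u: "x = jexp u" using x(1) by (rule sym_coneE)
  then have "\<sigma> u = u" using x(2) by (simp add: invol_preserves(5))
  then show "x \<in> jexp ` {u. \<sigma> u = u}" using u by blast
qed (auto simp: cone_plus_def invol_preserves(5))

lemma cone_minus_eq: "cone_minus \<sigma> = jexp ` {u. \<sigma> u = - u}"
proof (intro equalityI subsetI)
  fix x assume "x \<in> cone_minus \<sigma>"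
  then have x: "x \<in> sym_cone" "\<sigma> x = jpow x (-1)" by (auto simp: cone_minus_def)
  obtain u where u: "x = jexp u" using x(1) by (rule sym_coneE)
  then have "\<sigma> u = - u" using x(2) by (simp add: invol_preserves(5) jpow_jexp)
  then show "x \<in> jexp ` {u. \<sigma> u = - u}" using u by blast
qed (auto simp: cone_minus_def invol_preserves(5) jpow_jexp)

lemma continuous_invol: "continuous_on UNIV \<sigma>"
  using invol_linear by (simp add: linear_continuous_on linear_conv_bounded_linear)

lemma closed_fixed: "closed {u. \<sigma> u = u}" "closed {u. \<sigma> u = - u}"
  by (intro closed_Collect_eq continuous_invol continuous_intros)+

lemma wgeo_mean_cone_plus:
  assumes "x \<in> cone_plus \<sigma>" "y \<in> cone_plus \<sigma>"
  shows "wgeo_mean t x y \<in> cone_plus \<sigma>"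
  using assms by (simp add: cone_plus_def invol_preserves(4))

lemma wgeo_mean_cone_minus:
  assumes "x \<in> cone_minus \<sigma>" "y \<in> cone_minus \<sigma>"
  shows "wgeo_mean t x y \<in> cone_minus \<sigma>"
  using assms by (simp add: cone_minus_def invol_preserves(4) wgeo_mean_inverse)

lemma factor_map_in_sym_cone:
  assumes "a \<in> cone_plus \<sigma>" "b \<in> cone_minus \<sigma>"
  shows "factor_map (a, b) \<in> sym_cone"
  using assms by (simp add: factor_map_def cone_plus_def cone_minus_def)

text \<open>
  Applying \<open>\<sigma>\<close> to \<open>x = P(a\<^sup>1\<^sup>/\<^sup>2) b\<close> and inverting it give two expressions in \<open>b\<^sup>-\<^sup>1\<close>, which combine to
  \<open>P(a) x\<^sup>-\<^sup>1 = \<sigma>(x)\<close>.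
\<close>

lemma factors_determined:
  assumes a: "a \<in> cone_plus \<sigma>" and b: "b \<in> cone_minus \<sigma>" and x: "x = factor_map (a, b)"
  shows "a = geo_mean x (\<sigma> x)" "b = spec_mean x (\<sigma> (jpow x (-1)))"
proof -
  have a': "a \<in> sym_cone" "\<sigma> a = a" using a by (auto simp: cone_plus_def)
  have b': "b \<in> sym_cone" "\<sigma> b = jpow b (-1)" using b by (auto simp: cone_minus_def)
  let ?h = "jpow a (1/2)"
  have h: "?h \<in> sym_cone" "\<sigma> ?h = ?h" using a' by (simp_all add: invol_preserves(3))
  have x': "x = quad_rep ?h b" "x \<in> sym_cone" using x factor_map_in_sym_cone[OF a b] by (simp_all add: factor_map_def)
  have sx: "\<sigma> x = quad_rep ?h (jpow b (-1))" "\<sigma> x \<in> sym_cone"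
    using x' by (simp_all add: invol_preserves(1,2) h b')
  have "jpow x (-1) = quad_rep (jpow a (-1/2)) (jpow b (-1))"
    unfolding x'(1) using jpow_minus_1_quad_rep[OF h(1) b'(1)] a' by (simp add: jpow_jpow)
  then have "quad_rep a (jpow x (-1)) = quad_rep ?h (jpow b (-1))"
    using quad_rep_jpow_add[OF a'(1), of 1 "-1/2"] a' by simp
  then show geo: "a = geo_mean x (\<sigma> x)"
    using riccati_iff[OF a'(1) x'(2) sx(2)] sx(1) by simp
  have "geo_mean (jpow x (-1)) (\<sigma> (jpow x (-1))) = jpow a (-1)"
    using geo_mean_inverse[OF x'(2) sx(2)] x'(2) by (simp add: invol_preserves(3) flip: geo)
  then have "spec_mean x (\<sigma> (jpow x (-1))) = quad_rep (jpow a (-1/2)) x"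
    using a' by (simp add: spec_mean_def jpow_jpow)
  then show "b = spec_mean x (\<sigma> (jpow x (-1)))"
    unfolding x'(1) by (simp add: quad_rep_half_cancel[OF a'(1)])
qed

text \<open>
  For \<open>a = x # \<sigma>(x)\<close> the symmetry of the mean gives \<open>\<sigma>(a) = a\<close>, and the Riccati equation
  \<open>P(a) x\<^sup>-\<^sup>1 = \<sigma>(x)\<close> says that \<open>\<sigma>\<close> inverts \<open>b = P(a\<^sup>-\<^sup>1\<^sup>/\<^sup>2) x\<close>.
\<close>

lemma factorization_exists:
  assumes x: "x \<in> sym_cone"
  shows "\<exists>a\<in>cone_plus \<sigma>. \<exists>b\<in>cone_minus \<sigma>. x = factor_map (a, b)"
proof -
  have sx: "\<sigma> x \<in> sym_cone" using x by (rule invol_preserves(2))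
  define a where "a = geo_mean x (\<sigma> x)"
  have a: "a \<in> sym_cone" using x sx by (simp add: a_def)
  have "\<sigma> a = geo_mean (\<sigma> x) x"
    using invol_preserves(4)[OF x sx] by (simp add: a_def geo_mean_def invol_invol)
  then have sa: "\<sigma> a = a" using geo_mean_commute[OF x sx] by (simp add: a_def)
  let ?k = "jpow a (-1/2)" and ?h = "jpow a (1/2)"
  have k: "?k \<in> sym_cone" "\<sigma> ?k = ?k" using a sa by (simp_all add: invol_preserves(3))
  define b where "b = quad_rep ?k x"
  have b: "b \<in> sym_cone" using k x by (simp add: b_def)
  have "quad_rep a (jpow x (-1)) = \<sigma> x" using riccati_iff[OF a x sx] by (simp add: a_def)
  then have "quad_rep ?k (\<sigma> x) = quad_rep ?h (jpow x (-1))"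
    using quad_rep_jpow_add[OF a, of "-1/2" 1 "jpow x (-1)"] a by simp
  also have "\<dots> = jpow b (-1)"
    unfolding b_def using jpow_minus_1_quad_rep[OF k(1) x] a by (simp add: jpow_jpow)
  finally have "\<sigma> b = jpow b (-1)" using k by (simp add: b_def invol_preserves(1))
  then have "a \<in> cone_plus \<sigma>" "b \<in> cone_minus \<sigma>" using a b sa by (auto simp: cone_plus_def cone_minus_def)
  moreover have "x = factor_map (a, b)" by (simp add: factor_map_def b_def quad_rep_half_cancel[OF a])
  ultimately show ?thesis by blast
qed

lemma factor_map_bij: "bij_betw factor_map (cone_plus \<sigma> \<times> cone_minus \<sigma>) sym_cone"
  unfolding bij_betw_def
proof
  show "inj_on factor_map (cone_plus \<sigma> \<times> cone_minus \<sigma>)"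
  proof (rule inj_onI)
    fix p q assume p: "p \<in> cone_plus \<sigma> \<times> cone_minus \<sigma>" and q: "q \<in> cone_plus \<sigma> \<times> cone_minus \<sigma>"
      and eq: "factor_map p = factor_map q"
    obtain a b c d where *: "p = (a, b)" "q = (c, d)" by fastforce
    show "p = q"
      using factors_determined[of a b "factor_map p"] factors_determined[of c d "factor_map p"] p q eq
      unfolding * by simp
  qed
  show "factor_map ` (cone_plus \<sigma> \<times> cone_minus \<sigma>) = sym_cone"
  proof (intro equalityI subsetI)
    fix x :: 'a assume "x \<in> sym_cone"
    then show "x \<in> factor_map ` (cone_plus \<sigma> \<times> cone_minus \<sigma>)" using factorization_exists by blast
  qed (use factor_map_in_sym_cone in auto)
qed

lemma factors_factor_map:
  "a \<in> cone_plus \<sigma> \<Longrightarrow> b \<in> cone_minus \<sigma> \<Longrightarrow> factors \<sigma> (factor_map (a, b)) = (a, b)"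
  unfolding factors_def by (rule bij_betw_inv_into_left[OF factor_map_bij]) simp

lemma sigma_geod_factor_map:
  assumes "p \<in> cone_plus \<sigma> \<times> cone_minus \<sigma>" "q \<in> cone_plus \<sigma> \<times> cone_minus \<sigma>"
  shows "sigma_geod \<sigma> t (factor_map p) (factor_map q) =
    factor_map (wgeo_mean t (fst p) (fst q), wgeo_mean t (snd p) (snd q))"
  using assms by (auto simp: sigma_geod_def factors_factor_map)

lemma sigma_dist_factor_map:
  assumes "p \<in> cone_plus \<sigma> \<times> cone_minus \<sigma>" "q \<in> cone_plus \<sigma> \<times> cone_minus \<sigma>"
  shows "sigma_dist \<sigma> (factor_map p) (factor_map q) = prod_dist cone_dist cone_dist p q"
  using assms by (auto simp: sigma_dist_def factors_factor_map factor_map_in_sym_cone prod_dist_def)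

end

theorem proposition7p1:
  fixes \<sigma> :: "'a::simple_euclidean_jordan_algebra \<Rightarrow> 'a"
  assumes "involutive_jordan_automorphism \<sigma>"
  shows
    "hadamard_space sym_cone (sigma_dist \<sigma>) \<and>
     metric_isometry (cone_plus \<sigma> \<times> cone_minus \<sigma>) (prod_dist cone_dist cone_dist)
       sym_cone (sigma_dist \<sigma>) factor_map \<and>
     (\<forall>a1\<in>cone_plus \<sigma>. \<forall>b1\<in>cone_minus \<sigma>. \<forall>a2\<in>cone_plus \<sigma>. \<forall>b2\<in>cone_minus \<sigma>. \<forall>x y.
        x = factor_map (a1, b1) \<and> y = factor_map (a2, b2) \<longrightarrow>
          (\<forall>t\<in>{0..1}.
             wgeo_mean t a1 a2 \<in> cone_plus \<sigma> \<and> wgeo_mean t b1 b2 \<in> cone_minus \<sigma> \<and>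
             sigma_geod \<sigma> t x y = factor_map (wgeo_mean t a1 a2, wgeo_mean t b1 b2)) \<and>
          unique_geodesic_joining sym_cone (sigma_dist \<sigma>) x y (\<lambda>t. sigma_geod \<sigma> t x y) \<and>
          (\<forall>m. metric_midpoint sym_cone (sigma_dist \<sigma>) x y m \<longleftrightarrow> m = sigma_geod \<sigma> (1/2) x y) \<and>
          sigma_geod \<sigma> (1/2) x y = factor_map (geo_mean a1 a2, geo_mean b1 b2)) \<and>
     (\<forall>x\<in>sym_cone. \<forall>y\<in>sym_cone.
        let a = geo_mean (geo_mean x (\<sigma> x)) (geo_mean y (\<sigma> y));
            b = geo_mean (spec_mean x (\<sigma> (jpow x (-1)))) (spec_mean y (\<sigma> (jpow y (-1))))
        in sigma_geod \<sigma> (1/2) x y = quad_rep (jpow a (1/2)) b)"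
proof -
  note \<sigma> = assms
  let ?F = "cone_plus \<sigma> \<times> cone_minus \<sigma>" and ?d = "prod_dist cone_dist (cone_dist :: 'a \<Rightarrow> 'a \<Rightarrow> real)"
  interpret C: Metric_space sym_cone "cone_dist :: 'a \<Rightarrow> 'a \<Rightarrow> real" by (rule Metric_space_cone_dist)
  have plus: "cone_plus \<sigma> \<subseteq> sym_cone" and minus: "cone_minus \<sigma> \<subseteq> sym_cone"
    by (auto simp: cone_plus_def cone_minus_def)
  interpret P: Metric_space12 "cone_plus \<sigma>" cone_dist "cone_minus \<sigma>" cone_dist
    by (intro Metric_space12.intro C.subspace plus minus)
  note bij = factor_map_bij[OF \<sigma>] and iso = sigma_dist_factor_map[OF \<sigma>]
  have geo_F: "cat0_geodesics ?F ?d (\<lambda>t p q. (wgeo_mean t (fst p) (fst q), wgeo_mean t (snd p) (snd q)))"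
    by (intro cat0_prod cat0_cone_dist plus minus wgeo_mean_cone_plus[OF \<sigma>] wgeo_mean_cone_minus[OF \<sigma>])
  have geo: "cat0_geodesics sym_cone (sigma_dist \<sigma>) (sigma_geod \<sigma>)"
  proof (rule cat0_transport[OF geo_F bij])
    show "sigma_dist \<sigma> (factor_map p) (factor_map q) = ?d p q" if "p \<in> ?F" "q \<in> ?F" for p q
      using that by (rule iso)
    show "sigma_geod \<sigma> t (factor_map p) (factor_map q) =
        factor_map (wgeo_mean t (fst p) (fst q), wgeo_mean t (snd p) (snd q))"
      if "p \<in> ?F" "q \<in> ?F" "t \<in> {0..1}" for p q t
      using that(1,2) by (rule sigma_geod_factor_map[OF \<sigma>])
  qed
  have met: "Metric_space sym_cone (sigma_dist \<sigma>)"
  proof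
    fix x y :: 'a
    show "0 \<le> sigma_dist \<sigma> x y" by (auto simp: sigma_dist_def case_prod_beta)
    show "sigma_dist \<sigma> x y = sigma_dist \<sigma> y x" by (auto simp: sigma_dist_def case_prod_beta C.commute)
  next
    fix x y z :: 'a assume "x \<in> sym_cone" "y \<in> sym_cone"
    then obtain p q where pq: "p \<in> ?F" "q \<in> ?F" "x = factor_map p" "y = factor_map q"
      using bij unfolding bij_betw_def by blast
    show "sigma_dist \<sigma> x y = 0 \<longleftrightarrow> x = y"
      using P.Prod_metric.zero[OF pq(1,2)] inj_on_eq_iff[OF bij_betw_imp_inj_on[OF bij] pq(1,2)] pq
      by (simp add: iso)
    assume "z \<in> sym_cone"
    then obtain r where "r \<in> ?F" "z = factor_map r" using bij unfolding bij_betw_def by blast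
    then show "sigma_dist \<sigma> x z \<le> sigma_dist \<sigma> x y + sigma_dist \<sigma> y z"
      using P.Prod_metric.triangle[OF pq(1,2)] pq by (simp add: iso)
  qed
  have "P.M1.mcomplete" "P.M2.mcomplete"
    using mcomplete_jexp_closed[OF closed_fixed(1)[OF \<sigma>]] mcomplete_jexp_closed[OF closed_fixed(2)[OF \<sigma>]]
    by (simp_all only: cone_plus_eq[OF \<sigma>] cone_minus_eq[OF \<sigma>])
  then have "P.Prod_metric.mcomplete" by (simp add: P.mcomplete_prod_metric)
  then have "Metric_space.mcomplete sym_cone (sigma_dist \<sigma>)"
    using mcomplete_transport[OF P.prod_metric met _ bij] iso by blast
  then have hadamard: "hadamard_space sym_cone (sigma_dist \<sigma>)"
    by (rule cat0_hadamard[OF met _ geo])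
  have isometry: "metric_isometry ?F ?d sym_cone (sigma_dist \<sigma>) factor_map"
    unfolding metric_isometry_def using P.prod_metric met bij iso by blast
  have part3: "(\<forall>t\<in>{0..1}.
       wgeo_mean t a1 a2 \<in> cone_plus \<sigma> \<and> wgeo_mean t b1 b2 \<in> cone_minus \<sigma> \<and>
       sigma_geod \<sigma> t x y = factor_map (wgeo_mean t a1 a2, wgeo_mean t b1 b2)) \<and>
    unique_geodesic_joining sym_cone (sigma_dist \<sigma>) x y (\<lambda>t. sigma_geod \<sigma> t x y) \<and>
    (\<forall>m. metric_midpoint sym_cone (sigma_dist \<sigma>) x y m \<longleftrightarrow> m = sigma_geod \<sigma> (1/2) x y) \<and>
    sigma_geod \<sigma> (1/2) x y = factor_map (geo_mean a1 a2, geo_mean b1 b2)"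
    if F: "a1 \<in> cone_plus \<sigma>" "b1 \<in> cone_minus \<sigma>" "a2 \<in> cone_plus \<sigma>" "b2 \<in> cone_minus \<sigma>"
      and xy: "x = factor_map (a1, b1)" "y = factor_map (a2, b2)" for a1 b1 a2 b2 x y
  proof -
    have cone: "x \<in> sym_cone" "y \<in> sym_cone" using factor_map_in_sym_cone[OF \<sigma>] F xy by auto
    have "sigma_geod \<sigma> t x y = factor_map (wgeo_mean t a1 a2, wgeo_mean t b1 b2)" for t
      using sigma_geod_factor_map[OF \<sigma>, of "(a1, b1)" "(a2, b2)"] F xy by simp
    then show ?thesis
      using wgeo_mean_cone_plus[OF \<sigma> F(1,3)] wgeo_mean_cone_minus[OF \<sigma> F(2,4)]
        cat0_unique_geodesic[OF met geo cone] cat0_midpoint_iff[OF met geo cone]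
      unfolding geo_mean_def by blast
  qed
  have part4: "sigma_geod \<sigma> (1/2) x y =
      quad_rep (jpow (geo_mean (geo_mean x (\<sigma> x)) (geo_mean y (\<sigma> y))) (1/2))
        (geo_mean (spec_mean x (\<sigma> (jpow x (-1)))) (spec_mean y (\<sigma> (jpow y (-1)))))"
    if "x \<in> sym_cone" "y \<in> sym_cone" for x y
  proof -
    obtain a1 b1 where 1: "a1 \<in> cone_plus \<sigma>" "b1 \<in> cone_minus \<sigma>" "x = factor_map (a1, b1)"
      using factorization_exists[OF \<sigma> \<open>x \<in> sym_cone\<close>] by blast
    obtain a2 b2 where 2: "a2 \<in> cone_plus \<sigma>" "b2 \<in> cone_minus \<sigma>" "y = factor_map (a2, b2)"
      using factorization_exists[OF \<sigma> \<open>y \<in> sym_cone\<close>] by blast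
    have "sigma_geod \<sigma> (1/2) x y = factor_map (geo_mean a1 a2, geo_mean b1 b2)"
      using part3[OF 1(1,2) 2(1,2) 1(3) 2(3)] by blast
    then show ?thesis
      unfolding factors_determined[OF \<sigma> 1, symmetric] factors_determined[OF \<sigma> 2, symmetric]
      by (simp add: factor_map_def)
  qed
  show ?thesis
    unfolding Let_def by (intro conjI hadamard isometry ballI allI impI) (use part3 part4 in blast)+
qed


end
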